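(* Let $\rho>0$ and $\mu\in\mathbb{R}^r$, and let $\{z^l\}_{l\in\mathbb{N}}$ be the sequence generated by the inexact proximal regularised block-coordinate descent scheme described in the context (run without its stopping test), from any starting point $z^0=(z^0_1,\ldots,z^0_N)\in\mathcal{Z}_1\times\cdots\times\mathcal{Z}_N$. Then $\{z^l\}$ converges to a point $z^\ast$ satisfying $$0\in\nabla_zL_\rho(z^\ast,\mu)+\mathcal{N}_{\mathcal{Z}}(z^\ast),$$ or equivalently $d\big(0,\nabla_zL_\rho(z^\ast,\mu)+\mathcal{N}_{\mathcal{Z}}(z^\ast)\big)=0$.
   Context: Setting. Let $N\ge 1$, $n=\sum_{i=1}^N n_i$, $z=(z_1,\ldots,z_N)\in\mathbb{R}^n$ with $z_i\in\mathbb{R}^{n_i}$. Let $J(z)=\sum_{i=1}^N J_i(z_i)+Q(z)$ with $J_i:\mathbb{R}^{n_i}\to\mathbb{R}$, $Q:\mathbb{R}^n\to\mathbb{R}$, and $H(z)=(F_1(z_1)^\top,\ldots,F_N(z_N)^\top,G(z)^\top)^\top\in\mathbb{R}^r$ with $F_i:\mathbb{R}^{n_i}\to\mathbb{R}^{m_i}$, $G:\mathbb{R}^n\to\mathbb{R}^p$, $r=\sum_i m_i+p$. The functions $J_i,Q,F_i,G$ are twice continuously differentiable and semi-algebraic. Each $\mathcal{Z}_i\subset\mathbb{R}^{n_i}$ is a (bounded) polytope and $\mathcal{Z}=\mathcal{Z}_1\times\cdots\times\mathcal{Z}_N$. Augmented Lagrangian: $L_\rho(z,\mu)=J(z)+\mu^\top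 H(z)+\frac{\rho}{2}\|H(z)\|_2^2$ for $\mu\in\mathbb{R}^r$, $\rho>0$. Normal cone: $\mathcal{N}_\Omega(\bar x)=\{v: v^\top(x-\bar x)\le 0\ \forall x\in\Omega\}$ for $\Omega$ convex, $\bar x\in\Omega$. Distance: $d(x,S)=\inf_{y\in S}\|x-y\|_2$. Algorithm. Given $z^l$, for $i=1,\ldots,N$ in order, $$z_i^{l+1}=\operatorname*{argmin}_{z_i\in\mathcal{Z}_i}\ \nabla_{z_i}L_\rho(z_1^{l+1},\ldots,z_{i-1}^{l+1},z_i^l,\ldots,z_N^l,\mu)^\top(z_i-z_i^l)+\tfrac12(z_i-z_i^l)^\top(B_i^l+\alpha_i^lI_{n_i})(z_i-z_i^l).$$ The $\alpha_i^l$ are real numbers such that for every $i$ there are constants $0<\alpha_i^-<\alpha_i^+$ with $\alpha_i^l\in[\alpha_i^-,\alpha_i^+]$ for all $l\in\mathbb{N}$. The $B_i^l\in\mathbb{R}^{n_i\times n_i}$ are symmetric positive definite. Constants $C_i$. Write $\mu=(\mu_1,\ldots,\mu_N,\mu_G)$ with $\mu_i\in\mathbb{R}^{m_i}$ the multipliers of $F_i(z_i)=0$ and $\mu_G\in\mathbb{R}^p$ those of $G(z)=0$. Put $\Psi_i(z_i)=\mu_i^\top F_i(z_i)+\frac\rho2\|F_i(z_i)\|_2^2$ and $S(z)=\mu_G^\top G(z)+\frac\rho2\|G(z)\|_2^2$. For a $C^2$ function $f$ and a compact set $\Omega$, $\|\nabla^2f\|_\infty^\Omega=\max_{x\in\Omega}\|\nabla^2f(x)\|_2$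 (induced matrix 2-norm), and $\nabla_j^2$ is the Hessian with respect to the block $z_j$. Define $$C_i=\|\nabla^2J_i\|_\infty^{\mathcal{Z}_i}+\|\nabla^2\Psi_i\|_\infty^{\mathcal{Z}_i}+\max_{j\in\{1,\ldots,N\}}\|\nabla_j^2(S+Q)\|_\infty^{\mathcal{Z}}.$$ Standing assumption: $B_i^l-C_iI_{n_i}\succ0$ and $2C_iI_{n_i}-B_i^l\succ0$ for all $i\in\{1,\ldots,N\}$ and $l\in\mathbb{N}$. *)

theory Defs
  imports "HOL-Analysis.Analysis"
begin

section \<open>Block-structured vectors\<close>

text \<open>
  A product of Euclidean spaces of differing dimensions is encoded by one type \<open>real^'n\<close> together
  with a labelling \<open>b\<close> that sends every coordinate to the label of the block owning it. The factor
  with label \<open>i\<close> is the coordinate subspace \<open>block_space b i\<close>, of dimension \<open>card {k. b k = i}\<close>, so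
  that an element of the factor is a vector of \<open>real^'n\<close> padded with zeros. Functions on a factor
  are functions on \<open>real^'n\<close> that are only ever applied to points of \<open>block_space b i\<close>.
\<close>

definition block_space :: "('n::finite \<Rightarrow> 'l) \<Rightarrow> 'l \<Rightarrow> (real^'n) set" where
  "block_space b i = {x. \<forall>k. b k \<noteq> i \<longrightarrow> x $ k = 0}"

definition block :: "('n::finite \<Rightarrow> 'l) \<Rightarrow> 'l \<Rightarrow> real^'n \<Rightarrow> real^'n" where
  "block b i x = (\<chi> k. if b k = i then x $ k else 0)"

definition block_mat :: "('n::finite \<Rightarrow> 'l) \<Rightarrow> 'l \<Rightarrow> real^'n^'n \<Rightarrow> real^'n^'n" where
  "block_mat b i A = (\<chi> k l. if b k = i \<and> b l = i then A $ k $ l else 0)"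

text \<open>Positive definiteness of the diagonal block of \<open>A\<close> with label \<open>i\<close>.\<close>

definition block_pos_def :: "('n::finite \<Rightarrow> 'l) \<Rightarrow> 'l \<Rightarrow> real^'n^'n \<Rightarrow> bool" where
  "block_pos_def b i A \<longleftrightarrow> (\<forall>x\<in>block_space b i. x \<noteq> 0 \<longrightarrow> x \<bullet> (A *v x) > 0)"

definition block_prod :: "('n::finite \<Rightarrow> nat) \<Rightarrow> nat \<Rightarrow> (nat \<Rightarrow> (real^'n) set) \<Rightarrow> (real^'n) set" where
  "block_prod b N Zs = {z. \<forall>i\<in>{1..N}. block b i z \<in> Zs i}"


section \<open>Derivatives\<close>

definition gradient :: "(real^'n::finite \<Rightarrow> real) \<Rightarrow> real^'n \<Rightarrow> real^'n" where
  "gradient f x = (\<chi> k. frechet_derivative f (at x) (axis k 1))"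

definition hessian :: "(real^'n::finite \<Rightarrow> real) \<Rightarrow> real^'n \<Rightarrow> real^'n^'n" where
  "hessian f x = jacobian (gradient f) (at x)"

definition C2 :: "(real^'n::finite \<Rightarrow> real) \<Rightarrow> bool" where
  "C2 f \<longleftrightarrow> (\<forall>x. f differentiable (at x)) \<and> (\<forall>x. gradient f differentiable (at x))
     \<and> continuous_on UNIV (hessian f)"

text \<open>
  The maximum over \<open>\<Omega>\<close> of the induced 2-norm of the Hessian with respect to block \<open>i\<close>; padding the
  block with zeros does not change its norm. The supremum is a maximum when \<open>f\<close> is \<open>C2\<close> and \<open>\<Omega>\<close> is
  compact and nonempty.
\<close>

definition hess_bound ::
    "('n::finite \<Rightarrow> 'l) \<Rightarrow> 'l \<Rightarrow> (real^'n \<Rightarrow> real) \<Rightarrow> (real^'n) set \<Rightarrow> real" where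
  "hess_bound b i f \<Omega> = (SUP x\<in>\<Omega>. onorm (\<lambda>v. block_mat b i (hessian f x) *v v))"


section \<open>Semi-algebraic sets and functions\<close>

definition semialgebraic :: "'a::euclidean_space set \<Rightarrow> bool" where
  "semialgebraic S \<longleftrightarrow>
     (\<exists>\<C> :: (('a \<Rightarrow> real) set \<times> ('a \<Rightarrow> real) set) set.
        finite \<C> \<and>
        (\<forall>(P, R)\<in>\<C>. finite P \<and> finite R \<and> (\<forall>p\<in>P \<union> R. real_polynomial_function p)) \<and>
        S = (\<Union>(P, R)\<in>\<C>. {x. (\<forall>p\<in>P. p x = 0) \<and> (\<forall>q\<in>R. q x < 0)}))"

definition semialgebraic_on ::
    "'a::euclidean_space set \<Rightarrow> ('a \<Rightarrow> 'b::euclidean_space) \<Rightarrow> bool" where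
  "semialgebraic_on D f \<longleftrightarrow> semialgebraic ((\<lambda>x. (x, f x)) ` D)"


section \<open>Normal cone\<close>

definition normal_cone :: "'a::real_inner set \<Rightarrow> 'a \<Rightarrow> 'a set" where
  "normal_cone \<Omega> x = {v. \<forall>y\<in>\<Omega>. v \<bullet> (y - x) \<le> 0}"


section \<open>The optimisation problem\<close>

text \<open>
  The rows of the constraint map are labelled by \<open>c\<close>: rows with label \<open>Some i\<close> belong to the
  constraint \<open>F i\<close> on block \<open>i\<close>, rows with label \<open>None\<close> to the coupling constraint \<open>G\<close>.
\<close>

definition objective ::
    "('n::finite \<Rightarrow> nat) \<Rightarrow> nat \<Rightarrow> (nat \<Rightarrow> real^'n \<Rightarrow> real) \<Rightarrow> (real^'n \<Rightarrow> real) \<Rightarrow> real^'n \<Rightarrow> real" where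
  "objective b N J Q z = (\<Sum>i=1..N. J i (block b i z)) + Q z"

definition constraint_map ::
    "('n::finite \<Rightarrow> nat) \<Rightarrow> ('r::finite \<Rightarrow> nat option) \<Rightarrow> (nat \<Rightarrow> real^'n \<Rightarrow> real^'r)
      \<Rightarrow> (real^'n \<Rightarrow> real^'r) \<Rightarrow> real^'n \<Rightarrow> real^'r" where
  "constraint_map b c F G z =
     (\<chi> k. case c k of Some i \<Rightarrow> F i (block b i z) $ k | None \<Rightarrow> G z $ k)"

definition aug_lagrangian ::
    "(real^'n::finite \<Rightarrow> real) \<Rightarrow> (real^'n \<Rightarrow> real^'r::finite) \<Rightarrow> real \<Rightarrow> real^'r \<Rightarrow> real^'n \<Rightarrow> real" where
  "aug_lagrangian Jt H \<rho> \<mu> z = Jt z + \<mu> \<bullet> H z + \<rho> / 2 * (norm (H z))\<^sup>2"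

definition penalty ::
    "(real^'n::finite \<Rightarrow> real^'r::finite) \<Rightarrow> real \<Rightarrow> real^'r \<Rightarrow> real^'n \<Rightarrow> real" where
  "penalty h \<rho> \<nu> x = \<nu> \<bullet> h x + \<rho> / 2 * (norm (h x))\<^sup>2"

definition curvature_const ::
    "('n::finite \<Rightarrow> nat) \<Rightarrow> ('r::finite \<Rightarrow> nat option) \<Rightarrow> nat \<Rightarrow> (nat \<Rightarrow> real^'n \<Rightarrow> real)
      \<Rightarrow> (real^'n \<Rightarrow> real) \<Rightarrow> (nat \<Rightarrow> real^'n \<Rightarrow> real^'r) \<Rightarrow> (real^'n \<Rightarrow> real^'r)
      \<Rightarrow> (nat \<Rightarrow> (real^'n) set) \<Rightarrow> real \<Rightarrow> real^'r \<Rightarrow> nat \<Rightarrow> real" where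
  "curvature_const b c N J Q F G Zs \<rho> \<mu> i =
     hess_bound b i (\<lambda>x. J i (block b i x)) (Zs i)
   + hess_bound b i (\<lambda>x. penalty (F i) \<rho> (block c (Some i) \<mu>) (block b i x)) (Zs i)
   + (MAX j\<in>{1..N}. hess_bound b j (\<lambda>z. penalty G \<rho> (block c None \<mu>) z + Q z) (block_prod b N Zs))"


section \<open>The proximal block-coordinate scheme\<close>

text \<open>The point \<open>(y\<^sub>1, \<dots>, y\<^sub>i\<^sub>-\<^sub>1, x\<^sub>i, \<dots>, x\<^sub>N)\<close>.\<close>

definition sweep_point :: "('n::finite \<Rightarrow> nat) \<Rightarrow> nat \<Rightarrow> real^'n \<Rightarrow> real^'n \<Rightarrow> real^'n" where
  "sweep_point b i y x = (\<chi> k. if b k < i then y $ k else x $ k)"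

definition bcd_sequence ::
    "('n::finite \<Rightarrow> nat) \<Rightarrow> nat \<Rightarrow> (real^'n \<Rightarrow> real) \<Rightarrow> (nat \<Rightarrow> (real^'n) set)
      \<Rightarrow> (nat \<Rightarrow> nat \<Rightarrow> real^'n^'n) \<Rightarrow> (nat \<Rightarrow> nat \<Rightarrow> real) \<Rightarrow> (nat \<Rightarrow> real^'n) \<Rightarrow> bool" where
  "bcd_sequence b N L Zs B \<alpha> z \<longleftrightarrow>
     z 0 \<in> block_prod b N Zs \<and>
     (\<forall>l. \<forall>i\<in>{1..N}.
        is_arg_min
          (\<lambda>x. block b i (gradient L (sweep_point b i (z (Suc l)) (z l))) \<bullet> (x - block b i (z l))
               + 1/2 * ((x - block b i (z l)) \<bullet> ((B i l + \<alpha> i l *\<^sub>R mat 1) *v (x - block b i (z l)))))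
          (\<lambda>x. x \<in> Zs i)
          (block b i (z (Suc l))))"

end

theory Submission
  imports Defs "HOL-Computational_Algebra.Polynomial" "HOL-Library.Multiset"
begin

text \<open>
  Each sweep decreases \<open>L\<close> by a multiple of the squared step, and the step bounds the slope of \<open>L\<close>
  over \<open>Z\<close> at the new iterate. Instead of a Kurdyka-Lojasiewicz inequality, the finite length of the
  trajectory is read off a curve: lexicographic minimisation selects, for every level \<open>t\<close> of \<open>L\<close>
  above its limit value, a point \<open>y t\<close> of least slope on that level. The curve \<open>y\<close> is semi-algebraic,
  so its coordinates are monotone near \<open>0\<close> and it has finite variation there. The decrease between two
  levels is at most the least slope times the displacement of \<open>y\<close>, up to a quadratic term, so the
  step lengths are summable. That \<open>y\<close> is semi-algebraic rests on quantifier elimination: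
  the pattern of signs of finitely many polynomials in one variable is determined, up to an order-preserving
  matching of real lines, by the signs of finitely many polynomials in the parameters.
\<close>

section \<open>Comparing the sign patterns of two lists of polynomials\<close>

text \<open>Roots are never counted or followed continuously in the parameter. Two parameter values
  are compared through a relation between their real lines that is total on both sides, respects
  sign vectors and reverses order only inside a cell. Such a relation extends to a further
  polynomial by the intermediate value theorem, because that polynomial is monotone between zeros of
  its derivative.

  The slope at \<open>x\<close> in \<open>Z\<close> is not a subdifferential but any
  \<open>s\<close> for which \<open>f x - s * norm (y - x) - M * (norm (y - x))^2\<close> lies below
  \<open>f y\<close> for all \<open>y\<close> in \<open>Z\<close>. This is a first-order, closed
  condition, so it is semi-algebraic and a least \<open>s\<close> is attained; the constraint set is
  built in and no normal cone enters the estimate. Least slope matters because the iterate itself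
  lies on the level with slope at most \<open>b\<close> times the last step. The curve inherits this
  bound, and the decrease between levels gives \<open>d (Suc l) <= d l / 2 + const * e l\<close>
  with \<open>e l\<close> the displacement of the curve. The curve may jump: only its variation
  along decreasing levels is used.\<close>

definition flat :: "(real \<Rightarrow> 'v) \<Rightarrow> real \<Rightarrow> real \<Rightarrow> bool" where
  "flat s y z \<longleftrightarrow> (\<forall>w. min y z \<le> w \<and> w \<le> max y z \<longrightarrow> s w = s y)"

lemma flatI: "(\<And>w. min y z \<le> w \<Longrightarrow> w \<le> max y z \<Longrightarrow> s w = s y) \<Longrightarrow> flat s y z"
  unfolding flat_def by blast

lemma flatD: "flat s y z \<Longrightarrow> min y z \<le> w \<Longrightarrow> w \<le> max y z \<Longrightarrow> s w = s y"
  unfolding flat_def by blast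

lemma flat_refl: "flat s y y"
  by (rule flatI) (metis min.idem max.idem order_antisym)

lemma flat_eq: "flat s y z \<Longrightarrow> s z = s y"
  by (erule flatD) auto

lemma flat_sym:
  assumes "flat s y z" shows "flat s z y"
proof (rule flatI)
  fix w assume "min z y \<le> w" "w \<le> max z y"
  then have "s w = s y" by (intro flatD[OF assms]) linarith+
  then show "s w = s z" by (rule trans[OF _ flat_eq[OF assms, symmetric]])
qed

lemma flat_trans:
  assumes "flat s x y" "flat s y z" shows "flat s x z"
proof (rule flatI)
  fix w assume w: "min x z \<le> w" "w \<le> max x z"
  show "s w = s x"
  proof (cases "min x y \<le> w \<and> w \<le> max x y")
    case True then show ?thesis by (intro flatD[OF assms(1)]) auto
  next
    case False
    then have "min y z \<le> w" "w \<le> max y z" using w by linarith+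
    then have "s w = s y" by (rule flatD[OF assms(2)])
    then show ?thesis by (rule trans[OF _ flat_eq[OF assms(1)]])
  qed
qed

lemma flat_mono: "flat s y z \<Longrightarrow> y \<le> w \<Longrightarrow> w \<le> z \<Longrightarrow> flat s y w"
  by (rule flatI, erule flatD) linarith+

text \<open>Cells are intervals: if \<open>a < b\<close> but the cell of \<open>a\<close> reaches at
  least as far as some point in the cell of \<open>b\<close>, the two overlap and are one
  cell.\<close>

lemma flat_cross:
  assumes "flat s a y" "flat s b z" "a < b" "z \<le> y"
  shows "flat s a b"
proof (cases "b \<le> y")
  case True
  show ?thesis by (rule flat_mono[OF assms(1) less_imp_le[OF assms(3)] True])
next
  case False
  then have *: "z \<le> y" "y \<le> b" using assms by auto
  have "flat s z y" using flat_mono[OF flat_sym[OF assms(2)] *] .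
  show ?thesis
    by (rule flat_trans[OF flat_trans[OF assms(1) flat_sym[OF \<open>flat s z y\<close>]] flat_sym[OF assms(2)]])
qed

text \<open>
  \<open>\<rho> y y'\<close> is read as: \<open>y\<close> and \<open>y'\<close> lie in corresponding cells of the two lines. The last
  condition says that \<open>\<rho>\<close> is increasing, except inside a single cell.
\<close>

definition sign_corr :: "(real \<Rightarrow> 'v) \<Rightarrow> (real \<Rightarrow> 'v) \<Rightarrow> (real \<Rightarrow> real \<Rightarrow> bool) \<Rightarrow> bool" where
  "sign_corr s t \<rho> \<longleftrightarrow> (\<forall>y. \<exists>y'. \<rho> y y') \<and> (\<forall>y'. \<exists>y. \<rho> y y') \<and> (\<forall>y y'. \<rho> y y' \<longrightarrow> s y = t y') \<and>
     (\<forall>y y' z z'. \<rho> y y' \<longrightarrow> \<rho> z z' \<longrightarrow> y \<le> z \<longrightarrow> z' \<le> y' \<longrightarrow> flat s y z \<and> flat t z' y')"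

lemma sign_corrD:
  assumes "sign_corr s t \<rho>"
  shows "\<exists>y'. \<rho> y y'" "\<exists>y. \<rho> y y'" "\<rho> y y' \<Longrightarrow> s y = t y'"
    "\<rho> y y' \<Longrightarrow> \<rho> z z' \<Longrightarrow> y \<le> z \<Longrightarrow> z' \<le> y' \<Longrightarrow> flat s y z"
    "\<rho> y y' \<Longrightarrow> \<rho> z z' \<Longrightarrow> y \<le> z \<Longrightarrow> z' \<le> y' \<Longrightarrow> flat t z' y'"
  using assms unfolding sign_corr_def by blast+

lemma sign_corr_converse:
  assumes c: "sign_corr s t \<rho>" shows "sign_corr t s (\<lambda>y' y. \<rho> y y')"
  unfolding sign_corr_def
proof (intro conjI allI impI)
  fix y y' z z' assume *: "\<rho> y' y" "\<rho> z' z" "y \<le> z" "z' \<le> y'"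
  show "flat t y z" "flat s z' y'"
    using sign_corrD(4,5)[OF c *(2) *(1) *(4) *(3)] by auto
next
  fix y y' assume "\<rho> y' y" then show "t y = s y'" by (rule sign_corrD(3)[OF c, symmetric])
qed (rule sign_corrD(1,2)[OF c])+

text \<open>Take \<open>w\<close> between \<open>y\<close> and \<open>z\<close> with correspondent
  \<open>w'\<close>. If \<open>w'\<close> lies inside the primed segment, flatness of
  \<open>t\<close> gives the value; if it lies outside, the pair is reversed against an endpoint and
  the last clause of \<open>sign_corr\<close> makes \<open>s\<close> flat up to that
  endpoint.\<close>

lemma sign_corr_flat:
  assumes c: "sign_corr s t \<rho>" and r: "\<rho> y y'" "\<rho> z z'" and f: "flat t y' z'"
  shows "flat s y z"
proof -
  have *: "flat s y z" if r: "\<rho> y y'" "\<rho> z z'" and f: "flat t y' z'" and le: "y \<le> z" for y y' z z'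
  proof (cases "z' \<le> y'")
    case True show ?thesis by (rule sign_corrD(4)[OF c r le True])
  next
    case False
    have eq: "s w = s y" if w: "y \<le> w" "w \<le> z" for w
    proof -
      obtain w' where w': "\<rho> w w'" using sign_corrD(1)[OF c] by blast
      consider "w' \<le> y'" | "z' \<le> w'" | "y' < w'" "w' < z'" by linarith
      then show ?thesis
      proof cases
        case 1 show ?thesis by (rule flat_eq[OF sign_corrD(4)[OF c r(1) w' w(1) 1]])
      next
        case 2 have "s z = s w" by (rule flat_eq[OF sign_corrD(4)[OF c w' r(2) w(2) 2]])
        then show ?thesis using flat_eq[OF f] sign_corrD(3)[OF c r(1)] sign_corrD(3)[OF c r(2)] by simp
      next
        case 3
        then have "t w' = t y'" by (intro flatD[OF f]) auto
        then show ?thesis using sign_corrD(3)[OF c r(1)] sign_corrD(3)[OF c w'] by simp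
      qed
    qed
    show ?thesis by (rule flatI, rule eq) (use le in linarith)+
  qed
  show ?thesis
    using *[OF r f] flat_sym[OF *[OF r(2) r(1) flat_sym[OF f]]] linear[of y z] by blast
qed

text \<open>Closing the relation under movement inside cells gives the freedom to replace a
  correspondent by another point of its cell; this is how a prescribed sign of a new polynomial is
  reached.\<close>

definition saturate :: "(real \<Rightarrow> 'v) \<Rightarrow> (real \<Rightarrow> 'v) \<Rightarrow> (real \<Rightarrow> real \<Rightarrow> bool) \<Rightarrow> real \<Rightarrow> real \<Rightarrow> bool" where
  "saturate s t \<rho> y y' \<longleftrightarrow> (\<exists>y0 y0'. \<rho> y0 y0' \<and> flat s y0 y \<and> flat t y0' y')"

lemma sign_corr_saturate:
  assumes c: "sign_corr s t \<rho>"
  shows "sign_corr s t (saturate s t \<rho>)"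
  unfolding sign_corr_def
proof (intro conjI allI impI)
  show "\<exists>y'. saturate s t \<rho> y y'" for y
    using sign_corrD(1)[OF c, of y] flat_refl unfolding saturate_def by blast
  show "\<exists>y. saturate s t \<rho> y y'" for y'
    using sign_corrD(2)[OF c, of y'] flat_refl unfolding saturate_def by blast
  show "s y = t y'" if sat: "saturate s t \<rho> y y'" for y y'
  proof -
    obtain y0 y0' where y0: "\<rho> y0 y0'" "flat s y0 y" "flat t y0' y'"
      using sat unfolding saturate_def by blast
    show ?thesis using flat_eq[OF y0(2)] flat_eq[OF y0(3)] sign_corrD(3)[OF c y0(1)] by simp
  qed
  fix y y' z z'
  assume sat: "saturate s t \<rho> y y'" "saturate s t \<rho> z z'" and le: "y \<le> z" "z' \<le> y'"
  obtain y0 y0' where y0: "\<rho> y0 y0'" "flat s y0 y" "flat t y0' y'" using sat unfolding saturate_def by blast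
  obtain z0 z0' where z0: "\<rho> z0 z0'" "flat s z0 z" "flat t z0' z'" using sat unfolding saturate_def by blast
  have k1: "flat t y0' z0' \<Longrightarrow> flat s y0 z0" using sign_corr_flat[OF c y0(1) z0(1)] .
  have k2: "flat s y0 z0 \<Longrightarrow> flat t y0' z0'"
    using sign_corr_flat[OF sign_corr_converse[OF c], of y0 y0' z0 z0'] y0 z0 by blast
  \<comment> \<open>Either the representatives are reversed too, or on one line their order is
    opposite to that of the points. In that case the cells cross there and \<open>flat_cross\<close>
    merges them; \<open>k1\<close> and \<open>k2\<close> carry the merger to the other line.\<close>
  consider "y0' < z0'" | "z0 < y0" | "y0 \<le> z0" "z0' \<le> y0'" by linarith
  then have "flat s y0 z0 \<and> flat t y0' z0'"
  proof cases
    case 1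
    have "flat t y0' z0'" by (rule flat_cross[OF y0(3) z0(3) 1 le(2)])
    then show ?thesis using k1 by simp
  next
    case 2
    have "flat s z0 y0" by (rule flat_cross[OF z0(2) y0(2) 2 le(1)])
    then show ?thesis using k2 flat_sym[of s z0 y0] by blast
  next
    case 3
    show ?thesis using sign_corrD(4)[OF c y0(1) z0(1) 3] k2 by blast
  qed
  then have f: "flat s y0 z0" "flat t y0' z0'" by auto
  show "flat s y z" by (rule flat_trans[OF flat_sym[OF y0(2)] flat_trans[OF f(1) z0(2)]])
  show "flat t z' y'" by (rule flat_sym[OF flat_trans[OF flat_sym[OF y0(3)] flat_trans[OF f(2) z0(3)]]])
qed

lemma saturate_flat: "saturate s t \<rho> y y' \<Longrightarrow> flat t y' z' \<Longrightarrow> saturate s t \<rho> y z'"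
  unfolding saturate_def by (blast intro: flat_trans)

text \<open>
  Here \<open>A\<close> is the set of zeros of the polynomials already matched, so that the new function \<open>g\<close>
  is strictly monotone between consecutive points of \<open>A\<close>, in the direction \<open>\<delta>\<close>.
\<close>

definition monotone_pieces :: "(real \<Rightarrow> 'v) \<Rightarrow> real set \<Rightarrow> ('v \<Rightarrow> real) \<Rightarrow> (real \<Rightarrow> real) \<Rightarrow> bool" where
  "monotone_pieces s A \<delta> g \<longleftrightarrow> finite A \<and> (\<forall>x. isCont g x) \<and>
     (\<forall>y z. y \<in> A \<longrightarrow> flat s y z \<longrightarrow> y = z) \<and>
     (\<forall>y z. y \<le> z \<longrightarrow> A \<inter> {y..z} = {} \<longrightarrow> flat s y z) \<and>
     (\<forall>w. w \<notin> A \<longrightarrow> \<delta> (s w) \<noteq> 0) \<and>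
     (\<forall>y w z. y < w \<longrightarrow> w < z \<longrightarrow> A \<inter> {y<..<z} = {} \<longrightarrow> sgn (g z - g y) = \<delta> (s w)) \<and>
     (\<forall>y. A \<inter> {y<..} = {} \<longrightarrow> (\<exists>z>y. g z * \<delta> (s z) > 0)) \<and>
     (\<forall>y. A \<inter> {..<y} = {} \<longrightarrow> (\<exists>z<y. g z * \<delta> (s z) < 0))"

lemma monotone_piecesD:
  assumes "monotone_pieces s A \<delta> g"
  shows "finite A" "isCont g x" "y \<in> A \<Longrightarrow> flat s y z \<Longrightarrow> y = z"
    "y \<le> z \<Longrightarrow> A \<inter> {y..z} = {} \<Longrightarrow> flat s y z"
    "w \<notin> A \<Longrightarrow> \<delta> (s w) \<noteq> 0"
    "y < w \<Longrightarrow> w < z \<Longrightarrow> A \<inter> {y<..<z} = {} \<Longrightarrow> sgn (g z - g y) = \<delta> (s w)"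
    "A \<inter> {y<..} = {} \<Longrightarrow> \<exists>z>y. g z * \<delta> (s z) > 0"
    "A \<inter> {..<y} = {} \<Longrightarrow> \<exists>z<y. g z * \<delta> (s z) < 0"
  using assms unfolding monotone_pieces_def by blast+

text \<open>
  If the value of \<open>h\<close> at \<open>y0\<close> is too small, move right within the cell: the sign of \<open>h\<close> at the
  right end of the cell agrees with that of \<open>g\<close> by \<open>sg\<close>, so an intermediate value has the right sign.
\<close>

lemma match_right:
  assumes c: "sign_corr s t \<rho>"
    and sat: "\<And>y y' z'. \<rho> y y' \<Longrightarrow> flat t y' z' \<Longrightarrow> \<rho> y z'"
    and ms: "monotone_pieces s A \<delta> g" and mt: "monotone_pieces t A' \<delta> h"
    and A: "\<And>y y'. \<rho> y y' \<Longrightarrow> y \<in> A \<longleftrightarrow> y' \<in> A'"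
    and sg: "\<And>y y'. \<rho> y y' \<Longrightarrow> y \<in> A \<Longrightarrow> sgn (g y) = sgn (h y')"
    and y: "y \<notin> A" "\<rho> y y0" "\<delta> (s y) = 1" "sgn (h y0) < sgn (g y)"
  shows "\<exists>y'. \<rho> y y' \<and> sgn (h y') = sgn (g y)"
proof -
  have y0: "y0 \<notin> A'" using A y by blast
  define \<sigma> where "\<sigma> = sgn (g y)"
  have \<sigma>: "\<sigma> = 0 \<or> \<sigma> = 1" using y(4) by (auto simp: \<sigma>_def sgn_if split: if_splits)
  have hy0: "h y0 < 0 \<or> (h y0 = 0 \<and> \<sigma> = 1)" using y(4) by (auto simp: \<sigma>_def sgn_if split: if_splits)
  have reach: ?thesis if b: "y0 < b" "A' \<inter> {y0<..<b} = {}" "h b > 0" for b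
  proof -
    \<comment> \<open>A target between \<open>h y0\<close> and \<open>h b\<close> with sign
      \<sigma>: zero itself, or half of the positive end value.\<close>
    define v where "v = (if \<sigma> = 0 then 0 else h b / 2)"
    have v: "h y0 < v" "v < h b" "sgn v = \<sigma>" using hy0 b(3) \<sigma> by (auto simp: v_def)
    obtain w where w: "y0 \<le> w" "w \<le> b" "h w = v"
      using IVT[of h y0 v b] monotone_piecesD(2)[OF mt] v b(1) by force
    have w': "y0 < w" "w < b" using w v by (metis order_le_less less_irrefl)+
    have "A' \<inter> {y0..w} = {}" 
    proof (rule ccontr)
      assume "A' \<inter> {y0..w} \<noteq> {}"
      then obtain a where "a \<in> A'" "y0 \<le> a" "a \<le> w" by auto
      then have "a \<in> A' \<inter> {y0<..<b}" using y0 w' by (cases "a = y0") auto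
      then show False using b(2) by blast
    qed
    then have "flat t y0 w" using monotone_piecesD(4)[OF mt w(1)] by blast
    then show ?thesis using sat[OF y(2)] w v \<sigma>_def by blast
  qed
  show ?thesis
  proof (cases "A' \<inter> {y0<..} = {}")
    case True
    \<comment> \<open>The cell is unbounded on the right, so the clause on behaviour at infinity
      takes the place of the sign at its right end.\<close>
    obtain z where z: "z > y0" "h z * \<delta> (t z) > 0" using monotone_piecesD(7)[OF mt True] by blast
    have "A' \<inter> {y0..z} = {}" using True y0 by (auto simp: order_le_less)
    then have "flat t y0 z" using monotone_piecesD(4)[OF mt] z by simp
    then have "t z = s y" using flat_eq sign_corrD(3)[OF c y(2)] by metis
    then show ?thesis using reach[of z] True z y(3) by fastforce
  next
    case False
    define b' where "b' = Min (A' \<inter> {y0<..})"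
    have fin: "finite (A' \<inter> {y0<..})" using monotone_piecesD(1)[OF mt] by simp
    have b': "b' \<in> A'" "y0 < b'" using Min_in[OF fin False] by (auto simp: b'_def)
    have bmin: "a \<ge> b'" if "a \<in> A'" "a > y0" for a using Min_le[OF fin] that by (simp add: b'_def)
    \<comment> \<open>The right end \<open>b'\<close> corresponds to a point \<open>b\<close> of
      \<open>A\<close>. Points of \<open>A\<close> are singleton cells, so no reversal can involve
      them; hence \<open>b\<close> is the next point of \<open>A\<close> after \<open>y\<close>.
      There \<open>g\<close> exceeds its nonnegative value at \<open>y\<close>.\<close>
    obtain b where b: "\<rho> b b'" using sign_corrD(2)[OF c] by blast
    have bA: "b \<in> A" using A b b' by blast
    have yb: "y < b"
    proof (rule ccontr)
      assume "\<not> y < b"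
      then have "flat s b y" using sign_corrD(4)[OF c b y(2)] b' by simp
      then show False using monotone_piecesD(3)[OF ms bA] bA y(1) by blast
    qed
    have noA: "A \<inter> {y<..<b} = {}"
    proof (rule ccontr)
      assume "A \<inter> {y<..<b} \<noteq> {}"
      then obtain a where a: "a \<in> A" "y < a" "a < b" by auto
      obtain a' where a': "\<rho> a a'" using sign_corrD(1)[OF c] by blast
      have "y0 < a'"
      proof (rule ccontr)
        assume "\<not> y0 < a'"
        then have "flat s y a" using sign_corrD(4)[OF c y(2) a'] a by simp
        then show False using monotone_piecesD(3)[OF ms a(1) flat_sym] a by blast
      qed
      then have "b' \<le> a'" using bmin A a a' by blast
      then have "flat s a b" using sign_corrD(4)[OF c a' b] a by simp
      then show False using monotone_piecesD(3)[OF ms a(1)] a by blast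
    qed
    define w where "w = (y + b) / 2"
    have w: "y < w" "w < b" using yb by (auto simp: w_def)
    have "A \<inter> {y..w} = {}"
    proof (rule ccontr)
      assume "A \<inter> {y..w} \<noteq> {}"
      then obtain a where "a \<in> A" "y \<le> a" "a \<le> w" by auto
      then have "a \<in> A \<inter> {y<..<b}" using y(1) w by (cases "a = y") auto
      then show False using noA by blast
    qed
    then have "s w = s y" using flat_eq[OF monotone_piecesD(4)[OF ms, of y w]] w by simp
    then have "sgn (g b - g y) = 1" using monotone_piecesD(6)[OF ms w noA] y(3) by simp
    then have "g b > g y" by (simp add: sgn_if split: if_splits)
    then have "g b > 0" using \<sigma> by (auto simp: \<sigma>_def sgn_if split: if_splits)
    then have "h b' > 0" using sg[OF b bA] by (auto simp: sgn_if split: if_splits)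
    then show ?thesis using reach[of b'] b' bmin by force
  qed
qed

section \<open>Negation and reflection of the data\<close>

lemma monotone_pieces_minus:
  assumes "monotone_pieces s A \<delta> g"
  shows "monotone_pieces s A (\<lambda>v. - \<delta> v) (\<lambda>y. - g y)"
proof -
  have "sgn (- g z - - g y) = - \<delta> (s w)" if "y < w" "w < z" "A \<inter> {y<..<z} = {}" for y w z
    using monotone_piecesD(6)[OF assms that] by (simp add: sgn_if split: if_splits)
  then show ?thesis using assms unfolding monotone_pieces_def by auto
qed

lemma flat_reflect: "flat (\<lambda>y. s (- y)) y z \<longleftrightarrow> flat s (- y) (- z)"
proof -
  have *: "flat (\<lambda>y. s (- y)) y z" if "flat s (- y) (- z)" for s :: "real \<Rightarrow> 'a" and y z
    by (rule flatI, rule flatD[OF that]) linarith+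
  show ?thesis using *[of s y z] *[of "\<lambda>y. s (- y)" "- y" "- z"] by auto
qed

text \<open>Reflecting the line reverses the direction of growth and negating the values restores
  it, so \<delta> is unchanged and a search to the left becomes one to the right.\<close>

lemma monotone_pieces_reflect:
  assumes m: "monotone_pieces s A \<delta> g"
  shows "monotone_pieces (\<lambda>y. s (- y)) (uminus ` A) \<delta> (\<lambda>y. - g (- y))"
  unfolding monotone_pieces_def
proof (intro conjI allI impI)
  show "finite (uminus ` A)" using monotone_piecesD(1)[OF m] by simp
  show "isCont (\<lambda>y. - g (- y)) x" for x
    by (intro isCont_minus isCont_o2[where f = uminus and g = g] monotone_piecesD(2)[OF m] continuous_ident)
  show "y = z" if "y \<in> uminus ` A" "flat (\<lambda>y. s (- y)) y z" for y z
    using that monotone_piecesD(3)[OF m, of "- y" "- z"] by (auto simp: flat_reflect)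
  show "flat (\<lambda>y. s (- y)) y z" if "y \<le> z" "uminus ` A \<inter> {y..z} = {}" for y z
  proof -
    have "A \<inter> {- z..- y} = {}" using that(2) by force
    then show ?thesis using monotone_piecesD(4)[OF m, of "- z" "- y"] that flat_sym by (auto simp: flat_reflect)
  qed
  show "\<delta> (s (- w)) \<noteq> 0" if "w \<notin> uminus ` A" for w
  proof -
    have "- w \<notin> A" using that by force
    then show ?thesis using monotone_piecesD(5)[OF m] by simp
  qed
  show "sgn (- g (- z) - - g (- y)) = \<delta> (s (- w))" if "y < w" "w < z" "uminus ` A \<inter> {y<..<z} = {}" for y w z
  proof -
    have "A \<inter> {- z<..<- y} = {}" using that(3) by force
    then show ?thesis using monotone_piecesD(6)[OF m, of "- z" "- w" "- y"] that by simp
  qed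
  show "\<exists>z>y. - g (- z) * \<delta> (s (- z)) > 0" if "uminus ` A \<inter> {y<..} = {}" for y
  proof -
    have "A \<inter> {..<- y} = {}" using that by force
    then obtain z where "z < - y" "g z * \<delta> (s z) < 0" using monotone_piecesD(8)[OF m] by blast
    then show ?thesis by (intro exI[of _ "- z"]) auto
  qed
  show "\<exists>z<y. - g (- z) * \<delta> (s (- z)) < 0" if "uminus ` A \<inter> {..<y} = {}" for y
  proof -
    have "A \<inter> {- y<..} = {}" using that by force
    then obtain z where "z > - y" "g z * \<delta> (s z) > 0" using monotone_piecesD(7)[OF m] by blast
    then show ?thesis by (intro exI[of _ "- z"]) auto
  qed
qed

lemma sign_corr_reflect:
  assumes "sign_corr s t \<rho>"
  shows "sign_corr (\<lambda>y. s (- y)) (\<lambda>y. t (- y)) (\<lambda>y y'. \<rho> (- y) (- y'))"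
  unfolding sign_corr_def flat_reflect
proof (intro conjI allI impI)
  fix y show "\<exists>y'. \<rho> (- y) (- y')" using sign_corrD(1)[OF assms] by (metis minus_minus)
next
  fix y' show "\<exists>y. \<rho> (- y) (- y')" using sign_corrD(2)[OF assms] by (metis minus_minus)
next
  fix y y' z z' assume "\<rho> (- y) (- y')" "\<rho> (- z) (- z')" "y \<le> z" "z' \<le> y'"
  then show "flat s (- y) (- z)" "flat t (- z') (- y')"
    using sign_corrD(4,5)[OF assms, of "- z" "- z'" "- y" "- y'"] flat_sym by auto
qed (rule sign_corrD(3)[OF assms])

text \<open>All cases reduce to \<open>match_right\<close>: a value that is too large is treated by
  reflection, a decreasing \<open>g\<close> by negating both functions.\<close>

lemma match_value:
  assumes c: "sign_corr s t \<rho>"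
    and sat: "\<And>y y' z'. \<rho> y y' \<Longrightarrow> flat t y' z' \<Longrightarrow> \<rho> y z'"
    and ms: "monotone_pieces s A \<delta> g" and mt: "monotone_pieces t A' \<delta> h"
    and A: "\<And>y y'. \<rho> y y' \<Longrightarrow> y \<in> A \<longleftrightarrow> y' \<in> A'"
    and sg: "\<And>y y'. \<rho> y y' \<Longrightarrow> y \<in> A \<Longrightarrow> sgn (g y) = sgn (h y')"
  shows "\<exists>y'. \<rho> y y' \<and> sgn (h y') = sgn (g y)"
proof -
  have *: "\<exists>y'. \<rho> y y' \<and> sgn (h y') = sgn (g y)"
    if ms: "monotone_pieces s A \<delta> g" and mt: "monotone_pieces t A' \<delta> h"
      and sg: "\<And>y y'. \<rho> y y' \<Longrightarrow> y \<in> A \<Longrightarrow> sgn (g y) = sgn (h y')"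
      and y: "y \<notin> A" "\<rho> y y0" "\<delta> (s y) = 1" for \<delta> g h y0
  proof -
    consider "sgn (h y0) < sgn (g y)" | "sgn (h y0) = sgn (g y)" | "sgn (h y0) > sgn (g y)" by linarith
    then show ?thesis
    proof cases
      case 1 then show ?thesis using match_right[OF c _ ms mt A _ y] sat sg by blast
    next
      case 2 then show ?thesis using y by blast
    next
      case 3
      have mem: "a \<in> uminus ` S \<longleftrightarrow> - a \<in> S" for a :: real and S by force
      have "\<exists>y'. \<rho> (- (- y)) (- y') \<and> sgn (- h (- y')) = sgn (- g (- (- y)))"
      proof (rule match_right[OF sign_corr_reflect[OF c] _ monotone_pieces_reflect[OF ms] monotone_pieces_reflect[OF mt], where ?y0.0="- y0"])
        show "\<rho> (- a) (- d)" if "\<rho> (- a) (- b)" "flat (\<lambda>y. t (- y)) b d" for a b d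
          using that sat by (auto simp: flat_reflect)
        show "a \<in> uminus ` A \<longleftrightarrow> b \<in> uminus ` A'" if "\<rho> (- a) (- b)" for a b
          using A[OF that] by (simp add: mem)
        show "sgn (- g (- a)) = sgn (- h (- b))" if "\<rho> (- a) (- b)" "a \<in> uminus ` A" for a b
        proof -
          have "- a \<in> A" using that by force
          then show ?thesis using sg[OF that(1)] by (simp add: sgn_minus)
        qed
      qed (use y 3 in \<open>auto simp: sgn_minus\<close>)
      then show ?thesis by (metis minus_minus neg_equal_iff_equal sgn_minus)
    qed
  qed
  obtain y0 where y0: "\<rho> y y0" using sign_corrD(1)[OF c] by blast
  show ?thesis
  proof (cases "y \<in> A")
    case True then show ?thesis using sg y0 by metis
  next
    case False
    \<comment> \<open>A stretch free of \<open>A\<close> to the right of \<open>y\<close> exhibits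
      \<delta> at \<open>y\<close> as the sign of an increment, so it is 1 or -1.\<close>
    obtain z where z: "z > y" "A \<inter> {y..z} = {}"
    proof (cases "A \<inter> {y<..} = {}")
      case True
      show ?thesis by (rule that[of "y + 1"]) (use True False in \<open>auto simp: order_le_less\<close>)
    next
      case ne: False
      have fin: "finite (A \<inter> {y<..})" using monotone_piecesD(1)[OF ms] by simp
      have m: "Min (A \<inter> {y<..}) > y" using Min_in[OF fin ne] by auto
      then obtain z where z: "y < z" "z < Min (A \<inter> {y<..})" using dense by blast
      have "A \<inter> {y..z} = {}" 
      proof (rule ccontr)
        assume "A \<inter> {y..z} \<noteq> {}"
        then obtain a where "a \<in> A" "y \<le> a" "a \<le> z" by auto
        then show False using False Min_le[OF fin, of a] z by (cases "a = y") auto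
      qed
      then show ?thesis using that z by blast
    qed
    then have "sgn (g z - g y) = \<delta> (s ((y + z) / 2))" "flat s y ((y + z) / 2)"
      using monotone_piecesD(6)[OF ms, of y "(y + z) / 2" z] monotone_piecesD(4)[OF ms, of y "(y + z) / 2"]
      by (force simp: disjoint_iff)+
    then have "\<delta> (s y) = sgn (g z - g y)" using flat_eq by metis
    then consider "\<delta> (s y) = 1" | "\<delta> (s y) = - 1"
      using monotone_piecesD(5)[OF ms False] by (auto simp: sgn_if split: if_splits)
    then show ?thesis
    proof cases
      case 1 then show ?thesis using *[OF ms mt sg False y0] by blast
    next
      case 2
      have "\<exists>y'. \<rho> y y' \<and> sgn (- h y') = sgn (- g y)"
        using *[OF monotone_pieces_minus[OF ms] monotone_pieces_minus[OF mt] _ False y0] sg 2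
        by (simp add: sgn_minus)
      then show ?thesis by (simp add: sgn_minus)
    qed
  qed
qed

section \<open>Sign patterns of real polynomials\<close>

lemma poly_sgn_constant:
  fixes p :: "real poly"
  assumes "\<And>w. a \<le> w \<Longrightarrow> w \<le> b \<Longrightarrow> poly p w \<noteq> 0" "a \<le> b"
  shows "sgn (poly p b) = sgn (poly p a)"
proof (rule ccontr)
  assume ne: "\<not> ?thesis"
  then have "a < b" using assms(2) by (cases "a = b") auto
  moreover have "poly p a * poly p b < 0"
    using ne assms(1)[of a] assms(1)[of b] assms(2) by (auto simp: sgn_if mult_less_0_iff split: if_splits)
  ultimately obtain x where "a < x" "x < b" "poly p x = 0" using poly_IVT by blast
  then show False using assms(1)[of x] by simp
qed

lemma poly_zero_interval:
  fixes p :: "real poly"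
  assumes "a < b" "\<And>w. a \<le> w \<Longrightarrow> w \<le> b \<Longrightarrow> poly p w = 0"
  shows "p = 0"
proof (rule ccontr)
  assume "p \<noteq> 0"
  then have "finite {x. poly p x = 0}" by (rule poly_roots_finite)
  moreover have "{a..b} \<subseteq> {x. poly p x = 0}" using assms(2) by auto
  ultimately have "finite {a..b}" using finite_subset by blast
  then show False using assms(1) infinite_Icc by blast
qed

lemma poly_unbounded:
  fixes p :: "real poly"
  assumes "degree p > 0"
  shows "\<exists>K. \<forall>z. \<bar>z\<bar> \<ge> K \<longrightarrow> \<bar>poly p z\<bar> > c"
proof -
  have "filterlim (poly p) at_infinity at_infinity" using filterlim_poly_at_infinity[of p] assms by blast
  then have "\<forall>\<^sub>F x in at_infinity. norm (poly p x) \<ge> max 1 (c + 1)"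
    using filterlim_at_infinity[of 0 "poly p" at_infinity] by (metis max.cobounded1 zero_less_one order_less_le_trans order_refl)
  then obtain K where "\<And>z. norm z \<ge> K \<Longrightarrow> norm (poly p z) \<ge> max 1 (c + 1)"
    unfolding eventually_at_infinity by blast
  then show ?thesis by (intro exI[of _ K]) force
qed

text \<open>The default 0 outside \<open>I\<close> makes two sign vectors equal as functions exactly
  when they agree on \<open>I\<close>.\<close>

definition sgns :: "'i set \<Rightarrow> ('i \<Rightarrow> real poly) \<Rightarrow> real \<Rightarrow> 'i \<Rightarrow> real" where
  "sgns I q y i = (if i \<in> I then sgn (poly (q i) y) else 0)"

lemma flat_sgns_iff:
  "flat (sgns I q) y z \<longleftrightarrow>
     (\<forall>i\<in>I. \<forall>w. min y z \<le> w \<longrightarrow> w \<le> max y z \<longrightarrow> sgn (poly (q i) w) = sgn (poly (q i) y))"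
proof
  assume f: "flat (sgns I q) y z"
  show "\<forall>i\<in>I. \<forall>w. min y z \<le> w \<longrightarrow> w \<le> max y z \<longrightarrow> sgn (poly (q i) w) = sgn (poly (q i) y)"
  proof (intro ballI allI impI)
    fix i w assume i: "i \<in> I" and w: "min y z \<le> w" "w \<le> max y z"
    have "sgns I q w i = sgns I q y i" by (rule fun_cong[OF flatD[OF f w]])
    then show "sgn (poly (q i) w) = sgn (poly (q i) y)" using i by (simp add: sgns_def)
  qed
next
  assume *: "\<forall>i\<in>I. \<forall>w. min y z \<le> w \<longrightarrow> w \<le> max y z \<longrightarrow> sgn (poly (q i) w) = sgn (poly (q i) y)"
  show "flat (sgns I q) y z"
  proof (rule flatI, rule ext)
    fix w i assume w: "min y z \<le> w" "w \<le> max y z"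
    show "sgns I q w i = sgns I q y i"
      unfolding sgns_def by (rule if_cong[OF refl _ refl]) (use * w in blast)
  qed
qed

text \<open>The derivative of \<open>p\<close> is one of the \<open>q i\<close>, so its zeros are
  among the separating points and the mean value theorem makes \<open>p\<close> strictly monotone in
  between, with the direction recorded at index \<open>d\<close>. The \<open>q i\<close> outside
  \<open>I0\<close> are constant and cannot end a cell.\<close>

lemma monotone_pieces_poly:
  assumes fin: "finite I" and I0: "I0 \<subseteq> I" "\<And>i. i \<in> I0 \<Longrightarrow> q i \<noteq> 0"
    and const: "\<And>i. i \<in> I - I0 \<Longrightarrow> degree (q i) = 0"
    and d: "d \<in> I0" "q d = pderiv p"
  shows "monotone_pieces (sgns I q) {y. \<exists>i\<in>I0. poly (q i) y = 0} (\<lambda>v. v d) (poly p)"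
    (is "monotone_pieces _ ?A _ _")
  unfolding monotone_pieces_def
proof (intro conjI allI impI)
  have dI: "d \<in> I" using d I0 by blast
  have dp: "degree p > 0" using I0(2)[OF d(1)] d(2) by (simp add: pderiv_eq_0_iff)
  have sgns_d: "sgns I q w d = sgn (poly (pderiv p) w)" for w using dI d by (simp add: sgns_def)
  have mvt: "sgn (poly p z - poly p y) = sgn (poly (pderiv p) w)"
    if w: "y < w" "w < z" and A: "?A \<inter> {y<..<z} = {}" for y w z
  proof -
    have "y < z" using w by simp
    from poly_MVT[OF this] obtain x where x: "y < x" "x < z" "poly p z - poly p y = (z - y) * poly (pderiv p) x"
      by blast
    have nz: "poly (pderiv p) v \<noteq> 0" if "y < v" "v < z" for v
    proof
      assume "poly (pderiv p) v = 0"
      then have "\<exists>i\<in>I0. poly (q i) v = 0" using d by (intro bexI[of _ d]) simp_all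
      then have "v \<in> ?A \<inter> {y<..<z}" using that by simp
      then show False using A by blast
    qed
    have "sgn (poly (pderiv p) x) = sgn (poly (pderiv p) w)"
    proof (cases "x \<le> w")
      case True
      then show ?thesis using poly_sgn_constant[of x w "pderiv p"] nz x w by force
    next
      case False
      then show ?thesis using poly_sgn_constant[of w x "pderiv p"] nz x w by force
    qed
    then show ?thesis using x(3) \<open>y < z\<close> by (simp add: sgn_mult)
  qed
  have "?A = (\<Union>i\<in>I0. {y. poly (q i) y = 0})" by auto
  moreover have "finite I0" using fin I0 finite_subset by blast
  moreover have "finite {y. poly (q i) y = 0}" if "i \<in> I0" for i
    by (rule poly_roots_finite[OF I0(2)[OF that]])
  ultimately show "finite ?A" by simp
  show "isCont (poly p) x" for x by simp
  show "y = z" if yA: "y \<in> ?A" and f: "flat (sgns I q) y z" for y z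
  proof (rule ccontr)
    assume "y \<noteq> z"
    obtain i where i: "i \<in> I0" "poly (q i) y = 0" using yA by blast
    have "i \<in> I" using i I0 by blast
    with f have s: "\<forall>w. min y z \<le> w \<longrightarrow> w \<le> max y z \<longrightarrow> sgn (poly (q i) w) = sgn (poly (q i) y)"
      unfolding flat_sgns_iff by blast
    have "poly (q i) w = 0" if "min y z \<le> w" "w \<le> max y z" for w
      using s[rule_format, OF that] unfolding i(2) by (simp add: sgn_0_0)
    then have "q i = 0" using poly_zero_interval[of "min y z" "max y z" "q i"] \<open>y \<noteq> z\<close> by fastforce
    then show False using I0(2) i by blast
  qed
  show "flat (sgns I q) y z" if le: "y \<le> z" and A: "?A \<inter> {y..z} = {}" for y z
    unfolding flat_sgns_iff
  proof (intro ballI allI impI)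
    fix i w assume i: "i \<in> I" and w: "min y z \<le> w" "w \<le> max y z"
    then have w: "y \<le> w" "w \<le> z" using le by auto
    show "sgn (poly (q i) w) = sgn (poly (q i) y)"
    proof (cases "i \<in> I0")
      case True
      show ?thesis
      proof (rule poly_sgn_constant[OF _ w(1)])
        fix v assume "y \<le> v" "v \<le> w"
        then have "v \<in> {y..z}" using w by simp
        then show "poly (q i) v \<noteq> 0" using A True by blast
      qed
    next
      case False
      then have "degree (q i) = 0" using const i by blast
      then obtain a where "q i = [:a:]" by (meson degree_eq_zeroE)
      then show ?thesis by simp
    qed
  qed
  show "sgns I q w d \<noteq> 0" if "w \<notin> ?A" for w
    using that d(1) dI by (auto simp: sgns_def sgn_0_0)
  show "sgn (poly p z - poly p y) = sgns I q w d" if "y < w" "w < z" "?A \<inter> {y<..<z} = {}" for y w z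
    using mvt[OF that] sgns_d by simp
  show "\<exists>z>y. poly p z * sgns I q z d > 0" if A: "?A \<inter> {y<..} = {}" for y
  proof -
    \<comment> \<open>Beyond \<open>K\<close> the value at \<open>z\<close> dominates the one at
      \<open>y + 1\<close>, so \<open>poly p z\<close> has the sign of the increment, which is the
      sign of the derivative.\<close>
    obtain K where K: "\<And>z. \<bar>z\<bar> \<ge> K \<Longrightarrow> \<bar>poly p z\<bar> > \<bar>poly p (y + 1)\<bar>" using poly_unbounded[OF dp] by blast
    define z where "z = max \<bar>K\<bar> (y + 2)"
    have z: "z > y + 1" "\<bar>z\<bar> \<ge> K" unfolding z_def by linarith+
    have s: "sgn (poly p z - poly p (y + 1)) = sgn (poly (pderiv p) z)"
    proof -
      have "sgn (poly p z - poly p (y + 1)) = sgn (poly (pderiv p) ((y + 1 + z) / 2))"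
        using z A by (intro mvt) (auto simp: disjoint_iff)
      also have "\<dots> = sgn (poly (pderiv p) z)"
      proof (rule poly_sgn_constant[symmetric])
        fix w assume "(y + 1 + z) / 2 \<le> w" "w \<le> z"
        then have "w \<in> {y<..}" using z by (simp add: field_simps)
        then show "poly (pderiv p) w \<noteq> 0" using A d by (metis (mono_tags, lifting) disjoint_iff mem_Collect_eq)
      qed (use z in simp)
      finally show ?thesis .
    qed
    have "poly (pderiv p) z \<noteq> 0" using A d z(1) by (force simp: disjoint_iff)
    then have "poly p z * sgn (poly (pderiv p) z) > 0"
      using s K[OF z(2)] by (auto simp: sgn_if split: if_splits)
    then show ?thesis using z sgns_d by (intro exI[of _ z]) auto
  qed
  show "\<exists>z<y. poly p z * sgns I q z d < 0" if A: "?A \<inter> {..<y} = {}" for y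
  proof -
    obtain K where K: "\<And>z. \<bar>z\<bar> \<ge> K \<Longrightarrow> \<bar>poly p z\<bar> > \<bar>poly p (y - 1)\<bar>" using poly_unbounded[OF dp] by blast
    define z where "z = - max \<bar>K\<bar> (2 - y)"
    have z: "z < y - 1" "\<bar>z\<bar> \<ge> K" unfolding z_def by linarith+
    have s: "sgn (poly p (y - 1) - poly p z) = sgn (poly (pderiv p) z)"
    proof -
      have "sgn (poly p (y - 1) - poly p z) = sgn (poly (pderiv p) ((y - 1 + z) / 2))"
        using z A by (intro mvt) (auto simp: disjoint_iff)
      also have "\<dots> = sgn (poly (pderiv p) z)"
      proof (rule poly_sgn_constant)
        fix w assume "z \<le> w" "w \<le> (y - 1 + z) / 2"
        then have "w \<in> {..<y}" using z by (simp add: field_simps)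
        then show "poly (pderiv p) w \<noteq> 0" using A d by (metis (mono_tags, lifting) disjoint_iff mem_Collect_eq)
      qed (use z in simp)
      finally show ?thesis .
    qed
    have "poly (pderiv p) z \<noteq> 0" using A d z(1) by (force simp: disjoint_iff)
    then have "poly p z * sgn (poly (pderiv p) z) < 0"
      using s K[OF z(2)] by (auto simp: sgn_if split: if_splits)
    then show ?thesis using z sgns_d by (intro exI[of _ z]) auto
  qed
qed

text \<open>The given relation is first saturated and then thinned to the pairs on which the signs
  of \<open>p\<close> and \<open>p'\<close> agree. Totality of the thinned relation is
  \<open>match_value\<close> in both directions; its only input about the values of \<open>p\<close>
  is \<open>root\<close>, the agreement of signs at corresponding zeros.\<close>

lemma sign_corr_poly_insert:
  fixes p p' :: "real poly"
  assumes fin: "finite I" and I0: "I0 \<subseteq> I" "\<And>i. i \<in> I0 \<Longrightarrow> q i \<noteq> 0" "\<And>i. i \<in> I0 \<Longrightarrow> q' i \<noteq> 0"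
    and const: "\<And>i. i \<in> I - I0 \<Longrightarrow> degree (q i) = 0" "\<And>i. i \<in> I - I0 \<Longrightarrow> degree (q' i) = 0"
    and d: "d \<in> I0" "q d = pderiv p" "q' d = pderiv p'"
    and c: "sign_corr (sgns I q) (sgns I q') \<rho>"
    and root: "\<And>y y' i. \<rho> y y' \<Longrightarrow> i \<in> I0 \<Longrightarrow> poly (q i) y = 0 \<Longrightarrow> poly (q' i) y' = 0 \<Longrightarrow>
                 sgn (poly p y) = sgn (poly p' y')"
  shows "\<exists>\<rho>'. sign_corr (\<lambda>y. (sgns I q y, sgn (poly p y))) (\<lambda>y. (sgns I q' y, sgn (poly p' y))) \<rho>'"
proof -
  define s t where "s = sgns I q" and "t = sgns I q'"
  define A A' where "A = {y. \<exists>i\<in>I0. poly (q i) y = 0}" and "A' = {y. \<exists>i\<in>I0. poly (q' i) y = 0}"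
  have ms: "monotone_pieces s A (\<lambda>v. v d) (poly p)"
    unfolding s_def A_def by (rule monotone_pieces_poly[OF fin I0(1)]) (use I0 const d in auto)
  have mt: "monotone_pieces t A' (\<lambda>v. v d) (poly p')"
    unfolding t_def A'_def by (rule monotone_pieces_poly[OF fin I0(1)]) (use I0 const d in auto)
  define \<rho>s where "\<rho>s = saturate s t \<rho>"
  have c: "sign_corr s t \<rho>" using c by (simp add: s_def t_def)
  have cs: "sign_corr s t \<rho>s" unfolding \<rho>s_def by (rule sign_corr_saturate[OF c])
  have zero: "poly (q i) y = 0 \<longleftrightarrow> poly (q' i) y' = 0" if "s y = t y'" "i \<in> I0" for i y y'
  proof -
    have "i \<in> I" using that I0 by blast
    then show ?thesis using fun_cong[OF that(1), of i] by (simp add: s_def t_def sgns_def) (metis sgn_0_0)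
  qed
  have AA: "y \<in> A \<longleftrightarrow> y' \<in> A'" if "s y = t y'" for y y'
    using zero[OF that] by (auto simp: A_def A'_def)
  have rs: "sgn (poly p y) = sgn (poly p' y')" if r: "\<rho>s y y'" and y: "y \<in> A" for y y'
  proof -
    obtain y0 y0' where y0: "\<rho> y0 y0'" "flat s y0 y" "flat t y0' y'" using r unfolding \<rho>s_def saturate_def by blast
    have "y' \<in> A'" using AA sign_corrD(3)[OF cs r] y by blast
    \<comment> \<open>Points of \<open>A\<close> and \<open>A'\<close> are singleton cells, so
      saturation adds no pair there and \<open>root\<close> still applies.\<close>
    then have e: "y0 = y" "y0' = y'"
      using monotone_piecesD(3)[OF ms y flat_sym[OF y0(2)]] monotone_piecesD(3)[OF mt _ flat_sym[OF y0(3)]] by auto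
    obtain i where i: "i \<in> I0" "poly (q i) y = 0" using y by (auto simp: A_def)
    have "poly (q' i) y' = 0" using zero[OF sign_corrD(3)[OF cs r] i(1)] i(2) by simp
    then show ?thesis using root[of y y' i] y0(1) e i by simp
  qed
  have sat: "\<rho>s y z'" if "\<rho>s y y'" "flat t y' z'" for y y' z'
    using saturate_flat that unfolding \<rho>s_def by metis
  have sat': "\<rho>s z y'" if "\<rho>s y y'" "flat s y z" for y y' z
    using that flat_trans[OF _ that(2)] unfolding \<rho>s_def saturate_def by blast
  have tot1: "\<exists>y'. \<rho>s y y' \<and> sgn (poly p' y') = sgn (poly p y)" for y
    using match_value[OF cs _ ms mt] sat AA sign_corrD(3)[OF cs] rs by blast
  have tot2: "\<exists>y. \<rho>s y y' \<and> sgn (poly p y) = sgn (poly p' y')" for y'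
  proof (rule match_value[OF sign_corr_converse[OF cs] _ mt ms])
    show "\<rho>s z y" if "\<rho>s y' y" "flat s y' z" for y y' z using sat' that by blast
    show "y \<in> A' \<longleftrightarrow> y' \<in> A" if "\<rho>s y' y" for y y' using AA sign_corrD(3)[OF cs that] by blast
    show "sgn (poly p' y) = sgn (poly p y')" if "\<rho>s y' y" "y \<in> A'" for y y'
      using rs[OF that(1)] AA sign_corrD(3)[OF cs that(1)] that(2) by simp
  qed
  define \<rho>' where "\<rho>' y y' \<longleftrightarrow> \<rho>s y y' \<and> sgn (poly p y) = sgn (poly p' y')" for y y'
  have piece: "\<exists>\<sigma>. \<sigma> \<noteq> 0 \<and> (\<forall>v w. y \<le> v \<longrightarrow> v < w \<longrightarrow> w \<le> z \<longrightarrow> sgn (poly p w - poly p v) = \<sigma>)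
       \<and> \<sigma> = s y d"
    if m: "monotone_pieces s A (\<lambda>v. v d) (poly p)" and f: "flat s y z" "y < z" for s A p y z
  proof -
    have no: "w \<notin> A" if "y \<le> w" "w \<le> z" for w
    proof
      assume w: "w \<in> A"
      have "flat s y w" using flat_mono[OF f(1) that] .
      then have "w = y" using monotone_piecesD(3)[OF m w flat_sym] by blast
      then show False using monotone_piecesD(3)[OF m _ f(1)] w f(2) by blast
    qed
    have nz: "s y d \<noteq> 0" using monotone_piecesD(5)[OF m no[of y]] f by simp
    have "sgn (poly p w - poly p v) = s y d" if vw: "y \<le> v" "v < w" "w \<le> z" for v w
    proof -
      have "sgn (poly p w - poly p v) = s ((v + w) / 2) d"
        using no vw by (intro monotone_piecesD(6)[OF m]) auto
      moreover have "s ((v + w) / 2) = s y" using vw by (intro flatD[OF f(1)]) (simp_all add: min_le_iff_disj le_max_iff_disj)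
      ultimately show ?thesis by simp
    qed
    then show ?thesis using nz by blast
  qed
  have pflat: "flat (\<lambda>y. (s y, sgn (poly p y))) y z"
    if m: "monotone_pieces s A (\<lambda>v. v d) (poly p)" and f: "flat s y z" "y \<le> z"
      and e: "sgn (poly p y) = sgn (poly p z)" for s A p y z
  proof (rule flatI)
    fix w assume "min y z \<le> w" "w \<le> max y z"
    then have w: "y \<le> w" "w \<le> z" using f(2) by auto
    have sw: "s w = s y" using w by (intro flatD[OF f(1)]) linarith+
    have "sgn (poly p w) = sgn (poly p y)"
    proof (cases "w = y \<or> w = z")
      case True then show ?thesis using e by auto
    next
      case False
      then have w': "y < w" "w < z" using w by auto
      then obtain \<sigma> where \<sigma>: "\<sigma> \<noteq> 0" "\<forall>v w. y \<le> v \<longrightarrow> v < w \<longrightarrow> w \<le> z \<longrightarrow> sgn (poly p w - poly p v) = \<sigma>"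
        using piece[OF m f(1)] by fastforce
      have "sgn (poly p w - poly p y) = \<sigma>" "sgn (poly p z - poly p w) = \<sigma>" using \<sigma>(2) w' by auto
      then show ?thesis using e \<sigma>(1) by (auto simp: sgn_if split: if_splits)
    qed
    then show "(s w, sgn (poly p w)) = (s y, sgn (poly p y))" using sw by simp
  qed
  have "sign_corr (\<lambda>y. (s y, sgn (poly p y))) (\<lambda>y. (t y, sgn (poly p' y))) \<rho>'"
    unfolding sign_corr_def
  proof (intro conjI allI impI)
    show "\<exists>y'. \<rho>' y y'" for y using tot1 unfolding \<rho>'_def by metis
    show "\<exists>y. \<rho>' y y'" for y' using tot2 unfolding \<rho>'_def by metis
    show "(s y, sgn (poly p y)) = (t y', sgn (poly p' y'))" if "\<rho>' y y'" for y y'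
      using that sign_corrD(3)[OF cs] unfolding \<rho>'_def by simp
    fix y y' z z' assume r: "\<rho>' y y'" "\<rho>' z z'" and le: "y \<le> z" "z' \<le> y'"
    have rs: "\<rho>s y y'" "\<rho>s z z'" and e: "sgn (poly p y) = sgn (poly p' y')" "sgn (poly p z) = sgn (poly p' z')"
      using r by (auto simp: \<rho>'_def)
    have f: "flat s y z" "flat t z' y'" using sign_corrD(4,5)[OF cs rs le] by auto
    \<comment> \<open>In a genuine reversal \<open>p\<close> changes from \<open>y\<close> to
      \<open>z\<close> in the same direction as \<open>p'\<close> from \<open>z'\<close> to
      \<open>y'\<close>. As the signs of \<open>p\<close> and \<open>p'\<close> agree on both pairs,
      the sign at \<open>y\<close> is squeezed against the sign at \<open>z\<close>.\<close>
    have eq: "sgn (poly p y) = sgn (poly p z)"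
    proof (cases "y < z \<and> z' < y'")
      case True
      obtain \<sigma> where \<sigma>: "\<sigma> \<noteq> 0" "sgn (poly p z - poly p y) = \<sigma>" "\<sigma> = s y d"
        using piece[OF ms f(1)] True by blast
      obtain \<tau> where \<tau>: "\<tau> \<noteq> 0" "sgn (poly p' y' - poly p' z') = \<tau>" "\<tau> = t z' d"
        using piece[OF mt f(2)] True by blast
      have "\<sigma> = \<tau>" using \<sigma>(3) \<tau>(3) sign_corrD(3)[OF cs rs(1)] flat_eq[OF f(2)] by simp
      then show ?thesis using \<sigma>(1,2) \<tau>(2) e by (auto simp: sgn_if split: if_splits)
    next
      case False
      then have "y = z \<or> y' = z'" using le by auto
      then show ?thesis using e by auto
    qed
    show "flat (\<lambda>y. (s y, sgn (poly p y))) y z" by (rule pflat[OF ms f(1) le(1) eq])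
    show "flat (\<lambda>y. (t y, sgn (poly p' y))) z' y'" by (rule pflat[OF mt f(2) le(2)]) (use e eq in simp)
  qed
  then show ?thesis unfolding s_def t_def by blast
qed

section \<open>Elimination of a real variable\<close>

text \<open>The coefficients, as functions of the parameters, come from such a ring; it is later the
  ring of polynomial functions.\<close>

definition fun_ring :: "('x \<Rightarrow> real) set \<Rightarrow> bool" where
  "fun_ring R \<longleftrightarrow> (\<forall>c. (\<lambda>_. c) \<in> R) \<and> (\<forall>f\<in>R. \<forall>g\<in>R. (\<lambda>x. f x + g x) \<in> R \<and> (\<lambda>x. f x * g x) \<in> R)"

text \<open>The number \<open>n\<close> is formal: it bounds the number of coefficients uniformly in
  \<open>x\<close>, while the true degree may drop where a leading coefficient vanishes. Thus
  \<open>n <= 1\<close> means constant, and the formal leading coefficient has index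
  \<open>n - 1\<close>.\<close>

definition poly_family :: "('x \<Rightarrow> real) set \<Rightarrow> ('x \<Rightarrow> real poly) \<Rightarrow> nat \<Rightarrow> bool" where
  "poly_family R P n \<longleftrightarrow> (\<forall>i. (\<lambda>x. coeff (P x) i) \<in> R) \<and> (\<forall>x. \<forall>i\<ge>n. coeff (P x) i = 0)"

lemma fun_ringD:
  assumes "fun_ring R"
  shows "(\<lambda>_. c) \<in> R" "f \<in> R \<Longrightarrow> g \<in> R \<Longrightarrow> (\<lambda>x. f x + g x) \<in> R"
    "f \<in> R \<Longrightarrow> g \<in> R \<Longrightarrow> (\<lambda>x. f x * g x) \<in> R"
  using assms unfolding fun_ring_def by blast+

lemma fun_ring_diff:
  assumes R: "fun_ring R" and "f \<in> R" "g \<in> R" shows "(\<lambda>x. f x - g x) \<in> R"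
proof -
  have "(\<lambda>x. f x + (- 1) * g x) \<in> R" using fun_ringD[OF R] assms by blast
  then show ?thesis by simp
qed

lemma fun_ring_sum:
  assumes R: "fun_ring R" and "finite I" "\<And>i. i \<in> I \<Longrightarrow> f i \<in> R"
  shows "(\<lambda>x. \<Sum>i\<in>I. f i x) \<in> R"
  using assms(2,3)
proof (induction I rule: finite_induct)
  case empty show ?case using fun_ringD(1)[OF R, of 0] by simp
next
  case (insert i I) then show ?case using fun_ringD(2)[OF R, of "f i"] by simp
qed

lemma poly_familyD:
  assumes "poly_family R P n"
  shows "(\<lambda>x. coeff (P x) i) \<in> R" "n \<le> i \<Longrightarrow> coeff (P x) i = 0"
  using assms unfolding poly_family_def by blast+

text \<open>For parameters at which the formal leading coefficient vanishes, this is the same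
  polynomial with a smaller formal length.\<close>

definition truncation :: "('x \<Rightarrow> real poly) \<times> nat \<Rightarrow> ('x \<Rightarrow> real poly) \<times> nat" where
  "truncation p = (\<lambda>x. fst p x - monom (coeff (fst p x) (snd p - 1)) (snd p - 1), snd p - 1)"

lemma poly_family_truncation:
  assumes R: "fun_ring R" and P: "poly_family R (fst p) (snd p)" and n: "snd p \<ge> 1"
  shows "poly_family R (fst (truncation p)) (snd (truncation p))"
  unfolding poly_family_def truncation_def fst_conv snd_conv
proof (intro conjI allI impI)
  show "(\<lambda>x. coeff (fst p x - monom (coeff (fst p x) (snd p - 1)) (snd p - 1)) i) \<in> R" for i
    using fun_ringD(1)[OF R, of 0] poly_familyD(1)[OF P] by (cases "i = snd p - 1") simp_all
  show "coeff (fst p x - monom (coeff (fst p x) (snd p - 1)) (snd p - 1)) i = 0" if "snd p - 1 \<le> i" for x i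
    using poly_familyD(2)[OF P, of i x] that n by (cases "i = snd p - 1") simp_all
qed

definition formal_derivative :: "('x \<Rightarrow> real poly) \<times> nat \<Rightarrow> ('x \<Rightarrow> real poly) \<times> nat" where
  "formal_derivative p = (\<lambda>x. pderiv (fst p x), snd p - 1)"

lemma poly_family_formal_derivative:
  assumes R: "fun_ring R" and P: "poly_family R (fst p) (snd p)"
  shows "poly_family R (fst (formal_derivative p)) (snd (formal_derivative p))"
  unfolding poly_family_def formal_derivative_def fst_conv snd_conv
proof (intro conjI allI impI)
  show "(\<lambda>x. coeff (pderiv (fst p x)) i) \<in> R" for i
    unfolding coeff_pderiv by (intro fun_ringD[OF R] poly_familyD(1)[OF P])
  show "coeff (pderiv (fst p x)) i = 0" if "snd p - 1 \<le> i" for x i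
    using poly_familyD(2)[OF P, of "Suc i" x] that by (simp add: coeff_pderiv)
qed

text \<open>
  One step of pseudo-division of \<open>p\<close> by \<open>q\<close>. At a zero of \<open>q\<close> it equals \<open>p\<close> times the leading
  coefficient of \<open>q\<close>; a full remainder is not needed, since only the formal degree must drop.
\<close>

definition reduct :: "('x \<Rightarrow> real poly) \<times> nat \<Rightarrow> ('x \<Rightarrow> real poly) \<times> nat \<Rightarrow> ('x \<Rightarrow> real poly) \<times> nat" where
  "reduct p q = (\<lambda>x. smult (coeff (fst q x) (snd q - 1)) (fst p x)
                  - monom (coeff (fst p x) (snd p - 1)) (snd p - snd q) * fst q x, snd p - 1)"

lemma poly_family_reduct:
  assumes R: "fun_ring R" and P: "poly_family R (fst p) (snd p)" and Q: "poly_family R (fst q) (snd q)"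
    and n: "1 \<le> snd q" "snd q \<le> snd p"
  shows "poly_family R (fst (reduct p q)) (snd (reduct p q))"
  unfolding poly_family_def reduct_def fst_conv snd_conv
proof (intro conjI allI impI)
  show "(\<lambda>x. coeff (smult (coeff (fst q x) (snd q - 1)) (fst p x)
          - monom (coeff (fst p x) (snd p - 1)) (snd p - snd q) * fst q x) i) \<in> R" for i
    unfolding coeff_diff coeff_smult coeff_monom_mult
    by (cases "i < snd p - snd q"; simp)
       (intro fun_ring_diff[OF R] fun_ringD[OF R] poly_familyD(1)[OF P] poly_familyD(1)[OF Q])+
  show "coeff (smult (coeff (fst q x) (snd q - 1)) (fst p x)
          - monom (coeff (fst p x) (snd p - 1)) (snd p - snd q) * fst q x) i = 0" if i: "snd p - 1 \<le> i" for x i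
  proof (cases "i = snd p - 1")
    case True
    have "snd p - Suc 0 - (snd p - snd q) = snd q - Suc 0" "\<not> snd p - Suc 0 < snd p - snd q" using n by linarith+
    then show ?thesis using True by (simp add: coeff_monom_mult)
  next
    case False
    then have "snd p \<le> i" "snd q \<le> i - (snd p - snd q)" using i n by linarith+
    then show ?thesis using poly_familyD(2)[OF P] poly_familyD(2)[OF Q] by (simp add: coeff_monom_mult)
  qed
qed

lemma poly_reduct:
  "poly (fst q x) y = 0 \<Longrightarrow> poly (fst (reduct p q) x) y = coeff (fst q x) (snd q - 1) * poly (fst p x) y"
  by (simp add: reduct_def)

text \<open>Used to forget entries of a sign vector and to rename them.\<close>

lemma sign_corr_comp:
  assumes c: "sign_corr s t \<rho>" shows "sign_corr (\<lambda>y. \<phi> (s y)) (\<lambda>y. \<phi> (t y)) \<rho>"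
proof -
  have *: "flat (\<lambda>y. \<phi> (s y)) y z" if "flat s y z" for s y z
    by (rule flatI, rule arg_cong[where f = \<phi>], rule flatD[OF that])
  show ?thesis
    unfolding sign_corr_def
  proof (intro conjI allI impI)
    fix y y' assume "\<rho> y y'" then show "\<phi> (s y) = \<phi> (t y')" by (intro arg_cong[where f = \<phi>] sign_corrD(3)[OF c])
  next
    fix y y' z z' assume r: "\<rho> y y'" "\<rho> z z'" "y \<le> z" "z' \<le> y'"
    show "flat (\<lambda>y. \<phi> (s y)) y z" "flat (\<lambda>y. \<phi> (t y)) z' y'"
      using sign_corrD(4,5)[OF c r] * by auto
  qed (rule sign_corrD(1,2)[OF c])+
qed

definition family_sgns :: "(('x \<Rightarrow> real poly) \<times> nat) set \<Rightarrow> 'x \<Rightarrow> real \<Rightarrow> ('x \<Rightarrow> real poly) \<times> nat \<Rightarrow> real" where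
  "family_sgns I x = sgns I (\<lambda>p. fst p x)"

text \<open>Induction along the multiset order on formal lengths: one entry of top length is traded
  for any number of shorter ones. Where no leading coefficient vanishes, these are its derivative
  and its reducts, which supply the signs at zeros demanded by \<open>sign_corr_poly_insert\<close>;
  otherwise a polynomial is truncated. The signs of the leading coefficients decide which case holds
  and therefore belong to \<open>C\<close>.\<close>

lemma sign_cells:
  fixes M :: "(('x \<Rightarrow> real poly) \<times> nat) multiset"
  assumes R: "fun_ring R" and M: "\<And>p. p \<in># M \<Longrightarrow> poly_family R (fst p) (snd p)"
  shows "\<exists>C. finite C \<and> C \<subseteq> R \<and> (\<forall>x x'. (\<forall>c\<in>C. sgn (c x) = sgn (c x')) \<longrightarrow>
           (\<exists>\<rho>. sign_corr (family_sgns (set_mset M) x) (family_sgns (set_mset M) x') \<rho>))"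
  using M
proof (induction M rule: wf_induct_rule[OF wf_mult1[OF wf_measure[of snd]]])
  case (1 M)
  note fam = 1(2) and IH = 1(1)
  show ?case
  proof (cases "\<forall>p\<in>#M. snd p \<le> 1")
    case True
    define C where "C = (\<lambda>p x. coeff (fst p x) 0) ` set_mset M"
    have "sign_corr (family_sgns (set_mset M) x) (family_sgns (set_mset M) x') (=)"
      if x: "\<forall>c\<in>C. sgn (c x) = sgn (c x')" for x x'
    proof -
      have "poly (fst p x) y = coeff (fst p x) 0" if "p \<in># M" for p x y
      proof -
        have "coeff (fst p x) i = 0" if "i > 0" for i
          using poly_familyD(2)[OF fam[OF \<open>p \<in># M\<close>], of i x] True \<open>p \<in># M\<close> that by force
        then have "degree (fst p x) = 0" by (meson degree_le le_zero_eq)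
        then show ?thesis by (metis coeff_pCons_0 degree_eq_zeroE mult_zero_right poly_0 poly_pCons add.right_neutral)
      qed
      moreover have "sgn (coeff (fst p x) 0) = sgn (coeff (fst p x') 0)" if "p \<in># M" for p
        using x that by (auto simp: C_def)
      ultimately have "family_sgns (set_mset M) x y = family_sgns (set_mset M) x' y" for y
        by (auto simp: family_sgns_def sgns_def)
      then show ?thesis unfolding sign_corr_def by (auto intro: flat_refl dest: order_antisym)
    qed
    moreover have "C \<subseteq> R" using poly_familyD(1)[OF fam] by (auto simp: C_def)
    moreover have "finite C" by (simp add: C_def)
    ultimately show ?thesis by blast
  next
    case False
    then have ne: "set_mset M \<noteq> {}" by auto
    define n where "n = Max (snd ` set_mset M)"
    have n_max: "snd q \<le> n" if "q \<in># M" for q using that by (simp add: n_def)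
    have "n \<in> snd ` set_mset M" using ne unfolding n_def by (intro Max_in) auto
    then obtain p where p: "p \<in># M" "snd p = n" by auto
    have n2: "n \<ge> 2" using False n_max by fastforce
    obtain M0 where M0: "M = add_mset p M0" using p(1) by (metis insert_DiffM)
    define lc where "lc q = (\<lambda>x. coeff (fst q x) (snd q - 1))" for q :: "('x \<Rightarrow> real poly) \<times> nat"
    define big where "big = {q \<in> set_mset M0. snd q \<ge> 2}"
    define d where "d = formal_derivative p"
    \<comment> \<open>Divisors are the entries with formal length at least 2 and the derivative
      \<open>d\<close>, since exactly their zeros separate the pieces on which \<open>p\<close> is
      monotone. The remaining entries are constant in the real variable.\<close>
    define M' where "M' = M0 + {#d#} + image_mset (reduct p) (mset_set (insert d big))"
    have finbig: "finite big" by (simp add: big_def)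
    have fd: "poly_family R (fst d) (snd d)" unfolding d_def by (rule poly_family_formal_derivative[OF R fam[OF p(1)]])
    have sd: "snd d = n - 1" by (simp add: d_def formal_derivative_def p)
    have fM0: "poly_family R (fst q) (snd q)" if "q \<in># M0" for q using fam that M0 by simp
    have fr: "poly_family R (fst (reduct p q)) (snd (reduct p q))" if "q \<in> insert d big" for q
    proof (rule poly_family_reduct[OF R fam[OF p(1)]])
      show "snd q \<le> snd p" using that n_max[of q] sd p M0 by (auto simp: big_def)
    qed (use that fd fM0 sd n2 in \<open>auto simp: big_def\<close>)
    have "(M', M) \<in> mult1 (Wellfounded.measure snd)"
      unfolding M'_def M0 add.assoc
    proof (rule mult1I[OF refl refl])
      fix r assume "r \<in># {#d#} + image_mset (reduct p) (mset_set (insert d big))"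
      then have "snd r = n - 1" using finbig p sd by (auto simp: reduct_def)
      then show "(r, p) \<in> Wellfounded.measure snd" using n2 p by simp
    qed
    then have "\<exists>C. finite C \<and> C \<subseteq> R \<and> (\<forall>x x'. (\<forall>c\<in>C. sgn (c x) = sgn (c x')) \<longrightarrow>
           (\<exists>\<rho>. sign_corr (family_sgns (set_mset M') x) (family_sgns (set_mset M') x') \<rho>))"
    proof (rule IH)
      fix r assume "r \<in># M'"
      then have "r \<in># M0 \<or> r = d \<or> r \<in> reduct p ` insert d big"
        using finbig unfolding M'_def by (simp, blast)
      then consider "r \<in># M0" | "r = d" | q where "q \<in> insert d big" "r = reduct p q"
        by blast
      then show "poly_family R (fst r) (snd r)" by cases (simp_all only: fM0 fd fr)
    qed
    then obtain C1 where C1: "finite C1" "C1 \<subseteq> R" "\<And>x x'. (\<forall>c\<in>C1. sgn (c x) = sgn (c x')) \<Longrightarrow>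
           \<exists>\<rho>. sign_corr (family_sgns (set_mset M') x) (family_sgns (set_mset M') x') \<rho>" by blast
    \<comment> \<open>Second use of the induction hypothesis, for each entry \<open>q\<close> that
      may degenerate: it covers the parameters at which the formal leading coefficient of
      \<open>q\<close> vanishes.\<close>
    have "\<exists>C. finite C \<and> C \<subseteq> R \<and> (\<forall>x x'. (\<forall>c\<in>C. sgn (c x) = sgn (c x')) \<longrightarrow>
           (\<exists>\<rho>. sign_corr (family_sgns (set_mset (add_mset (truncation q) (M - {#q#}))) x)
                (family_sgns (set_mset (add_mset (truncation q) (M - {#q#}))) x') \<rho>))"
      if q: "q \<in># M" "snd q \<ge> 2" for q
    proof (rule IH)
      show "(add_mset (truncation q) (M - {#q#}), M) \<in> mult1 (Wellfounded.measure snd)"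
      proof (rule mult1I)
        show "M = add_mset q (M - {#q#})" using q by simp
        show "add_mset (truncation q) (M - {#q#}) = (M - {#q#}) + {#truncation q#}" by simp
      qed (use q in \<open>auto simp: truncation_def\<close>)
      show "poly_family R (fst p) (snd p)" if "p \<in># add_mset (truncation q) (M - {#q#})" for p
        using that fam poly_family_truncation[OF R fam[OF q(1)]] q by (auto dest: in_diffD)
    qed
    then obtain C2 where C2: "\<And>q. q \<in># M \<Longrightarrow> snd q \<ge> 2 \<Longrightarrow> finite (C2 q) \<and> C2 q \<subseteq> R \<and>
         (\<forall>x x'. (\<forall>c\<in>C2 q. sgn (c x) = sgn (c x')) \<longrightarrow>
           (\<exists>\<rho>. sign_corr (family_sgns (set_mset (add_mset (truncation q) (M - {#q#}))) x)
                (family_sgns (set_mset (add_mset (truncation q) (M - {#q#}))) x') \<rho>))" by metis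
    define C where "C = C1 \<union> lc ` set_mset M \<union> (\<Union>q\<in>{q \<in> set_mset M. snd q \<ge> 2}. C2 q)"
    have "\<exists>\<rho>. sign_corr (family_sgns (set_mset M) x) (family_sgns (set_mset M) x') \<rho>"
      if x: "\<forall>c\<in>C. sgn (c x) = sgn (c x')" for x x'
    proof (cases "\<exists>q\<in>#M. snd q \<ge> 2 \<and> lc q x = 0")
      case True
      then obtain q where q: "q \<in># M" "snd q \<ge> 2" "lc q x = 0" by blast
      have "sgn (lc q x) = sgn (lc q x')" by (rule x[rule_format]) (use q in \<open>simp add: C_def\<close>)
      then have q': "lc q x' = 0" using q(3) by (simp add: sgn_0_0)
      let ?M = "add_mset (truncation q) (M - {#q#})"
      have "\<forall>c\<in>C2 q. sgn (c x) = sgn (c x')" using x q by (auto simp: C_def)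
      then obtain \<rho> where \<rho>: "sign_corr (family_sgns (set_mset ?M) x) (family_sgns (set_mset ?M) x') \<rho>"
        using C2[OF q(1,2)] by blast
      \<comment> \<open>Reads the entry of \<open>q\<close> off its truncation, with which it
        coincides at \<open>x\<close> and at \<open>x'\<close>.\<close>
      define \<phi> where "\<phi> v r = (if r = q then v (truncation q) else if r \<in># M then v r else (0::real))"
        for v :: "('x \<Rightarrow> real poly) \<times> nat \<Rightarrow> real" and r
      have tr: "fst (truncation q) x = fst q x" if "lc q x = 0" for x
        using that by (simp add: truncation_def lc_def)
      have mem: "r \<in># ?M" if "r \<in># M" "r \<noteq> q" for r using that by (simp add: in_diff_count)
      have "\<phi> (family_sgns (set_mset ?M) x y) = family_sgns (set_mset M) x y" if "lc q x = 0" for x y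
      proof (rule ext)
        fix r
        show "\<phi> (family_sgns (set_mset ?M) x y) r = family_sgns (set_mset M) x y r"
          using tr[OF that] mem[of r] q(1) by (cases "r = q"; cases "r \<in># M")
            (simp_all add: \<phi>_def family_sgns_def sgns_def)
      qed
      then have "sign_corr (family_sgns (set_mset M) x) (family_sgns (set_mset M) x') \<rho>"
        using sign_corr_comp[OF \<rho>, of \<phi>] q(3) q' by simp
      then show ?thesis by blast
    next
      case False
      have lcx: "lc q x \<noteq> 0" if "q \<in># M" "snd q \<ge> 2" for q using False that by blast
      have lcs: "sgn (lc q x) = sgn (lc q x')" if "q \<in># M" for q
        by (rule x[rule_format]) (use that in \<open>simp add: C_def\<close>)
      have lcx': "lc q x' \<noteq> 0" if "q \<in># M" "snd q \<ge> 2" for q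
        using lcx[OF that] lcs[OF that(1)] by (metis sgn_0_0)
      \<comment> \<open>The leading coefficient of the derivative is a positive multiple of that of
        \<open>p\<close>, so its sign needs no entry of its own in \<open>C\<close>.\<close>
      have dlc: "lc d x = of_nat (n - 1) * lc p x" for x
        using n2 p by (simp add: lc_def d_def formal_derivative_def coeff_pderiv Suc_diff_Suc numeral_2_eq_2)
      have "\<forall>c\<in>C1. sgn (c x) = sgn (c x')" using x by (auto simp: C_def)
      then obtain \<rho> where \<rho>: "sign_corr (family_sgns (set_mset M') x) (family_sgns (set_mset M') x') \<rho>"
        using C1(3) by blast
      define I where "I = insert d (set_mset M0)"
      define I0 where "I0 = insert d big"
      have IM': "I \<subseteq> set_mset M'" by (auto simp: I_def M'_def)
      have rM': "reduct p q \<in># M'" if "q \<in> I0" for q using that finbig by (auto simp: M'_def I0_def)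
      have lcI0: "lc q x \<noteq> 0" "lc q x' \<noteq> 0" "sgn (lc q x) = sgn (lc q x')" if "q \<in> I0" for q
      proof -
        have "lc q x \<noteq> 0 \<and> lc q x' \<noteq> 0 \<and> sgn (lc q x) = sgn (lc q x')"
        proof (cases "q = d")
          case True
          then show ?thesis using lcx[OF p(1)] lcx'[OF p(1)] lcs[OF p(1)] p n2 dlc by (simp add: sgn_mult)
        next
          case False
          then have "q \<in># M" "snd q \<ge> 2" using that M0 by (auto simp: I0_def big_def)
          then show ?thesis using lcx[of q] lcx'[of q] lcs[of q] by blast
        qed
        then show "lc q x \<noteq> 0" "lc q x' \<noteq> 0" "sgn (lc q x) = sgn (lc q x')" by auto
      qed
      have "\<exists>\<rho>'. sign_corr (\<lambda>y. (sgns I (\<lambda>q. fst q x) y, sgn (poly (fst p x) y)))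
                 (\<lambda>y. (sgns I (\<lambda>q. fst q x') y, sgn (poly (fst p x') y))) \<rho>'"
      proof (rule sign_corr_poly_insert[where ?I0.0 = I0 and d = d])
        show "finite I" by (simp add: I_def)
        show "I0 \<subseteq> I" by (auto simp: I_def I0_def big_def)
        show "fst i x \<noteq> 0" if "i \<in> I0" for i using lcI0(1)[OF that] by (auto simp: lc_def)
        show "fst i x' \<noteq> 0" if "i \<in> I0" for i using lcI0(2)[OF that] by (auto simp: lc_def)
        have const: "degree (fst i x) = 0" if "i \<in> I - I0" for i x
        proof -
          have i: "i \<in># M0" "snd i \<le> 1" using that by (auto simp: I_def I0_def big_def)
          have "coeff (fst i x) j = 0" if "j > 0" for j
            using poly_familyD(2)[OF fM0[OF i(1)], of j x] i that by simp
          then show ?thesis by (meson degree_le le_zero_eq)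
        qed
        show "degree (fst i x) = 0" "degree (fst i x') = 0" if "i \<in> I - I0" for i using const[OF that] by auto
        show "d \<in> I0" by (simp add: I0_def)
        show "fst d x = pderiv (fst p x)" "fst d x' = pderiv (fst p x')" by (simp_all add: d_def formal_derivative_def)
        define \<phi> where "\<phi> v r = (if r \<in> I then v r else (0::real))"
          for v :: "('x \<Rightarrow> real poly) \<times> nat \<Rightarrow> real" and r
        have "\<phi> (family_sgns (set_mset M') x y) = sgns I (\<lambda>q. fst q x) y" for x y
        proof (rule ext)
          fix r
          show "\<phi> (family_sgns (set_mset M') x y) r = sgns I (\<lambda>q. fst q x) y r"
            using IM' by (cases "r \<in> I") (auto simp: \<phi>_def family_sgns_def sgns_def)
        qed
        then show "sign_corr (sgns I (\<lambda>q. fst q x)) (sgns I (\<lambda>q. fst q x')) \<rho>"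
          using sign_corr_comp[OF \<rho>, of \<phi>] by simp
        show "sgn (poly (fst p x) y) = sgn (poly (fst p x') y')"
          if r: "\<rho> y y'" and i: "i \<in> I0" and z: "poly (fst i x) y = 0" "poly (fst i x') y' = 0" for y y' i
        proof -
          have "family_sgns (set_mset M') x y (reduct p i) = family_sgns (set_mset M') x' y' (reduct p i)"
            by (rule fun_cong[OF sign_corrD(3)[OF \<rho> r]])
          then have "sgn (poly (fst (reduct p i) x) y) = sgn (poly (fst (reduct p i) x') y')"
            using rM'[OF i] by (simp add: family_sgns_def sgns_def)
          \<comment> \<open>At a zero of the divisor the reduct is the leading coefficient times
            \<open>p\<close>; the leading coefficients are nonzero with equal signs and
            cancel.\<close>
          then have "sgn (lc i x) * sgn (poly (fst p x) y) = sgn (lc i x') * sgn (poly (fst p x') y')"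
            by (simp add: poly_reduct z sgn_mult lc_def)
          then show ?thesis using lcI0[OF i] by (simp add: sgn_0_0)
        qed
      qed
      then obtain \<rho>' where \<rho>': "sign_corr (\<lambda>y. (sgns I (\<lambda>q. fst q x) y, sgn (poly (fst p x) y)))
                 (\<lambda>y. (sgns I (\<lambda>q. fst q x') y, sgn (poly (fst p x') y))) \<rho>'" by blast
      define \<phi> where "\<phi> v r = (if r = p then snd v else if r \<in># M then fst v r else (0::real))"
        for v :: "(('x \<Rightarrow> real poly) \<times> nat \<Rightarrow> real) \<times> real" and r
      have "\<phi> (sgns I (\<lambda>q. fst q x) y, sgn (poly (fst p x) y)) = family_sgns (set_mset M) x y" for x y
      proof (rule ext)
        fix r
        show "\<phi> (sgns I (\<lambda>q. fst q x) y, sgn (poly (fst p x) y)) r = family_sgns (set_mset M) x y r"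
          by (cases "r = p"; cases "r \<in># M0")
            (simp_all add: \<phi>_def family_sgns_def sgns_def I_def M0)
      qed
      then show ?thesis using sign_corr_comp[OF \<rho>', of \<phi>] by auto
    qed
    moreover have "C \<subseteq> R"
      using C1(2) C2 poly_familyD(1)[OF fam] by (auto simp: C_def lc_def)
    moreover have "finite C" using C1(1) C2 by (auto simp: C_def)
    ultimately show ?thesis by blast
  qed
qed

section \<open>Semi-algebraic predicates and functions\<close>

text \<open>
  This is the class of boolean combinations of polynomial equations and inequalities; stated through
  the signs of finitely many polynomials, it is the form in which \<open>sign_cells\<close> eliminates a quantifier.
\<close>

definition sa_pred :: "('a::euclidean_space \<Rightarrow> bool) \<Rightarrow> bool" where
  "sa_pred \<phi> \<longleftrightarrow> (\<exists>C. finite C \<and> (\<forall>c\<in>C. real_polynomial_function c) \<and>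
     (\<forall>x y. (\<forall>c\<in>C. sgn (c x) = sgn (c y)) \<longrightarrow> \<phi> x \<longrightarrow> \<phi> y))"

lemma saI:
  assumes "finite C" "\<And>c. c \<in> C \<Longrightarrow> real_polynomial_function c"
    "\<And>x y. (\<And>c. c \<in> C \<Longrightarrow> sgn (c x) = sgn (c y)) \<Longrightarrow> \<phi> x \<Longrightarrow> \<phi> y"
  shows "sa_pred \<phi>"
  unfolding sa_pred_def using assms by (intro exI[of _ C]) blast

lemma saE:
  assumes "sa_pred \<phi>"
  obtains C where "finite C" "\<And>c. c \<in> C \<Longrightarrow> real_polynomial_function c"
    "\<And>x y. (\<And>c. c \<in> C \<Longrightarrow> sgn (c x) = sgn (c y)) \<Longrightarrow> \<phi> x \<longleftrightarrow> \<phi> y"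
proof -
  obtain C where C: "finite C" "\<And>c. c \<in> C \<Longrightarrow> real_polynomial_function c"
    "\<And>x y. (\<forall>c\<in>C. sgn (c x) = sgn (c y)) \<Longrightarrow> \<phi> x \<Longrightarrow> \<phi> y" using assms unfolding sa_pred_def by blast
  have "\<phi> x \<longleftrightarrow> \<phi> y" if eq: "\<And>c. c \<in> C \<Longrightarrow> sgn (c x) = sgn (c y)" for x y
  proof
    show "\<phi> y" if "\<phi> x" by (rule C(3)[OF _ that]) (use eq in blast)
    show "\<phi> x" if "\<phi> y" by (rule C(3)[OF _ that]) (use eq in fastforce)
  qed
  then show ?thesis using that[OF C(1,2)] by blast
qed

lemma sa_not: "sa_pred \<phi> \<Longrightarrow> sa_pred (\<lambda>x. \<not> \<phi> x)"
proof (erule saE)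
  fix C assume C: "finite C" "\<And>c. c \<in> C \<Longrightarrow> real_polynomial_function c"
    "\<And>x y. (\<And>c. c \<in> C \<Longrightarrow> sgn (c x) = sgn (c y)) \<Longrightarrow> \<phi> x \<longleftrightarrow> \<phi> y"
  show ?thesis by (rule saI[OF C(1,2)]) (use C(3) in blast)+
qed

lemma sa_conj:
  assumes "sa_pred \<phi>" "sa_pred \<psi>" shows "sa_pred (\<lambda>x. \<phi> x \<and> \<psi> x)"
proof -
  obtain C where C: "finite C" "\<And>c. c \<in> C \<Longrightarrow> real_polynomial_function c"
    "\<And>x y. (\<And>c. c \<in> C \<Longrightarrow> sgn (c x) = sgn (c y)) \<Longrightarrow> \<phi> x \<longleftrightarrow> \<phi> y" using saE[OF assms(1)] by blast
  obtain D where D: "finite D" "\<And>c. c \<in> D \<Longrightarrow> real_polynomial_function c"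
    "\<And>x y. (\<And>c. c \<in> D \<Longrightarrow> sgn (c x) = sgn (c y)) \<Longrightarrow> \<psi> x \<longleftrightarrow> \<psi> y" using saE[OF assms(2)] by blast
  show ?thesis
  proof (rule saI[of "C \<union> D"])
    show "\<phi> y \<and> \<psi> y" if "\<And>c. c \<in> C \<union> D \<Longrightarrow> sgn (c x) = sgn (c y)" "\<phi> x \<and> \<psi> x" for x y
      using C(3)[of x y] D(3)[of x y] that by blast
  qed (use C D in auto)
qed

lemma disj_conv_conj_not: "P \<or> Q \<longleftrightarrow> \<not> (\<not> P \<and> \<not> Q)"
  by blast

lemma sa_disj: "sa_pred \<phi> \<Longrightarrow> sa_pred \<psi> \<Longrightarrow> sa_pred (\<lambda>x. \<phi> x \<or> \<psi> x)"
  unfolding disj_conv_conj_not by (intro sa_conj sa_not)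

lemma sa_imp: "sa_pred \<phi> \<Longrightarrow> sa_pred \<psi> \<Longrightarrow> sa_pred (\<lambda>x. \<phi> x \<longrightarrow> \<psi> x)"
  unfolding imp_conv_disj by (intro sa_disj sa_not)

lemma sa_const: "sa_pred (\<lambda>x. P)"
  by (rule saI[of "{}"]) auto

lemma sa_ball_finite:
  assumes "finite I" "\<And>i. i \<in> I \<Longrightarrow> sa_pred (\<phi> i)" shows "sa_pred (\<lambda>x. \<forall>i\<in>I. \<phi> i x)"
  using assms by (induction I rule: finite_induct) (simp_all add: sa_const sa_conj)

lemma sa_bex_finite:
  assumes "finite I" "\<And>i. i \<in> I \<Longrightarrow> sa_pred (\<phi> i)" shows "sa_pred (\<lambda>x. \<exists>i\<in>I. \<phi> i x)"
  using assms by (induction I rule: finite_induct) (simp_all add: sa_const sa_disj)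

lemma sa_poly_pos: "real_polynomial_function p \<Longrightarrow> sa_pred (\<lambda>x. p x > 0)"
  by (rule saI[of "{p}"]) (auto simp: sgn_if split: if_splits)

lemma sa_poly_zero: "real_polynomial_function p \<Longrightarrow> sa_pred (\<lambda>x. p x = 0)"
  by (rule saI[of "{p}"]) (auto simp: sgn_if split: if_splits)

lemma sa_poly_comp:
  assumes "sa_pred \<phi>" "polynomial_function f" shows "sa_pred (\<lambda>x. \<phi> (f x))"
proof -
  obtain C where C: "finite C" "\<And>c. c \<in> C \<Longrightarrow> real_polynomial_function c"
    "\<And>x y. (\<And>c. c \<in> C \<Longrightarrow> sgn (c x) = sgn (c y)) \<Longrightarrow> \<phi> x \<longleftrightarrow> \<phi> y" using saE[OF assms(1)] by blast
  show ?thesis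
  proof (rule saI[of "(\<lambda>c. c \<circ> f) ` C"])
    show "\<phi> (f y)" if "\<And>c. c \<in> (\<lambda>c. c \<circ> f) ` C \<Longrightarrow> sgn (c x) = sgn (c y)" "\<phi> (f x)" for x y
      using C(3)[of "f x" "f y"] that by (auto simp: o_def)
  qed (use C real_polynomial_function_compose[OF assms(2)] in auto)
qed

lemma fun_ring_polynomial: "fun_ring {f. real_polynomial_function f}"
  unfolding fun_ring_def by auto

text \<open>Separates the last real variable from the parameters, the form that
  \<open>sign_cells\<close> expects; a linear form contributes \<open>f (a, 0)\<close> and
  \<open>f (0, 1)\<close> as its two coefficients.\<close>

lemma polynomial_as_family:
  fixes p :: "'a::euclidean_space \<times> real \<Rightarrow> real"
  assumes "real_polynomial_function p"
  shows "\<exists>P n. poly_family {f. real_polynomial_function f} P n \<and> (\<forall>a y. p (a, y) = poly (P a) y)"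
  using assms
proof (induction p rule: real_polynomial_function.induct)
  case (linear f)
  have "poly_family {f. real_polynomial_function f} (\<lambda>a. [:f (a, 0), f (0, 1):]) 2"
    unfolding poly_family_def
  proof (intro conjI allI impI CollectI)
    have "bounded_linear (\<lambda>a. f (a, 0))"
      by (rule bounded_linear_compose[OF linear])
         (intro bounded_linear_Pair bounded_linear_ident bounded_linear_zero)
    then show "real_polynomial_function (\<lambda>a. coeff [:f (a, 0), f (0, 1):] i)" for i
      by (cases i; cases "i - 1") (auto simp: coeff_pCons split: nat.splits)
  qed (simp add: coeff_pCons numeral_2_eq_2 split: nat.split)
  moreover have "f (a, y) = poly [:f (a, 0), f (0, 1):] y" for a y
  proof -
    interpret bounded_linear f by fact
    have "(a, y) = (a, 0) + y *\<^sub>R (0, 1)" by simp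
    then have "f (a, y) = f (a, 0) + y * f (0, 1)" by (metis add scaleR real_scaleR_def)
    then show ?thesis by simp
  qed
  ultimately show ?case by blast
next
  case (const c)
  have "poly_family {f. real_polynomial_function f} (\<lambda>a. [:c:]) 1"
    unfolding poly_family_def by (auto simp: coeff_pCons split: nat.split)
  then show ?case by (intro exI[of _ "\<lambda>a. [:c:]"] exI[of _ 1]) simp
next
  case (add f g)
  obtain P n Q m where P: "poly_family {f. real_polynomial_function f} P n" "\<And>a y. f (a, y) = poly (P a) y"
    and Q: "poly_family {f. real_polynomial_function f} Q m" "\<And>a y. g (a, y) = poly (Q a) y" using add by blast
  have "poly_family {f. real_polynomial_function f} (\<lambda>a. P a + Q a) (max n m)"
    using P(1) Q(1) unfolding poly_family_def by auto
  then show ?case using P(2) Q(2) by (intro exI[of _ "\<lambda>a. P a + Q a"] exI[of _ "max n m"]) simp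
next
  case (mult f g)
  obtain P n Q m where P: "poly_family {f. real_polynomial_function f} P n" "\<And>a y. f (a, y) = poly (P a) y"
    and Q: "poly_family {f. real_polynomial_function f} Q m" "\<And>a y. g (a, y) = poly (Q a) y" using mult by blast
  have "poly_family {f. real_polynomial_function f} (\<lambda>a. P a * Q a) (n + m)"
    unfolding poly_family_def
  proof (intro conjI allI impI)
    show "(\<lambda>a. coeff (P a * Q a) i) \<in> {f. real_polynomial_function f}" for i
      unfolding coeff_mult
      by (intro fun_ring_sum fun_ringD fun_ring_polynomial poly_familyD(1)[OF P(1)] poly_familyD(1)[OF Q(1)]) auto
    show "coeff (P a * Q a) i = 0" if "n + m \<le> i" for a i
      unfolding coeff_mult
    proof (rule sum.neutral, rule ballI)
      fix j
      have "n \<le> j \<or> m \<le> i - j" using that by linarith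
      then show "coeff (P a) j * coeff (Q a) (i - j) = 0"
        using poly_familyD(2)[OF P(1), of j a] poly_familyD(2)[OF Q(1), of "i - j" a] by auto
    qed
  qed
  then show ?case using P(2) Q(2) by (intro exI[of _ "\<lambda>a. P a * Q a"] exI[of _ "n + m"]) simp
qed

text \<open>Tarski-Seidenberg projection along one variable. Parameters with equal signs on
  \<open>D\<close> have corresponding real lines, and a correspondent of a witness has the same sign
  vector, so it is again a witness.\<close>

lemma sa_ex_real:
  fixes \<phi> :: "'a::euclidean_space \<times> real \<Rightarrow> bool"
  assumes "sa_pred \<phi>" shows "sa_pred (\<lambda>a. \<exists>y. \<phi> (a, y))"
proof -
  obtain C where C: "finite C" "\<And>c. c \<in> C \<Longrightarrow> real_polynomial_function c"
    "\<And>x y. (\<And>c. c \<in> C \<Longrightarrow> sgn (c x) = sgn (c y)) \<Longrightarrow> \<phi> x \<longleftrightarrow> \<phi> y" using saE[OF assms(1)] by blast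
  have "\<forall>c\<in>C. \<exists>q. poly_family {f. real_polynomial_function f} (fst q) (snd q) \<and> (\<forall>a y. c (a, y) = poly (fst q a) y)"
    using polynomial_as_family[OF C(2)] by fastforce
  then obtain F where F: "\<And>c. c \<in> C \<Longrightarrow> poly_family {f. real_polynomial_function f} (fst (F c)) (snd (F c))"
      "\<And>c a y. c \<in> C \<Longrightarrow> c (a, y) = poly (fst (F c) a) y" by metis
  define M where "M = mset_set (F ` C)"
  have M: "set_mset M = F ` C" using C(1) by (simp add: M_def)
  have "\<exists>D. finite D \<and> D \<subseteq> {f. real_polynomial_function f} \<and> (\<forall>x x'. (\<forall>c\<in>D. sgn (c x) = sgn (c x')) \<longrightarrow>
           (\<exists>\<rho>. sign_corr (family_sgns (set_mset M) x) (family_sgns (set_mset M) x') \<rho>))"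
    by (rule sign_cells[OF fun_ring_polynomial]) (use F(1) M in auto)
  then obtain D where D: "finite D" "D \<subseteq> {f. real_polynomial_function f}"
     "\<And>x x'. (\<forall>c\<in>D. sgn (c x) = sgn (c x')) \<Longrightarrow>
           \<exists>\<rho>. sign_corr (family_sgns (F ` C) x) (family_sgns (F ` C) x') \<rho>" unfolding M by blast
  show ?thesis
  proof (rule saI[OF D(1)])
    show "real_polynomial_function c" if "c \<in> D" for c using D(2) that by auto
    fix x x' assume s: "\<And>c. c \<in> D \<Longrightarrow> sgn (c x) = sgn (c x')" and "\<exists>y. \<phi> (x, y)"
    then obtain y where y: "\<phi> (x, y)" by blast
    obtain \<rho> where \<rho>: "sign_corr (family_sgns (F ` C) x) (family_sgns (F ` C) x') \<rho>" using D(3) s by blast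
    obtain y' where y': "\<rho> y y'" using sign_corrD(1)[OF \<rho>] by blast
    have "sgn (c (x, y)) = sgn (c (x', y'))" if c: "c \<in> C" for c
    proof -
      have "family_sgns (F ` C) x y (F c) = family_sgns (F ` C) x' y' (F c)"
        by (rule fun_cong[OF sign_corrD(3)[OF \<rho> y']])
      then show ?thesis using c F(2)[OF c] by (simp add: family_sgns_def sgns_def)
    qed
    then have "\<phi> (x', y')" using C(3)[of "(x, y)" "(x', y')"] y by blast
    then show "\<exists>y. \<phi> (x', y)" by blast
  qed
qed

section \<open>Projection along Euclidean variables and the calculus of semi-algebraic
  functions\<close>

lemma polynomial_function_linear_comp:
  assumes "bounded_linear h" "polynomial_function f" shows "polynomial_function (\<lambda>x. h (f x))"
  using polynomial_function_compose[OF assms(2) polynomial_function_bounded_linear[OF assms(1)]]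
  by (simp add: o_def)

lemma polynomial_function_fst: "polynomial_function f \<Longrightarrow> polynomial_function (\<lambda>x. fst (f x))"
  by (rule polynomial_function_linear_comp[OF bounded_linear_fst])

lemma polynomial_function_snd: "polynomial_function f \<Longrightarrow> polynomial_function (\<lambda>x. snd (f x))"
  by (rule polynomial_function_linear_comp[OF bounded_linear_snd])

lemma polynomial_function_Pair:
  assumes "polynomial_function f" "polynomial_function g"
  shows "polynomial_function (\<lambda>x. (f x, g x))"
proof -
  have l: "bounded_linear (\<lambda>x. (x, 0))" "bounded_linear (\<lambda>x. (0, x))"
    by (intro bounded_linear_Pair bounded_linear_ident bounded_linear_zero)+
  have "polynomial_function (\<lambda>x. (f x, 0) + (0, g x))"
    by (intro polynomial_function_add polynomial_function_linear_comp[OF l(1) assms(1)]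
        polynomial_function_linear_comp[OF l(2) assms(2)])
  then show ?thesis by simp
qed

lemma polynomial_function_inner_poly:
  assumes "polynomial_function f" "polynomial_function g"
  shows "polynomial_function (\<lambda>x. f x \<bullet> (g x :: 'b::euclidean_space))"
proof -
  have "polynomial_function (\<lambda>x. \<Sum>b\<in>Basis. (f x \<bullet> b) *\<^sub>R (g x \<bullet> b))"
    by (intro polynomial_function_sum finite_Basis polynomial_function_mult polynomial_function_inner assms)
  then show ?thesis by (simp add: euclidean_inner[of "f _" "g _"])
qed

lemmas polynomial_intros = polynomial_function_Pair polynomial_function_fst polynomial_function_snd
  polynomial_function_add polynomial_function_diff polynomial_function_mult polynomial_function_inner_poly
  polynomial_function_const polynomial_function_id

lemma sa_ex:
  fixes \<phi> :: "'a::euclidean_space \<times> 'b::euclidean_space \<Rightarrow> bool"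
  assumes "sa_pred \<phi>" shows "sa_pred (\<lambda>a. \<exists>b. \<phi> (a, b))"
proof -
  \<comment> \<open>The Euclidean variable is eliminated one direction at a time. The free offset
    \<open>snd p\<close> absorbs the next coordinate; in the end the offset is 0 and the directions
    are a full basis.\<close>
  have *: "sa_pred (\<lambda>p. \<exists>g. \<phi> (fst p, snd p + (\<Sum>e\<in>E. g e *\<^sub>R e)))"
    if "finite E" for E
    using that
  proof (induction E rule: finite_induct)
    case empty then show ?case using assms by simp
  next
    case (insert e E)
    let ?\<psi> = "\<lambda>p. \<exists>g. \<phi> (fst p, snd p + (\<Sum>e\<in>E. g e *\<^sub>R e))"
    have "sa_pred (\<lambda>q::('a \<times> 'b) \<times> real. ?\<psi> (fst (fst q), snd (fst q) + snd q *\<^sub>R e))"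
      by (rule sa_poly_comp[OF insert.IH]) (intro polynomial_intros)
    from sa_ex_real[OF this]
    have "sa_pred (\<lambda>p. \<exists>r. ?\<psi> (fst p, snd p + r *\<^sub>R e))" by simp
    moreover have "(\<exists>r. ?\<psi> (fst p, snd p + r *\<^sub>R e)) \<longleftrightarrow>
        (\<exists>g. \<phi> (fst p, snd p + (\<Sum>e\<in>insert e E. g e *\<^sub>R e)))" for p
    proof
      assume "\<exists>r. ?\<psi> (fst p, snd p + r *\<^sub>R e)"
      then obtain r g where g: "\<phi> (fst p, snd p + r *\<^sub>R e + (\<Sum>e\<in>E. g e *\<^sub>R e))" by auto
      have "(\<Sum>e'\<in>E. (g(e := r)) e' *\<^sub>R e') = (\<Sum>e\<in>E. g e *\<^sub>R e)"
        using insert.hyps by (intro sum.cong) auto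
      then show "\<exists>g. \<phi> (fst p, snd p + (\<Sum>e\<in>insert e E. g e *\<^sub>R e))"
        using g insert.hyps by (intro exI[of _ "g(e := r)"]) (simp add: add.assoc)
    next
      assume "\<exists>g. \<phi> (fst p, snd p + (\<Sum>e\<in>insert e E. g e *\<^sub>R e))"
      then obtain g where "\<phi> (fst p, snd p + (\<Sum>e\<in>insert e E. g e *\<^sub>R e))" by blast
      then show "\<exists>r. ?\<psi> (fst p, snd p + r *\<^sub>R e)"
        using insert.hyps by (intro exI[of _ "g e"] exI[of _ g]) (simp add: add.assoc)
    qed
    ultimately show ?case by simp
  qed
  have "sa_pred (\<lambda>a. \<exists>g. \<phi> (fst (a, 0), snd (a, 0::'b) + (\<Sum>e\<in>Basis. g e *\<^sub>R e)))"
    using sa_poly_comp[OF *[OF finite_Basis], of "\<lambda>a. (a, 0)"] by (simp add: polynomial_intros)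
  moreover have "(\<exists>g. \<phi> (a, \<Sum>e\<in>Basis. g e *\<^sub>R e)) \<longleftrightarrow> (\<exists>b. \<phi> (a, b))" for a
    by (metis euclidean_representation)
  ultimately show ?thesis by simp
qed

lemma sa_all:
  assumes "sa_pred \<phi>" shows "sa_pred (\<lambda>a. \<forall>b. \<phi> (a, b))"
  using sa_not[OF sa_ex[OF sa_not[OF assms]]] by simp

definition sa_fun :: "('a::euclidean_space \<Rightarrow> 'b::euclidean_space) \<Rightarrow> bool" where
  "sa_fun f \<longleftrightarrow> sa_pred (\<lambda>p. snd p = f (fst p))"

lemma sa_fun_poly:
  assumes "polynomial_function f" shows "sa_fun f"
proof -
  have "polynomial_function (\<lambda>p. f (fst p))"
    using polynomial_function_compose[OF polynomial_function_bounded_linear[OF bounded_linear_fst] assms]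
    by (simp add: o_def)
  then have "polynomial_function (\<lambda>p. (snd p - f (fst p)) \<bullet> (snd p - f (fst p)))"
    by (intro polynomial_intros)
  then have "sa_pred (\<lambda>p. (snd p - f (fst p)) \<bullet> (snd p - f (fst p)) = 0)"
    by (intro sa_poly_zero) (simp add: real_polynomial_function_eq)
  then show ?thesis by (simp add: sa_fun_def)
qed

text \<open>Substituting a function known only by its graph costs a quantifier: some value equals
  \<open>f a\<close> and satisfies \<phi>.\<close>

lemma sa_comp:
  assumes "sa_pred \<phi>" "sa_fun f" shows "sa_pred (\<lambda>a. \<phi> (f a))"
proof -
  have "sa_pred (\<lambda>p. snd p = f (fst p) \<and> \<phi> (snd p))"
    by (intro sa_conj assms(2)[unfolded sa_fun_def] sa_poly_comp[OF assms(1)] polynomial_intros)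
  from sa_ex[OF this] show ?thesis by simp
qed

lemma sa_fun_comp:
  assumes "sa_fun g" "sa_fun f" shows "sa_fun (\<lambda>a. g (f a))"
proof -
  have "sa_pred (\<lambda>q. snd (fst q) = g (snd q))" 
    using sa_poly_comp[OF assms(1)[unfolded sa_fun_def], of "\<lambda>q. (snd q, snd (fst q))"]
    by (simp add: polynomial_intros)
  moreover have "sa_pred (\<lambda>q. snd q = f (fst (fst q)))"
    using sa_poly_comp[OF assms(2)[unfolded sa_fun_def], of "\<lambda>q. (fst (fst q), snd q)"]
    by (simp add: polynomial_intros)
  ultimately have "sa_pred (\<lambda>q. snd q = f (fst (fst q)) \<and> snd (fst q) = g (snd q))" by (intro sa_conj)
  from sa_ex[OF this] show ?thesis by (simp add: sa_fun_def)
qed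

lemma sa_fun_Pair:
  assumes "sa_fun f" "sa_fun g" shows "sa_fun (\<lambda>a. (f a, g a))"
proof -
  have "sa_pred (\<lambda>q. fst (snd q) = f (fst q))" 
    using sa_poly_comp[OF assms(1)[unfolded sa_fun_def], of "\<lambda>q. (fst q, fst (snd q))"]
    by (simp add: polynomial_intros)
  moreover have "sa_pred (\<lambda>q. snd (snd q) = g (fst q))"
    using sa_poly_comp[OF assms(2)[unfolded sa_fun_def], of "\<lambda>q. (fst q, snd (snd q))"]
    by (simp add: polynomial_intros)
  ultimately have "sa_pred (\<lambda>q. fst (snd q) = f (fst q) \<and> snd (snd q) = g (fst q))" by (intro sa_conj)
  then show ?thesis by (simp add: sa_fun_def prod_eq_iff)
qed

lemma sa_fun_const: "sa_fun (\<lambda>x. c)"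
  and sa_fun_id: "sa_fun (\<lambda>x. x)"
  by (rule sa_fun_poly, intro polynomial_intros)+

lemma sa_fun_poly_comp: "polynomial_function h \<Longrightarrow> sa_fun f \<Longrightarrow> sa_fun (\<lambda>x. h (f x))"
  by (rule sa_fun_comp[of h f, OF sa_fun_poly])


lemma sa_fun_linear: "bounded_linear h \<Longrightarrow> sa_fun f \<Longrightarrow> sa_fun (\<lambda>x. h (f x))"
  by (rule sa_fun_poly_comp[of h f, OF polynomial_function_bounded_linear])

lemma sa_fun_fst: "sa_fun f \<Longrightarrow> sa_fun (\<lambda>x. fst (f x))"
  by (rule sa_fun_linear[OF bounded_linear_fst])

lemma sa_fun_snd: "sa_fun f \<Longrightarrow> sa_fun (\<lambda>x. snd (f x))"
  by (rule sa_fun_linear[OF bounded_linear_snd])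

lemma sa_fun_add:
  assumes "sa_fun f" "sa_fun g" shows "sa_fun (\<lambda>x. f x + g x)"
  using sa_fun_poly_comp[OF _ sa_fun_Pair[OF assms], of "\<lambda>p. fst p + snd p"] by (simp add: polynomial_intros)

lemma sa_fun_diff:
  assumes "sa_fun f" "sa_fun g" shows "sa_fun (\<lambda>x. f x - g x)"
  using sa_fun_poly_comp[OF _ sa_fun_Pair[OF assms], of "\<lambda>p. fst p - snd p"] by (simp add: polynomial_intros)

lemma sa_fun_inner:
  assumes "sa_fun f" "sa_fun g" shows "sa_fun (\<lambda>x. f x \<bullet> g x)"
  using sa_fun_poly_comp[OF _ sa_fun_Pair[OF assms], of "\<lambda>p. fst p \<bullet> snd p"] by (simp add: polynomial_intros)

lemma sa_fun_mult:
  fixes f g :: "_ \<Rightarrow> real"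
  assumes "sa_fun f" "sa_fun g" shows "sa_fun (\<lambda>x. f x * g x)"
  using sa_fun_inner[OF assms] by simp

lemma sa_fun_sum:
  assumes "finite I" "\<And>i. i \<in> I \<Longrightarrow> sa_fun (f i)" shows "sa_fun (\<lambda>x. \<Sum>i\<in>I. f i x)"
  using assms by (induction I rule: finite_induct) (simp_all add: sa_fun_const sa_fun_add)

lemma sa_eq:
  assumes "sa_fun f" "sa_fun g" shows "sa_pred (\<lambda>x. f x = g x)"
proof -
  have "sa_pred (\<lambda>p::'b \<times> 'b. (fst p - snd p) \<bullet> (fst p - snd p) = 0)"
    by (rule sa_poly_zero) (simp only: real_polynomial_function_eq, intro polynomial_intros)
  from sa_comp[OF this sa_fun_Pair[OF assms]] show ?thesis by simp
qed

lemma sa_less: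
  fixes f g :: "_ \<Rightarrow> real"
  assumes "sa_fun f" "sa_fun g" shows "sa_pred (\<lambda>x. f x < g x)"
proof -
  have "sa_pred (\<lambda>p::real \<times> real. snd p - fst p > 0)"
    by (rule sa_poly_pos) (simp only: real_polynomial_function_eq, intro polynomial_intros)
  from sa_comp[OF this sa_fun_Pair[OF assms]] show ?thesis by simp
qed

lemma sa_le:
  fixes f g :: "_ \<Rightarrow> real"
  assumes "sa_fun f" "sa_fun g" shows "sa_pred (\<lambda>x. f x \<le> g x)"
  using sa_not[OF sa_less[OF assms(2,1)]] by (simp add: not_less)

text \<open>The norm is not polynomial, but its graph is: a nonnegative number whose square is the
  inner product of the vector with itself.\<close>

lemma sa_fun_norm:
  assumes "sa_fun f" shows "sa_fun (\<lambda>x. norm (f x))"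
proof -
  have "sa_pred (\<lambda>p::'b \<times> real. 0 \<le> snd p \<and> snd p * snd p = fst p \<bullet> fst p)"
    by (intro sa_conj sa_le sa_eq sa_fun_const sa_fun_inner sa_fun_mult sa_fun_fst sa_fun_snd sa_fun_id)
  moreover have "0 \<le> r \<and> r * r = x \<bullet> x \<longleftrightarrow> r = norm x" for r and x :: 'b
    by (metis dot_square_norm norm_ge_zero power2_eq_iff_nonneg power2_eq_square)
  ultimately have "sa_fun (norm :: 'b \<Rightarrow> real)" by (simp add: sa_fun_def)
  then show ?thesis using assms by (rule sa_fun_comp)
qed

lemmas sa_intros = sa_not sa_conj sa_disj sa_imp sa_const sa_eq sa_less sa_le sa_fun_const sa_fun_id sa_fun_fst
  sa_fun_snd sa_fun_Pair sa_fun_add sa_fun_diff sa_fun_mult sa_fun_inner sa_fun_norm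

lemma sa_exI: "sa_pred (\<lambda>p. \<phi> (fst p) (snd p)) \<Longrightarrow> sa_pred (\<lambda>a. \<exists>b. \<phi> a b)"
  by (drule sa_ex) simp

lemma sa_allI: "sa_pred (\<lambda>p. \<phi> (fst p) (snd p)) \<Longrightarrow> sa_pred (\<lambda>a. \<forall>b. \<phi> a b)"
  by (drule sa_all) simp

section \<open>Semi-algebraic functions of one real variable\<close>

lemma poly_sgn_right:
  fixes p :: "real poly"
  shows "\<exists>\<sigma>. \<exists>\<delta>>0. \<forall>s. a < s \<and> s < a + \<delta> \<longrightarrow> sgn (poly p s) = \<sigma>"
proof (cases "p = 0")
  case True then show ?thesis by (intro exI[of _ 0] exI[of _ 1]) simp
next
  case False
  define A where "A = {x. poly p x = 0} \<inter> {a<..}"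
  have fin: "finite A" using poly_roots_finite[OF False] by (simp add: A_def)
  obtain \<delta> where \<delta>: "\<delta> > 0" "\<And>s. a < s \<Longrightarrow> s < a + \<delta> \<Longrightarrow> poly p s \<noteq> 0"
  proof (cases "A = {}")
    case True
    show ?thesis by (rule that[of 1]) (use True in \<open>auto simp: A_def\<close>)
  next
    case ne: False
    have "Min A > a" using Min_in[OF fin ne] by (simp add: A_def)
    moreover have "poly p s \<noteq> 0" if "a < s" "s < Min A" for s
    proof
      assume "poly p s = 0"
      then have "s \<in> A" using that by (simp add: A_def)
      then show False using Min_le[OF fin] that by fastforce
    qed
    ultimately show ?thesis by (intro that[of "Min A - a"]) auto
  qed
  have "sgn (poly p s) = sgn (poly p (a + \<delta> / 2))" if s: "a < s" "s < a + \<delta>" for s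
  proof (cases "s \<le> a + \<delta> / 2")
    case True
    show ?thesis by (rule poly_sgn_constant[symmetric, OF _ True]) (use \<delta> s in force)
  next
    case False
    show ?thesis by (rule poly_sgn_constant) (use \<delta> s False in force)+
  qed
  then show ?thesis using \<delta>(1) by blast
qed

text \<open>Each of the finitely many deciding polynomials has constant sign just to the right of
  \<open>a\<close>, hence so does the whole sign vector.\<close>

lemma sa_right_dichotomy:
  fixes \<phi> :: "real \<Rightarrow> bool"
  assumes "sa_pred \<phi>"
  shows "\<exists>P. \<exists>\<delta>>0. \<forall>s. a < s \<and> s < a + \<delta> \<longrightarrow> (\<phi> s \<longleftrightarrow> P)"
proof -
  obtain C where C: "finite C" "\<And>c. c \<in> C \<Longrightarrow> real_polynomial_function c"
    "\<And>x y. (\<And>c. c \<in> C \<Longrightarrow> sgn (c x) = sgn (c y)) \<Longrightarrow> \<phi> x \<longleftrightarrow> \<phi> y" using saE[OF assms(1)] by blast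
  have "\<exists>\<sigma>. \<exists>\<delta>>0. \<forall>s. a < s \<and> s < a + \<delta> \<longrightarrow> sgn (c s) = \<sigma>" if "c \<in> C" for c
  proof -
    obtain k n where "c = (\<lambda>x. \<Sum>i\<le>n. k i * x ^ i)" using real_polynomial_function_imp_sum[OF C(2)[OF \<open>c \<in> C\<close>]] by blast
    then have "c x = poly (\<Sum>i\<le>n. monom (k i) i) x" for x by (simp add: poly_sum poly_monom)
    then show ?thesis using poly_sgn_right[of a "\<Sum>i\<le>n. monom (k i) i"] by simp
  qed
  then obtain \<sigma> \<delta> where \<sigma>: "\<And>c. c \<in> C \<Longrightarrow> \<delta> c > 0 \<and> (\<forall>s. a < s \<and> s < a + \<delta> c \<longrightarrow> sgn (c s) = \<sigma> c)"
    by metis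
  define \<epsilon> where "\<epsilon> = Min (insert 1 (\<delta> ` C))"
  have \<epsilon>: "\<epsilon> > 0" "\<And>c. c \<in> C \<Longrightarrow> \<epsilon> \<le> \<delta> c" using C(1) \<sigma> by (auto simp: \<epsilon>_def)
  have "\<phi> s \<longleftrightarrow> \<phi> (a + \<epsilon> / 2)" if s: "a < s" "s < a + \<epsilon>" for s
  proof (rule C(3))
    fix c assume c: "c \<in> C"
    have "sgn (c s) = \<sigma> c" using \<sigma>[OF c] \<epsilon>(2)[OF c] s by simp
    moreover have "sgn (c (a + \<epsilon> / 2)) = \<sigma> c" using \<sigma>[OF c] \<epsilon>(2)[OF c] \<epsilon>(1) by simp
    ultimately show "sgn (c s) = sgn (c (a + \<epsilon> / 2))" by simp
  qed
  then show ?thesis using \<epsilon>(1) by blast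
qed

section \<open>One-sided germs and monotonicity near zero\<close>

lemma sa_fun_minus: "sa_fun f \<Longrightarrow> sa_fun (\<lambda>x. - f x)"
  by (rule sa_fun_linear[OF bounded_linear_minus[OF bounded_linear_ident]])

lemma sa_sgn:
  assumes "sa_fun f" shows "sa_pred (\<lambda>x. sgn (f x :: real) = k)"
proof -
  have "sgn u = k \<longleftrightarrow> (0 < u \<and> k = 1) \<or> (u = 0 \<and> k = 0) \<or> (u < 0 \<and> k = - 1)" for u :: real
    by (auto simp: sgn_if)
  then show ?thesis by (simp only:) (intro sa_intros assms)
qed

text \<open>The local behaviour is expressed by a first-order formula in \<open>t\<close>, so that
  it is itself subject to \<open>sa_right_dichotomy\<close>.\<close>

definition right_germ :: "(real \<Rightarrow> real) \<Rightarrow> real \<Rightarrow> real \<Rightarrow> bool" where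
  "right_germ g k t \<longleftrightarrow> (\<exists>\<delta>. 0 < \<delta> \<and> (\<forall>s. t < s \<and> s < t + \<delta> \<longrightarrow> sgn (g s - g t) = k))"

definition left_germ :: "(real \<Rightarrow> real) \<Rightarrow> real \<Rightarrow> real \<Rightarrow> bool" where
  "left_germ g k t \<longleftrightarrow> (\<exists>\<delta>. 0 < \<delta> \<and> (\<forall>s. t - \<delta> < s \<and> s < t \<longrightarrow> sgn (g s - g t) = k))"

lemma sa_right_germ:
  assumes g: "sa_fun g" shows "sa_pred (right_germ g k)"
  unfolding right_germ_def
  by (intro sa_exI sa_conj sa_allI sa_imp sa_sgn sa_less sa_fun_diff sa_fun_add sa_fun_const
      sa_fun_comp[OF g] sa_fun_fst sa_fun_snd sa_fun_id)

lemma sa_left_germ: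
  assumes g: "sa_fun g" shows "sa_pred (left_germ g k)"
  unfolding left_germ_def
  by (intro sa_exI sa_conj sa_allI sa_imp sa_sgn sa_less sa_fun_diff sa_fun_add sa_fun_const
      sa_fun_comp[OF g] sa_fun_fst sa_fun_snd sa_fun_id)

lemma ex_right_germ:
  assumes "sa_fun g" shows "\<exists>k\<in>{-1, 0, 1}. right_germ g k t"
proof (rule ccontr)
  assume n: "\<not> ?thesis"
  have "\<exists>\<delta>>0. \<forall>s. t < s \<and> s < t + \<delta> \<longrightarrow> sgn (g s - g t) \<noteq> k" if "k \<in> {-1, 0, 1}" for k
  proof -
    have "sa_pred (\<lambda>s. sgn (g s - g t) = k)" by (intro sa_sgn sa_fun_diff assms sa_fun_const)
    from sa_right_dichotomy[OF this, of t] obtain P \<delta> where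
      \<delta>: "\<delta> > 0" "\<forall>s. t < s \<and> s < t + \<delta> \<longrightarrow> (sgn (g s - g t) = k \<longleftrightarrow> P)" by blast
    have "\<not> P" using n that \<delta> unfolding right_germ_def by blast
    then show ?thesis using \<delta> by blast
  qed
  then obtain \<delta> where \<delta>: "\<And>k. k \<in> {-1, 0, 1} \<Longrightarrow> \<delta> k > 0 \<and> (\<forall>s. t < s \<and> s < t + \<delta> k \<longrightarrow> sgn (g s - g t) \<noteq> k)"
    by metis
  define s where "s = t + min (\<delta> (-1)) (min (\<delta> 0) (\<delta> 1)) / 2"
  have "t < s \<and> s < t + \<delta> k" if "k \<in> {-1, 0, 1}" for k
    using \<delta>[of "-1"] \<delta>[of 0] \<delta>[of 1] that unfolding s_def by auto
  then have "sgn (g s - g t) \<noteq> k" if "k \<in> {-1, 0, 1}" for k using \<delta> that by blast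
  moreover have "sgn (g s - g t) \<in> {-1, 0, 1}" by (simp add: sgn_if)
  ultimately show False by blast
qed

lemma ex_left_germ:
  assumes "sa_fun g" shows "\<exists>k\<in>{-1, 0, 1}. left_germ g k t"
proof -
  obtain k where k: "k \<in> {-1, 0, 1}" "right_germ (\<lambda>s. g (- s)) k (- t)"
    using ex_right_germ[OF sa_fun_comp[OF assms sa_fun_minus[OF sa_fun_id]], of "- t"] by blast
  then obtain \<delta> where \<delta>: "\<delta> > 0" "\<And>s. - t < s \<and> s < - t + \<delta> \<Longrightarrow> sgn (g (- s) - g t) = k"
    unfolding right_germ_def by auto
  have "sgn (g s - g t) = k" if "t - \<delta> < s \<and> s < t" for s using \<delta>(2)[of "- s"] that by simp
  then have "left_germ g k t" using \<delta>(1) unfolding left_germ_def by blast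
  then show ?thesis using k(1) by blast
qed

text \<open>Bolzano bisection applied to the transitive relation \<open>g u <= g v\<close>; the
  argument covers discontinuous \<open>g\<close> as well.\<close>

lemma locally_mono_imp_le:
  fixes g :: "real \<Rightarrow> real"
  assumes "a \<le> b"
    and "\<And>t. a \<le> t \<Longrightarrow> t \<le> b \<Longrightarrow> \<exists>\<delta>>0. \<forall>s. t - \<delta> < s \<and> s < t \<longrightarrow> g s \<le> g t"
    and "\<And>t. a \<le> t \<Longrightarrow> t \<le> b \<Longrightarrow> \<exists>\<delta>>0. \<forall>s. t < s \<and> s < t + \<delta> \<longrightarrow> g t \<le> g s"
  shows "g a \<le> g b"
proof (rule Bolzano[OF assms(1), where P = "\<lambda>u v. g u \<le> g v"])
  fix x assume x: "a \<le> x" "x \<le> b"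
  obtain \<delta> \<epsilon> where d: "\<delta> > 0" "\<forall>s. x - \<delta> < s \<and> s < x \<longrightarrow> g s \<le> g x"
      "\<epsilon> > 0" "\<forall>s. x < s \<and> s < x + \<epsilon> \<longrightarrow> g x \<le> g s" using assms(2,3)[OF x] by blast
  have "g u \<le> g v" if "u \<le> x \<and> x \<le> v \<and> v - u < min \<delta> \<epsilon>" for u v
  proof -
    have "g u \<le> g x" using d(2) that by (cases "u = x") auto
    also have "g x \<le> g v" using d(4) that by (cases "v = x") auto
    finally show ?thesis .
  qed
  then show "\<exists>d>0. \<forall>u v. u \<le> x \<and> x \<le> v \<and> v - u < d \<longrightarrow> g u \<le> g v"
    using d by (intro exI[of _ "min \<delta> \<epsilon>"]) auto
qed auto

text \<open>A rational interval around \<open>t\<close> inside its window determines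
  \<open>t\<close>: two points sharing an interval lie in each other's windows, and each value would
  be strictly below the other.\<close>

lemma countable_strict_local_max:
  fixes g :: "real \<Rightarrow> real"
  assumes "\<And>t. t \<in> T \<Longrightarrow> \<exists>\<delta>>0. \<forall>s. s \<noteq> t \<and> \<bar>s - t\<bar> < \<delta> \<longrightarrow> g s < g t"
  shows "countable T"
proof -
  obtain \<delta> where \<delta>: "\<And>t. t \<in> T \<Longrightarrow> \<delta> t > 0 \<and> (\<forall>s. s \<noteq> t \<and> \<bar>s - t\<bar> < \<delta> t \<longrightarrow> g s < g t)"
    using assms by metis
  have "\<exists>p q :: rat. t - \<delta> t < of_rat p \<and> of_rat p < t \<and> t < of_rat q \<and> of_rat q < t + \<delta> t" if "t \<in> T" for t
    using of_rat_dense[of "t - \<delta> t" t] of_rat_dense[of t "t + \<delta> t"] \<delta>[OF that] by auto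
  then obtain p q :: "real \<Rightarrow> rat" where pq: "\<And>t. t \<in> T \<Longrightarrow> t - \<delta> t < of_rat (p t) \<and> of_rat (p t) < t \<and>
      t < of_rat (q t) \<and> of_rat (q t) < t + \<delta> t" by metis
  have "inj_on (\<lambda>t. (p t, q t)) T"
  proof (rule inj_onI, rule ccontr)
    fix t u assume t: "t \<in> T" and u: "u \<in> T" and e: "(p t, q t) = (p u, q u)" and ne: "t \<noteq> u"
    have "\<bar>u - t\<bar> < \<delta> t" using pq[OF t] pq[OF u] e by (auto simp: abs_less_iff)
    then have "g u < g t" using \<delta>[OF t] ne by auto
    moreover have "\<bar>t - u\<bar> < \<delta> u" using pq[OF t] pq[OF u] e by (auto simp: abs_less_iff)
    then have "g t < g u" using \<delta>[OF u] ne by auto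
    ultimately show False by simp
  qed
  then show ?thesis by (rule countableI')
qed

lemma no_strict_local_max_interval:
  fixes g :: "real \<Rightarrow> real"
  assumes "\<epsilon> > 0" "\<And>t. 0 < t \<Longrightarrow> t < \<epsilon> \<Longrightarrow> left_germ g (-1) t \<and> right_germ g (-1) t"
  shows False
proof -
  have "countable {0<..<\<epsilon>}"
  proof (rule countable_strict_local_max[of _ g])
    fix t assume "t \<in> {0<..<\<epsilon>}"
    then obtain \<delta> \<eta> where d: "\<delta> > 0" "\<And>s. t - \<delta> < s \<and> s < t \<Longrightarrow> sgn (g s - g t) = - 1"
      "\<eta> > 0" "\<And>s. t < s \<and> s < t + \<eta> \<Longrightarrow> sgn (g s - g t) = - 1"
      using assms(2) unfolding left_germ_def right_germ_def by (metis greaterThanLessThan_iff)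
    have "g s < g t" if "s \<noteq> t \<and> \<bar>s - t\<bar> < min \<delta> \<eta>" for s
    proof -
      have "sgn (g s - g t) = - 1" using d(2)[of s] d(4)[of s] that by (cases "s < t") auto
      then show ?thesis by (simp add: sgn_if split: if_splits)
    qed
    then show "\<exists>\<delta>>0. \<forall>s. s \<noteq> t \<and> \<bar>s - t\<bar> < \<delta> \<longrightarrow> g s < g t" using d by (intro exI[of _ "min \<delta> \<eta>"]) auto
  qed
  then show False using assms(1) uncountable_open_interval by blast
qed

lemma germ_minus:
  "left_germ g k t \<Longrightarrow> left_germ (\<lambda>t. - g t) (- k) t"
  "right_germ g k t \<Longrightarrow> right_germ (\<lambda>t. - g t) (- k) t"
proof -
  have "sgn (- g s - - g t) = - sgn (g s - g t)" for s by (simp add: sgn_if)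
  then show "left_germ g k t \<Longrightarrow> left_germ (\<lambda>t. - g t) (- k) t"
    "right_germ g k t \<Longrightarrow> right_germ (\<lambda>t. - g t) (- k) t"
    unfolding left_germ_def right_germ_def by auto
qed

lemma germ_mono_on:
  assumes "\<And>t. 0 < t \<Longrightarrow> t < \<epsilon> \<Longrightarrow> left_germ g k t \<and> right_germ g m t" "k \<le> 0" "0 \<le> m"
  shows "mono_on {0<..<\<epsilon>} g"
proof (rule mono_onI)
  fix a b assume ab: "a \<in> {0<..<\<epsilon>}" "b \<in> {0<..<\<epsilon>}" "a \<le> b"
  show "g a \<le> g b"
  proof (rule locally_mono_imp_le[OF ab(3)])
    fix t assume "a \<le> t" "t \<le> b"
    then have t: "left_germ g k t" "right_germ g m t" using assms(1) ab by auto
    show "\<exists>\<delta>>0. \<forall>s. t - \<delta> < s \<and> s < t \<longrightarrow> g s \<le> g t"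
      using t(1) assms(2) unfolding left_germ_def by (force simp: sgn_if split: if_splits)
    show "\<exists>\<delta>>0. \<forall>s. t < s \<and> s < t + \<delta> \<longrightarrow> g t \<le> g s"
      using t(2) assms(3) unfolding right_germ_def by (force simp: sgn_if split: if_splits)
  qed
qed

text \<open>The pair of one-sided germ signs is constant near 0. Compatible signs give monotonicity
  by bisection; equal nonzero signs would make every point of an interval a strict local maximum, of
  \<open>g\<close> or of its negative, and only countably many such points exist.\<close>

lemma sa_fun_eventually_monotone:
  fixes g :: "real \<Rightarrow> real"
  assumes g: "sa_fun g"
  shows "\<exists>\<epsilon>>0. mono_on {0<..<\<epsilon>} g \<or> mono_on {0<..<\<epsilon>} (\<lambda>t. - g t)"
proof -
  define K where "K = {-1, 0, 1::real} \<times> {-1, 0, 1::real}"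
  define \<phi> where "\<phi> q t \<longleftrightarrow> left_germ g (fst q) t \<and> right_germ g (snd q) t" for q t
  have "sa_pred (\<phi> q)" for q unfolding \<phi>_def by (intro sa_conj sa_left_germ sa_right_germ g)
  then have "\<exists>P. \<exists>\<delta>>0. \<forall>s. 0 < s \<and> s < 0 + \<delta> \<longrightarrow> (\<phi> q s \<longleftrightarrow> P)" for q by (rule sa_right_dichotomy)
  then obtain P \<delta> where P: "\<And>q. \<delta> q > 0 \<and> (\<forall>s. 0 < s \<and> s < \<delta> q \<longrightarrow> (\<phi> q s \<longleftrightarrow> P q))"
    unfolding add_0 by metis
  \<comment> \<open>One sample point inside all nine windows: the pair of germs found there is the
    one that holds throughout its window.\<close>
  define s where "s = Min (\<delta> ` K) / 2"
  have K: "finite K" "K \<noteq> {}" by (auto simp: K_def)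
  have s0: "s > 0" using K P by (simp add: s_def)
  have s: "s < \<delta> q" if "q \<in> K" for q
  proof -
    have "Min (\<delta> ` K) \<le> \<delta> q" using K that by simp
    then show ?thesis using s0 by (simp add: s_def)
  qed
  obtain k m where "k \<in> {-1, 0, 1}" "left_germ g k s" "m \<in> {-1, 0, 1}" "right_germ g m s"
    using ex_left_germ[OF g] ex_right_germ[OF g] by blast
  then have km: "(k, m) \<in> K" "\<phi> (k, m) s" by (auto simp: K_def \<phi>_def)
  define \<epsilon> where "\<epsilon> = \<delta> (k, m)"
  have \<epsilon>: "\<epsilon> > 0" using P by (simp add: \<epsilon>_def)
  have "P (k, m)" using P[of "(k, m)"] s[OF km(1)] s0 km(2) by blast
  then have germ: "left_germ g k t \<and> right_germ g m t" if "0 < t" "t < \<epsilon>" for t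
    using P[of "(k, m)"] that unfolding \<epsilon>_def \<phi>_def by auto
  have germ': "left_germ (\<lambda>t. - g t) (- k) t \<and> right_germ (\<lambda>t. - g t) (- m) t" if "0 < t" "t < \<epsilon>" for t
    using germ[OF that] germ_minus by blast
  consider "k \<le> 0" "0 \<le> m" | "0 \<le> k" "m \<le> 0" | "k = -1" "m = -1" | "k = 1" "m = 1"
    using km(1) by (auto simp: K_def)
  then show ?thesis
  proof cases
    case 1 then show ?thesis using germ_mono_on[of \<epsilon> g k m] germ \<epsilon> by blast
  next
    case 2 then show ?thesis using germ_mono_on[of \<epsilon> "\<lambda>t. - g t" "- k" "- m"] germ' \<epsilon> by force
  next
    case 3 then show ?thesis using no_strict_local_max_interval[OF \<epsilon>, of g] germ by blast
  next
    case 4 then show ?thesis using no_strict_local_max_interval[OF \<epsilon>, of "\<lambda>t. - g t"] germ' by auto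
  qed
qed

lemma summable_monotone_increments:
  fixes g :: "real \<Rightarrow> real"
  assumes g: "mono_on {0<..<\<epsilon>} g" "\<And>t. \<bar>g t\<bar> \<le> B"
    and t: "\<And>l. 0 < t l" "t \<longlonglongrightarrow> 0" "\<And>l. t (Suc l) \<le> t l" "\<epsilon> > 0"
  shows "summable (\<lambda>l. \<bar>g (t l) - g (t (Suc l))\<bar>)"
proof -
  obtain n where n: "t l < \<epsilon>" if "l \<ge> n" for l
    using order_tendstoD(2)[OF t(2,4)] unfolding eventually_sequentially by blast
  \<comment> \<open>The shift by \<open>n\<close> enters the interval of monotonicity; the minus
    sign turns the decreasing arguments into an increasing sequence.\<close>
  define h where "h l = - g (t (l + n))" for l
  have mono: "h l \<le> h (Suc l)" for l
    using mono_onD[OF g(1), of "t (Suc l + n)" "t (l + n)"] n t by (simp add: h_def)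
  have "convergent h"
  proof (rule Bseq_monoseq_convergent)
    show "Bseq h" using g(2) by (intro BseqI'[of _ B]) (simp add: h_def)
    show "monoseq h" using mono by (simp add: monoseq_Suc)
  qed
  then obtain c where "h \<longlonglongrightarrow> c" by (auto simp: convergent_def)
  from telescope_summable[OF this] have "summable (\<lambda>l. h (Suc l) - h l)" .
  moreover have "h (Suc l) - h l = \<bar>g (t (l + n)) - g (t (Suc (l + n)))\<bar>" for l
    using mono[of l] by (simp add: h_def)
  ultimately show ?thesis using summable_iff_shift[of "\<lambda>l. \<bar>g (t l) - g (t (Suc l))\<bar>" n] by simp
qed

text \<open>Each coordinate is monotone near 0 and bounded, so its increments telescope; the norm is
  at most the sum of the coordinate increments.\<close>

lemma sa_fun_finite_variation:
  fixes y :: "real \<Rightarrow> 'a::euclidean_space"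
  assumes y: "sa_fun y" "\<And>t. norm (y t) \<le> B"
    and t: "\<And>l. 0 < t l" "t \<longlonglongrightarrow> 0" "\<And>l. t (Suc l) \<le> t l"
  shows "summable (\<lambda>l. norm (y (t l) - y (t (Suc l))))"
proof (rule summable_comparison_test')
  have "summable (\<lambda>l. \<bar>y (t l) \<bullet> e - y (t (Suc l)) \<bullet> e\<bar>)" if "e \<in> Basis" for e
  proof -
    have "sa_fun (\<lambda>t. y t \<bullet> e)" by (intro sa_intros y)
    then obtain \<epsilon> where \<epsilon>: "\<epsilon> > 0" "mono_on {0<..<\<epsilon>} (\<lambda>t. y t \<bullet> e) \<or> mono_on {0<..<\<epsilon>} (\<lambda>t. - (y t \<bullet> e))"
      using sa_fun_eventually_monotone by blast
    have B: "\<bar>y t \<bullet> e\<bar> \<le> B" for t using Basis_le_norm[OF that] y(2) order_trans by blast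
    show ?thesis
      using \<epsilon>(2)
    proof
      assume "mono_on {0<..<\<epsilon>} (\<lambda>t. y t \<bullet> e)"
      from summable_monotone_increments[OF this B t \<epsilon>(1)] show ?thesis .
    next
      assume *: "mono_on {0<..<\<epsilon>} (\<lambda>t. - (y t \<bullet> e))"
      have "\<bar>- (y t \<bullet> e)\<bar> \<le> B" for t using B by simp
      from summable_monotone_increments[OF * this t \<epsilon>(1)] show ?thesis by (simp add: abs_minus_commute)
    qed
  qed
  then show "summable (\<lambda>l. \<Sum>e\<in>Basis. \<bar>(y (t l) - y (t (Suc l))) \<bullet> e\<bar>)"
    by (intro summable_sum) (simp add: inner_diff_left)
  show "norm (norm (y (t l) - y (t (Suc l)))) \<le> (\<Sum>e\<in>Basis. \<bar>(y (t l) - y (t (Suc l))) \<bullet> e\<bar>)" if "l \<ge> 0" for l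
    using norm_le_l1 by simp
qed

section \<open>Descent sequences of semi-algebraic functions\<close>

definition minimizers :: "(real \<Rightarrow> 'a::euclidean_space \<Rightarrow> bool) \<Rightarrow> 'a \<Rightarrow> real \<Rightarrow> 'a \<Rightarrow> bool" where
  "minimizers S e t x \<longleftrightarrow> S t x \<and> (\<forall>x'. S t x' \<longrightarrow> x \<bullet> e \<le> x' \<bullet> e)"

lemma sa_minimizers:
  assumes S: "sa_pred (\<lambda>p. S (fst p) (snd p))"
  shows "sa_pred (\<lambda>p. minimizers S e (fst p) (snd p))"
proof -
  have S': "sa_pred (\<lambda>a. S (f a) (g a))" if "sa_fun f" "sa_fun g" for f g
    using sa_comp[OF S sa_fun_Pair[OF that]] by simp
  show ?thesis unfolding minimizers_def
    by (intro sa_conj sa_allI sa_imp sa_le S' sa_fun_inner sa_fun_const sa_fun_fst sa_fun_snd sa_fun_id)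
qed

lemma compact_minimizers:
  assumes "compact {x. S t x}" shows "compact {x. minimizers S e t x}"
proof -
  have "{x. minimizers S e t x} = {x. S t x} \<inter> (\<Inter>x'\<in>{x'. S t x'}. {x. x \<bullet> e \<le> x' \<bullet> e})"
    by (auto simp: minimizers_def)
  moreover have "closed {x. x \<bullet> e \<le> c}" for c
    by (intro closed_Collect_le continuous_intros)
  ultimately show ?thesis using assms by (auto intro!: compact_Int_closed closed_INT)
qed

lemma ex_minimizers:
  assumes "compact {x. S t x}" "S t x0" shows "\<exists>x. minimizers S e t x"
proof -
  have "continuous_on {x. S t x} (\<lambda>x. x \<bullet> e)" by (intro continuous_intros)
  then obtain x where "x \<in> {x. S t x}" "\<forall>y\<in>{x. S t x}. x \<bullet> e \<le> y \<bullet> e"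
    using continuous_attains_inf[OF assms(1), of "\<lambda>x. x \<bullet> e"] assms(2) by blast
  then show ?thesis unfolding minimizers_def by blast
qed

text \<open>The selected point is the lexicographic minimum of the compact fibre.\<close>

lemma sa_selection:
  fixes S :: "real \<Rightarrow> 'a::euclidean_space \<Rightarrow> bool"
  assumes S: "sa_pred (\<lambda>p. S (fst p) (snd p))" "\<And>t. compact {x. S t x}"
  shows "\<exists>y. sa_fun y \<and> (\<forall>t. (\<exists>x. S t x) \<longrightarrow> S t (y t)) \<and> (\<forall>t. (\<nexists>x. S t x) \<longrightarrow> y t = 0)"
proof -
  \<comment> \<open>Invariant while minimising one coordinate after another: the remaining set
    \<open>T\<close> stays compact, so the next minimum is attained, and its points agree in all
    coordinates treated so far. After the whole basis a single point is left.\<close>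
  have "\<exists>T. sa_pred (\<lambda>p. T (fst p) (snd p)) \<and> (\<forall>t. compact {x. T t x}) \<and> (\<forall>t x. T t x \<longrightarrow> S t x) \<and>
      (\<forall>t. (\<exists>x. S t x) \<longrightarrow> (\<exists>x. T t x)) \<and> (\<forall>t x x'. T t x \<longrightarrow> T t x' \<longrightarrow> (\<forall>e\<in>E. x \<bullet> e = x' \<bullet> e))"
    if "finite E" for E :: "'a set"
    using that
  proof (induction E rule: finite_induct)
    case empty then show ?case using S by blast
  next
    case (insert e E)
    then obtain T where T: "sa_pred (\<lambda>p. T (fst p) (snd p))" "\<And>t. compact {x. T t x}" "\<And>t x. T t x \<Longrightarrow> S t x"
      "\<And>t. (\<exists>x. S t x) \<Longrightarrow> (\<exists>x. T t x)" "\<And>t x x'. T t x \<Longrightarrow> T t x' \<Longrightarrow> (\<forall>e\<in>E. x \<bullet> e = x' \<bullet> e)" by blast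
    show ?case
    proof (intro exI[of _ "minimizers T e"] conjI allI impI)
      show "sa_pred (\<lambda>p. minimizers T e (fst p) (snd p))" by (rule sa_minimizers[OF T(1)])
      show "compact {x. minimizers T e t x}" for t by (rule compact_minimizers[of T t, OF T(2)])
      show "S t x" if "minimizers T e t x" for t x using that T(3) unfolding minimizers_def by blast
      show "\<exists>x. minimizers T e t x" if "\<exists>x. S t x" for t
        using T(4)[OF that] ex_minimizers[of T t, OF T(2)] by blast
      show "\<forall>e\<in>insert e E. x \<bullet> e = x' \<bullet> e" if "minimizers T e t x" "minimizers T e t x'" for t x x'
        using that T(5)[of t x x'] unfolding minimizers_def by (auto intro: order_antisym)
    qed
  qed
  from this[OF finite_Basis] obtain T where T: "sa_pred (\<lambda>p. T (fst p) (snd p))" "\<And>t x. T t x \<Longrightarrow> S t x"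
    "\<And>t. (\<exists>x. S t x) \<Longrightarrow> (\<exists>x. T t x)" "\<And>t x x'. T t x \<Longrightarrow> T t x' \<Longrightarrow> (\<forall>e\<in>Basis. x \<bullet> e = x' \<bullet> e)" by blast
  have uniq: "x = x'" if "T t x" "T t x'" for t x x'
    by (rule euclidean_eqI) (rule bspec[OF T(4)[OF that]])
  \<comment> \<open>The default 0 on empty fibres keeps the graph semi-algebraic, since emptiness of
    a fibre is itself a semi-algebraic condition, and keeps the curve bounded.\<close>
  define y where "y t = (if \<exists>x. S t x then (SOME x. T t x) else 0)" for t
  have yT: "T t (y t)" if "\<exists>x. S t x" for t
    using someI_ex[OF T(3)[OF that]] that by (simp add: y_def)
  have S': "sa_pred (\<lambda>a. S (f a) (g a))" if "sa_fun f" "sa_fun g" for f g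
    using sa_comp[OF S(1) sa_fun_Pair[OF that]] by simp
  have "sa_pred (\<lambda>p. T (fst p) (snd p) \<or> \<not> (\<exists>x. S (fst p) x) \<and> snd p = 0)"
    by (intro sa_disj sa_conj sa_not sa_exI T(1) S' sa_eq sa_fun_const sa_fun_fst sa_fun_snd sa_fun_id)
  moreover have "T t x \<or> \<not> (\<exists>x. S t x) \<and> x = 0 \<longleftrightarrow> x = y t" for t x
  proof (cases "\<exists>x. S t x")
    case True then show ?thesis using yT[OF True] uniq[of t x "y t"] by blast
  next
    case False then show ?thesis using T(2) by (auto simp: y_def)
  qed
  ultimately have "sa_fun y" unfolding sa_fun_def by simp
  then show ?thesis using yT T(2) by (intro exI[of _ y]) (auto simp: y_def)
qed

text \<open>The partial sum reappears on the right with factor one half and is absorbed on the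
  left.\<close>

lemma summable_half_step:
  fixes d c :: "nat \<Rightarrow> real"
  assumes d: "\<And>l. 0 \<le> d l" and c: "summable c" "\<And>l. 0 \<le> c l" and step: "\<And>l. d (Suc l) \<le> d l / 2 + c l"
  shows "summable d"
proof (rule summableI_nonneg_bounded)
  show "0 \<le> d l" for l by (rule d)
  show "(\<Sum>l<n. d l) \<le> 2 * (d 0 + suminf c)" for n
  proof -
    have "(\<Sum>l<n. d l) \<le> (\<Sum>l<Suc n. d l)" using d by simp
    also have "\<dots> = d 0 + (\<Sum>l<n. d (Suc l))" by (rule sum.lessThan_Suc_shift)
    also have "(\<Sum>l<n. d (Suc l)) \<le> (\<Sum>l<n. d l / 2 + c l)" by (intro sum_mono step)
    also have "\<dots> = (\<Sum>l<n. d l) / 2 + (\<Sum>l<n. c l)" by (simp add: sum.distrib sum_divide_distrib)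
    also have "(\<Sum>l<n. c l) \<le> suminf c" using c by (intro sum_le_suminf) auto
    finally show ?thesis by simp
  qed
qed

text \<open>Completing the square: \<open>K\<close> dominates both ratios, and \<open>K >= 1\<close>
  lets \<open>K * e^2\<close> be enlarged to \<open>K * K * e^2\<close>, so that
  \<open>K * d * e\<close> is the cross term of the square of \<open>d / 2 + K * e\<close>.\<close>

lemma quadratic_half_step:
  fixes a b M d d' e :: real
  assumes a: "a > 0" and nn: "0 \<le> b" "0 \<le> M" "0 \<le> d" "0 \<le> e" and le: "a * d'\<^sup>2 \<le> b * d * e + M * e\<^sup>2"
  shows "d' \<le> d / 2 + (b / a + M / a + 1) * e"
proof (rule power2_le_imp_le)
  define K where "K = b / a + M / a + 1"
  have K: "b / a \<le> K" "M / a \<le> K" "1 \<le> K" using a nn by (auto simp: K_def)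
  have "d'\<^sup>2 \<le> (b * d * e + M * e\<^sup>2) / a" using le a by (simp add: field_simps)
  also have "\<dots> = (b / a) * (d * e) + (M / a) * e\<^sup>2" by (simp add: add_divide_distrib)
  also have "(b / a) * (d * e) \<le> K * (d * e)" using K nn by (intro mult_right_mono) auto
  also have "(M / a) * e\<^sup>2 \<le> K * e\<^sup>2" using K by (intro mult_right_mono) auto
  also have "K * e\<^sup>2 \<le> K * K * e\<^sup>2" using K by (intro mult_right_mono) auto
  also have "K * (d * e) + K * K * e\<^sup>2 \<le> (d / 2 + K * e)\<^sup>2"
    by (simp add: power2_eq_square algebra_simps)
  finally show "d'\<^sup>2 \<le> (d / 2 + K * e)\<^sup>2" by simp
  show "0 \<le> d / 2 + K * e" using K nn by simp
qed

text \<open>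
  The decrease of \<open>f\<close> between two iterates is compared with its decrease along a semi-algebraic
  curve that runs through the points of least slope of the same levels; this curve has finite length.
\<close>

lemma sa_descent_finite_length:
  fixes f :: "'a::euclidean_space \<Rightarrow> real" and z :: "nat \<Rightarrow> 'a"
  assumes Z: "compact Z" "sa_pred (\<lambda>x. x \<in> Z)" and f: "sa_fun f" "continuous_on UNIV f"
    and z: "\<And>l. z l \<in> Z" and nn: "0 < a" "0 \<le> b" "0 \<le> M"
    and decrease: "\<And>l. a * (norm (z (Suc l) - z l))\<^sup>2 \<le> f (z l) - f (z (Suc l))"
    and slope: "\<And>l y. y \<in> Z \<Longrightarrow> f (z (Suc l)) - b * norm (z (Suc l) - z l) * norm (y - z (Suc l))
                  - M * (norm (y - z (Suc l)))\<^sup>2 \<le> f y"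
  shows "summable (\<lambda>l. norm (z (Suc l) - z l))"
proof -
  have "decseq (\<lambda>l. f (z l))"
  proof (rule decseq_SucI)
    fix l show "f (z (Suc l)) \<le> f (z l)"
      using decrease[of l] nn(1) by (smt (verit) mult_nonneg_nonneg zero_le_power2)
  qed
  have fZ: "compact (f ` Z)" using continuous_on_subset[OF f(2)] Z(1) by (intro compact_continuous_image) auto
  then obtain Bf where "\<And>x. x \<in> Z \<Longrightarrow> \<bar>f x\<bar> \<le> Bf" using compact_imp_bounded bounded_iff[of "f ` Z"] by force
  then have "- Bf \<le> f (z l)" for l using z by (metis abs_le_D2 minus_le_iff)
  then obtain fs where fs: "(\<lambda>l. f (z l)) \<longlonglongrightarrow> fs" "\<And>l. fs \<le> f (z l)"
    using decseq_convergent[OF \<open>decseq (\<lambda>l. f (z l))\<close>] by blast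
  define t where "t l = f (z l) - fs" for l
  have t0: "t \<longlonglongrightarrow> 0" using tendsto_diff[OF fs(1) tendsto_const[of fs]] by (simp add: t_def[abs_def])
  have t_dec: "t (Suc l) \<le> t l" for l using decseq_SucD[OF \<open>decseq (\<lambda>l. f (z l))\<close>] by (simp add: t_def)
  define d where "d l = norm (z (Suc l) - z l)" for l
  have ad: "a * (d l)\<^sup>2 \<le> t l - t (Suc l)" for l using decrease by (simp add: d_def t_def)
  show ?thesis
  proof (cases "\<forall>l. t l > 0")
    case False
    \<comment> \<open>The limit value is reached after finitely many steps; from then on the
      decrease estimate forces zero steps.\<close>
    then obtain n where "t n \<le> 0" by (auto simp: not_less)
    have "t l \<le> 0" if "l \<ge> n" for l
      using decseqD[OF \<open>decseq (\<lambda>l. f (z l))\<close> that] \<open>t n \<le> 0\<close> by (simp add: t_def)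
    then have tz: "t l = 0" if "l \<ge> n" for l using that fs(2)[of l] unfolding t_def by (simp add: order_antisym)
    have "d l = 0" if "l \<ge> n" for l
    proof -
      have "a * (d l)\<^sup>2 \<le> 0" using ad[of l] tz[of l] tz[of "Suc l"] that by simp
      then have "(d l)\<^sup>2 \<le> 0" using nn(1) by (simp add: mult_le_0_iff)
      then show ?thesis by simp
    qed
    then have "eventually (\<lambda>l. d l = 0) sequentially" unfolding eventually_sequentially by blast
    then have "summable d \<longleftrightarrow> summable (\<lambda>_. 0 :: real)" by (rule summable_cong)
    then have "summable d" by simp
    then show ?thesis by (simp add: d_def[abs_def])
  next
    case True
    obtain r where r: "\<And>x. x \<in> Z \<Longrightarrow> norm x \<le> r" using compact_imp_bounded[OF Z(1)] bounded_iff by metis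
    \<comment> \<open>Steps have length at most \<open>2 * r\<close>, so \<open>K\<close> admits
      every slope \<open>b * d l\<close> that occurs.\<close>
    define K where "K = b * (2 * r)"
    \<comment> \<open>A pair of a point on level \<open>t\<close> and a candidate slope for it; the
      bound \<open>K\<close> on the slope makes the fibre compact.\<close>
    define S where "S t p \<longleftrightarrow> fst p \<in> Z \<and> f (fst p) = fs + t \<and> 0 \<le> snd p \<and> snd p \<le> K \<and>
        (\<forall>y. y \<in> Z \<longrightarrow> f (fst p) - snd p * norm (y - fst p) - M * (norm (y - fst p) * norm (y - fst p)) \<le> f y)"
      for t and p :: "'a \<times> real"
    have Zc: "sa_pred (\<lambda>a. g a \<in> Z)" if "sa_fun g" for g using sa_comp[OF Z(2) that] .
    have saS: "sa_pred (\<lambda>p. S (fst p) (snd p))" unfolding S_def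
      by (intro sa_conj sa_allI sa_imp sa_le sa_eq Zc sa_fun_comp[OF f(1)] sa_fun_add sa_fun_diff sa_fun_mult
          sa_fun_norm sa_fun_const sa_fun_fst sa_fun_snd sa_fun_id)
    have cS: "compact {p. S t p}" for t
    proof -
      have cf: "continuous_on UNIV (\<lambda>p::'a \<times> real. f (fst p))"
        by (rule continuous_on_compose2[OF f(2)]) (auto intro: continuous_intros)
      have "{p. S t p} = (Z \<times> {0..K}) \<inter> ({p. f (fst p) = fs + t} \<inter> (\<Inter>y\<in>Z. {p.
        f (fst p) - snd p * norm (y - fst p) - M * (norm (y - fst p) * norm (y - fst p)) \<le> f y}))"
        by (auto simp: S_def)
      moreover have "closed {p :: 'a \<times> real. f (fst p) = fs + t}"
        by (intro closed_Collect_eq cf continuous_intros)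
      moreover have "closed {p. f (fst p) - snd p * norm (y - fst p) - M * (norm (y - fst p) * norm (y - fst p)) \<le> f y}" for y
        by (intro closed_Collect_le continuous_intros cf)
      ultimately show ?thesis
        using compact_Times[OF Z(1) compact_Icc[of 0 K]] by (auto intro!: compact_Int_closed closed_Int closed_INT)
    qed
    \<comment> \<open>Minimising along \<open>e\<close> minimises the slope coordinate;
      \<open>sa_selection\<close> then picks one among the points of least slope.\<close>
    define e where "e = (0 :: 'a, 1 :: real)"
    obtain y where y: "sa_fun y" "\<And>t. (\<exists>x. minimizers S e t x) \<Longrightarrow> minimizers S e t (y t)"
      "\<And>t. (\<nexists>x. minimizers S e t x) \<Longrightarrow> y t = 0"
      using sa_selection[of "minimizers S e"] sa_minimizers[OF saS] compact_minimizers[of S, OF cS] by blast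
    have yb: "norm (y t) \<le> \<bar>r\<bar> + \<bar>K\<bar>" for t
    proof (cases "\<exists>x. minimizers S e t x")
      case True
      then have "S t (y t)" using y(2) unfolding minimizers_def by blast
      then have "norm (fst (y t)) \<le> r" "\<bar>snd (y t)\<bar> \<le> \<bar>K\<bar>" using r by (auto simp: S_def)
      then show ?thesis using norm_Pair_le[of "fst (y t)" "snd (y t)"] by simp
    qed (simp add: y(3))
    have "summable (\<lambda>l. norm (y (t l) - y (t (Suc l))))"
      by (rule sa_fun_finite_variation[OF y(1) yb _ t0 t_dec]) (use True in blast)
    \<comment> \<open>The slope estimate starts at \<open>z (Suc l)\<close>, so only from index 1 on
      is the fibre known to be nonempty.\<close>
    then have sum: "summable (\<lambda>l. norm (y (t (Suc l)) - y (t (Suc (Suc l)))))"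
      by (subst (asm) summable_Suc_iff[symmetric])
    have "S (t (Suc l)) (z (Suc l), b * d l)" for l
    proof -
      have "d l \<le> 2 * r" using norm_triangle_ineq4[of "z (Suc l)" "z l"] r[OF z[of l]] r[OF z[of "Suc l"]]
        by (simp add: d_def)
      then have "b * d l \<le> K" unfolding K_def using nn(2) by (intro mult_left_mono)
      then show ?thesis
        using z slope nn(2) by (simp add: S_def t_def d_def power2_eq_square)
    qed
    note Sz = this
    have ymin: "minimizers S e (t (Suc l)) (y (t (Suc l)))" for l
      by (rule y(2), rule ex_minimizers[of S "t (Suc l)", OF cS Sz])
    have "d (Suc l) \<le> d l / 2 + (b / a + M / a + 1) * norm (y (t (Suc l)) - y (t (Suc (Suc l))))" for l
    proof (rule quadratic_half_step[OF nn])
      define x s x' where "x = fst (y (t (Suc l)))" and "s = snd (y (t (Suc l)))"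
        and "x' = fst (y (t (Suc (Suc l))))"
      \<comment> \<open>The iterate \<open>z (Suc l)\<close> with slope \<open>b * d l\<close>
        competes on the same level, so the least slope is no larger.\<close>
      have "snd (y (t (Suc l))) \<le> b * d l"
        using ymin[of l] Sz[of l] unfolding minimizers_def e_def by (auto simp: inner_prod_def)
      then have s: "s \<le> b * d l" by (simp add: s_def)
      have Sx: "S (t (Suc l)) (y (t (Suc l)))" "S (t (Suc (Suc l))) (y (t (Suc (Suc l))))"
        using ymin unfolding minimizers_def by blast+
      then have x: "f x = fs + t (Suc l)" "x' \<in> Z" "f x' = fs + t (Suc (Suc l))" "0 \<le> s"
        "f x - s * norm (x' - x) - M * (norm (x' - x) * norm (x' - x)) \<le> f x'"
        unfolding S_def x_def x'_def s_def by auto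
      let ?e = "norm (y (t (Suc l)) - y (t (Suc (Suc l))))"
      have n: "norm (x' - x) \<le> ?e"
        using norm_fst_le[of "fst (y (t (Suc l)) - y (t (Suc (Suc l))))" "snd (y (t (Suc l)) - y (t (Suc (Suc l))))",
            unfolded prod.collapse]
        by (simp add: x_def x'_def norm_minus_commute)
      \<comment> \<open>The lower model at \<open>x\<close> is evaluated at the curve point
        \<open>x'\<close> of the next level: this bounds the drop between the two levels by slope
        times displacement plus the quadratic term.\<close>
      have "a * (d (Suc l))\<^sup>2 \<le> s * norm (x' - x) + M * (norm (x' - x) * norm (x' - x))"
        using ad[of "Suc l"] x by simp
      also have "\<dots> \<le> b * d l * ?e + M * (?e * ?e)"
        using s n x(4) nn by (intro add_mono mult_mono mult_left_mono) (auto simp: d_def)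
      finally show "a * (d (Suc l))\<^sup>2 \<le> b * d l * ?e + M * ?e\<^sup>2" by (simp add: power2_eq_square)
    qed (auto simp: d_def)
    note step = this
    have "summable d"
    proof (rule summable_half_step)
      show "d (Suc l) \<le> d l / 2 + (b / a + M / a + 1) * norm (y (t (Suc l)) - y (t (Suc (Suc l))))" for l
        by (rule step)
      show "summable (\<lambda>l. (b / a + M / a + 1) * norm (y (t (Suc l)) - y (t (Suc (Suc l)))))"
        by (rule summable_mult[OF sum])
      show "0 \<le> (b / a + M / a + 1) * norm (y (t (Suc l)) - y (t (Suc (Suc l))))" for l
        using nn by (intro mult_nonneg_nonneg) auto
    qed (simp add: d_def)
    then show ?thesis by (simp add: d_def[abs_def])
  qed
qed

lemma summable_increments_convergent:
  fixes z :: "nat \<Rightarrow> 'a::banach"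
  assumes "summable (\<lambda>l. norm (z (Suc l) - z l))" shows "convergent z"
proof -
  have "summable (\<lambda>l. z (Suc l) - z l)" by (rule summable_norm_cancel[OF assms])
  then have "(\<lambda>n. \<Sum>l<n. z (Suc l) - z l) \<longlonglongrightarrow> (\<Sum>l. z (Suc l) - z l)" by (rule summable_LIMSEQ)
  then have "(\<lambda>n. z n - z 0) \<longlonglongrightarrow> (\<Sum>l. z (Suc l) - z l)" by (simp add: sum_lessThan_telescope)
  from tendsto_add[OF this tendsto_const[of "z 0"]] show ?thesis by (auto simp: convergent_def)
qed

section \<open>Twice continuously differentiable functions and blocks\<close>

lemma inner_gradient:
  assumes "f differentiable (at x)" shows "(f has_derivative (\<lambda>h. gradient f x \<bullet> h)) (at x)"
proof -
  have d: "(f has_derivative frechet_derivative f (at x)) (at x)"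
    using assms frechet_derivative_works by blast
  then have l: "linear (frechet_derivative f (at x))" by (rule has_derivative_linear)
  have "frechet_derivative f (at x) h = gradient f x \<bullet> h" for h
  proof -
    have "frechet_derivative f (at x) h = frechet_derivative f (at x) (\<Sum>k\<in>UNIV. h $ k *\<^sub>R axis k 1)"
      by (simp add: basis_expansion[of h, unfolded scalar_mult_eq_scaleR])
    also have "\<dots> = (\<Sum>k\<in>UNIV. h $ k * frechet_derivative f (at x) (axis k 1))"
      by (simp add: linear_sum[OF l] linear_scale[OF l])
    finally show ?thesis by (simp add: gradient_def inner_vec_def mult.commute)
  qed
  then have "frechet_derivative f (at x) = (\<lambda>h. gradient f x \<bullet> h)" by blast
  then show ?thesis using d by simp
qed

lemma gradient_eq:
  assumes "(f has_derivative (\<lambda>h. g \<bullet> h)) (at x)" shows "gradient f x = g"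
proof -
  have "frechet_derivative f (at x) = (\<lambda>h. g \<bullet> h)" using frechet_derivative_at[OF assms] by simp
  then show ?thesis by (simp add: gradient_def inner_axis vec_eq_iff)
qed

lemma C2D:
  assumes "C2 f"
  shows "(f has_derivative (\<lambda>h. gradient f x \<bullet> h)) (at x)"
    "(gradient f has_derivative (\<lambda>h. hessian f x *v h)) (at x)"
    "continuous_on UNIV (hessian f)"
  using assms inner_gradient unfolding C2_def hessian_def by (auto simp: jacobian_works)

text \<open>Both \<open>gradient\<close> and \<open>hessian\<close> are read off the Frechet
  derivative, so uniqueness of derivatives identifies them with the candidates \<open>g\<close> and
  \<open>A\<close>.\<close>

lemma C2I:
  assumes f: "\<And>x. (f has_derivative (\<lambda>h. g x \<bullet> h)) (at x)"
    and g: "\<And>x. (g has_derivative (\<lambda>h. A x *v h)) (at x)"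
    and A: "continuous_on UNIV A"
  shows "C2 f"
proof -
  have eq: "gradient f = g" using gradient_eq[OF f] by blast
  have "hessian f x = A x" for x
    using frechet_derivative_at[OF g, of x, symmetric]
    by (simp add: hessian_def jacobian_def eq matrix_of_matrix_vector_mul)
  then have "hessian f = A" by blast
  then show ?thesis using f g A unfolding C2_def eq differentiable_def by auto
qed

lemma C2_const: "C2 (\<lambda>x. c)"
  by (rule C2I[where g = "\<lambda>_. 0" and A = "\<lambda>_. 0"]) auto

lemma C2_add:
  assumes "C2 f" "C2 g" shows "C2 (\<lambda>x. f x + g x)"
proof (rule C2I)
  show "((\<lambda>x. f x + g x) has_derivative (\<lambda>h. (gradient f x + gradient g x) \<bullet> h)) (at x)" for x
    unfolding inner_add_left by (intro has_derivative_add C2D assms)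
  show "((\<lambda>x. gradient f x + gradient g x) has_derivative (\<lambda>h. (hessian f x + hessian g x) *v h)) (at x)" for x
    unfolding matrix_vector_mult_add_rdistrib by (intro has_derivative_add C2D assms)
  show "continuous_on UNIV (\<lambda>x. hessian f x + hessian g x)"
    by (intro continuous_on_add C2D assms)
qed

lemma C2_continuous:
  assumes "C2 f" shows "continuous_on UNIV f" "continuous_on UNIV (gradient f)"
  by (intro continuous_at_imp_continuous_on ballI has_derivative_continuous[OF C2D(1)[OF assms]]
      has_derivative_continuous[OF C2D(2)[OF assms]])+

lemma continuous_on_vec_nth: "continuous_on S h \<Longrightarrow> continuous_on S (\<lambda>x. h x $ i)"
  by (intro continuous_intros)

lemma C2_mult:
  assumes "C2 f" "C2 g" shows "C2 (\<lambda>x. f x * g x)"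
proof (rule C2I)
  show "((\<lambda>x. f x * g x) has_derivative (\<lambda>h. (f x *\<^sub>R gradient g x + g x *\<^sub>R gradient f x) \<bullet> h)) (at x)" for x
    by (rule has_derivative_eq_rhs[OF has_derivative_mult[OF C2D(1)[OF assms(1)] C2D(1)[OF assms(2)]]])
       (simp add: inner_add_left algebra_simps)
  \<comment> \<open>The Hessian of a product: two scaled Hessians and two rank-one terms made of the
    gradients.\<close>
  define A where "A x = (\<chi> i j. f x * hessian g x $ i $ j + g x * hessian f x $ i $ j
      + gradient g x $ i * gradient f x $ j + gradient f x $ i * gradient g x $ j)" for x
  have A: "A x *v h = f x *\<^sub>R (hessian g x *v h) + (gradient f x \<bullet> h) *\<^sub>R gradient g x
     + (g x *\<^sub>R (hessian f x *v h) + (gradient g x \<bullet> h) *\<^sub>R gradient f x)" for x h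
  proof (rule vec_eq_iff[THEN iffD2], rule allI)
    fix i
    have "(A x *v h) $ i = (\<Sum>j\<in>UNIV. f x * (hessian g x $ i $ j * h $ j) + gradient g x $ i * (gradient f x $ j * h $ j)
      + (g x * (hessian f x $ i $ j * h $ j) + gradient f x $ i * (gradient g x $ j * h $ j)))"
      unfolding A_def matrix_vector_mult_def vec_lambda_beta by (intro sum.cong refl) algebra
    also have "\<dots> = f x * (hessian g x *v h) $ i + gradient g x $ i * (gradient f x \<bullet> h)
      + (g x * (hessian f x *v h) $ i + gradient f x $ i * (gradient g x \<bullet> h))"
      unfolding sum.distrib sum_distrib_left[symmetric] by (simp add: matrix_vector_mult_def inner_vec_def)
    finally show "(A x *v h) $ i = (f x *\<^sub>R (hessian g x *v h) + (gradient f x \<bullet> h) *\<^sub>R gradient g x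
      + (g x *\<^sub>R (hessian f x *v h) + (gradient g x \<bullet> h) *\<^sub>R gradient f x)) $ i" by simp
  qed
  show "((\<lambda>x. f x *\<^sub>R gradient g x + g x *\<^sub>R gradient f x) has_derivative (\<lambda>h. A x *v h)) (at x)" for x
    unfolding A by (intro has_derivative_add has_derivative_scaleR C2D assms)
  show "continuous_on UNIV A" unfolding A_def
    by (intro continuous_on_vec_lambda continuous_on_add continuous_on_mult continuous_on_vec_nth C2_continuous C2D(3) assms)
qed

lemma C2_sum:
  assumes "finite I" "\<And>i. i \<in> I \<Longrightarrow> C2 (f i)" shows "C2 (\<lambda>x. \<Sum>i\<in>I. f i x)"
  using assms by (induction I rule: finite_induct) (simp_all add: C2_const C2_add)

lemma C2_penalty:
  assumes "\<And>k. C2 (\<lambda>x. h x $ k)" shows "C2 (\<lambda>x. penalty h \<rho> \<nu> x)"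
  unfolding penalty_def power2_norm_eq_inner inner_vec_def inner_real_def
  by (intro C2_add C2_mult C2_const C2_sum finite assms)

text \<open>Maclaurin's formula with Lagrange remainder for the restriction of \<open>f\<close> to
  the line through \<open>x\<close> in direction \<open>d\<close>.\<close>

lemma C2_taylor:
  assumes "C2 f"
  shows "\<exists>t. 0 < t \<and> t < 1 \<and>
    f (x + d) = f x + gradient f x \<bullet> d + (d \<bullet> (hessian f (x + t *\<^sub>R d) *v d)) / 2"
proof -
  define D where "D m t = (if m = 0 then f (x + t *\<^sub>R d) else if m = 1 then gradient f (x + t *\<^sub>R d) \<bullet> d
    else d \<bullet> (hessian f (x + t *\<^sub>R d) *v d))" for m :: nat and t :: real
  have line: "((\<lambda>t. x + t *\<^sub>R d) has_derivative (\<lambda>h. h *\<^sub>R d)) (at t)" for t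
    by (auto intro!: derivative_eq_intros)
  have "DERIV (D m) t :> D (Suc m) t" if "m < 2" for m t
  proof (cases "m = 0")
    case True
    have "((\<lambda>t. f (x + t *\<^sub>R d)) has_derivative (\<lambda>h. gradient f (x + t *\<^sub>R d) \<bullet> (h *\<^sub>R d))) (at t)"
      by (rule has_derivative_compose[OF line C2D(1)[OF assms]])
    then show ?thesis using True
      by (simp add: D_def[abs_def] has_field_derivative_def mult_commute_abs)
  next
    case False
    then have m: "m = 1" using that by simp
    have "((\<lambda>t. gradient f (x + t *\<^sub>R d)) has_derivative (\<lambda>h. hessian f (x + t *\<^sub>R d) *v (h *\<^sub>R d))) (at t)"
      by (rule has_derivative_compose[OF line C2D(2)[OF assms]])
    from has_derivative_inner_left[OF this, of d] show ?thesis using m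
      by (simp add: D_def[abs_def] has_field_derivative_def mult_commute_abs matrix_vector_mult_scaleR inner_commute)
  qed
  moreover have "D 0 = (\<lambda>t. f (x + t *\<^sub>R d))" by (simp add: D_def fun_eq_iff)
  ultimately obtain t where t: "0 < t" "t < 1" "f (x + 1 *\<^sub>R d) = (\<Sum>m<2. D m 0 / fact m * 1 ^ m) + D 2 t / fact 2 * 1 ^ 2"
    using Maclaurin[of 1 2 D "\<lambda>t. f (x + t *\<^sub>R d)"] by auto
  then show ?thesis by (intro exI[of _ t]) (simp add: D_def numeral_2_eq_2)
qed

section \<open>Coordinate blocks and second-order estimates\<close>

lemma block_eq_self: "x \<in> block_space b i \<Longrightarrow> block b i x = x"
  by (auto simp: block_def block_space_def vec_eq_iff)

lemma block_in_block_space: "block b i x \<in> block_space b i"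
  by (simp add: block_def block_space_def)

lemma linear_block: "linear (block b i)"
  by (rule linearI) (simp_all add: block_def vec_eq_iff)

lemma bounded_linear_block: "bounded_linear (block b i)"
  using linear_block by (simp add: linear_conv_bounded_linear)

lemma norm_block_le: "norm (block b i x) \<le> norm x"
  by (rule norm_le_componentwise_cart) (simp add: block_def)

lemma inner_block: "x \<bullet> block b i y = block b i x \<bullet> y"
  unfolding inner_vec_def block_def by (intro sum.cong) auto

lemma sum_blocks:
  fixes b :: "'n::finite \<Rightarrow> nat"
  assumes "range b = {1..N}" shows "(\<Sum>i=1..N. block b i x) = x"
proof -
  have "(\<Sum>i=1..N. block b i x $ k) = x $ k" for k
  proof -
    have "b k \<in> {1..N}" using assms by blast
    have "(\<Sum>i=1..N. block b i x $ k) = (\<Sum>i=1..N. if b k = i then x $ k else 0)" by (simp add: block_def)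
    also have "\<dots> = x $ k" using \<open>b k \<in> {1..N}\<close> by (subst sum.delta') auto
    finally show ?thesis .
  qed
  then show ?thesis by (simp add: vec_eq_iff)
qed

lemma inner_block_mat:
  assumes "d \<in> block_space b i" shows "d \<bullet> (block_mat b i A *v d) = d \<bullet> (A *v d)"
proof -
  have "d $ k * (block_mat b i A $ k $ l * d $ l) = d $ k * (A $ k $ l * d $ l)" for k l
    using assms by (auto simp: block_mat_def block_space_def)
  then show ?thesis
    by (simp only: inner_vec_def inner_real_def matrix_vector_mult_def vec_lambda_beta sum_distrib_left)
qed

text \<open>Both operator norms are dominated by the sum of the absolute entries of the Hessian, a
  continuous function and hence bounded on a compact set.\<close>

lemma onorm_hessian_bdd:
  assumes "C2 f" "compact \<Omega>" shows "\<exists>K. \<forall>x\<in>\<Omega>. onorm (\<lambda>v. hessian f x *v v) \<le> K"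
    "bdd_above ((\<lambda>x. onorm (\<lambda>v. block_mat b i (hessian f x) *v v)) ` \<Omega>)"
proof -
  have "continuous_on UNIV (\<lambda>x. \<Sum>k\<in>UNIV. \<Sum>l\<in>UNIV. \<bar>hessian f x $ k $ l\<bar>)"
    by (intro continuous_on_sum continuous_on_rabs continuous_on_vec_nth C2D(3) assms(1))
  then have "compact ((\<lambda>x. \<Sum>k\<in>UNIV. \<Sum>l\<in>UNIV. \<bar>hessian f x $ k $ l\<bar>) ` \<Omega>)"
    using assms(2) continuous_on_subset by (intro compact_continuous_image) auto
  then obtain K where K: "\<And>x. x \<in> \<Omega> \<Longrightarrow> \<bar>\<Sum>k\<in>UNIV. \<Sum>l\<in>UNIV. \<bar>hessian f x $ k $ l\<bar>\<bar> \<le> K"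
    using compact_imp_bounded bounded_iff[of "(\<lambda>x. \<Sum>k\<in>UNIV. \<Sum>l\<in>UNIV. \<bar>hessian f x $ k $ l\<bar>) ` \<Omega>"] by force
  then have K: "(\<Sum>k\<in>UNIV. \<Sum>l\<in>UNIV. \<bar>hessian f x $ k $ l\<bar>) \<le> K" if "x \<in> \<Omega>" for x using that by force
  then show "\<exists>K. \<forall>x\<in>\<Omega>. onorm (\<lambda>v. hessian f x *v v) \<le> K"
    using onorm_le_matrix_component_sum order_trans by blast
  have "onorm (\<lambda>v. block_mat b i (hessian f x) *v v) \<le> K" if "x \<in> \<Omega>" for x
  proof -
    have "onorm (\<lambda>v. block_mat b i (hessian f x) *v v) \<le> (\<Sum>k\<in>UNIV. \<Sum>l\<in>UNIV. \<bar>block_mat b i (hessian f x) $ k $ l\<bar>)"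
      by (rule onorm_le_matrix_component_sum)
    also have "\<dots> \<le> (\<Sum>k\<in>UNIV. \<Sum>l\<in>UNIV. \<bar>hessian f x $ k $ l\<bar>)"
      by (intro sum_mono) (simp add: block_mat_def)
    also have "\<dots> \<le> K" by (rule K[OF that])
    finally show ?thesis .
  qed
  then show "bdd_above ((\<lambda>x. onorm (\<lambda>v. block_mat b i (hessian f x) *v v)) ` \<Omega>)" by (auto intro!: bdd_aboveI)
qed

lemma inner_matrix_le_onorm:
  fixes A :: "real^'n^'n"
  shows "\<bar>d \<bullet> (A *v d)\<bar> \<le> onorm (\<lambda>v. A *v v) * (norm d)\<^sup>2"
proof -
  have "\<bar>d \<bullet> (A *v d)\<bar> \<le> norm d * norm (A *v d)" by (rule Cauchy_Schwarz_ineq2)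
  also have "\<dots> \<le> norm d * (onorm (\<lambda>v. A *v v) * norm d)" by (intro mult_left_mono onorm) simp_all
  finally show ?thesis by (simp add: power2_eq_square mult_left_mono mult_ac)
qed

text \<open>Along a direction in one block the Taylor remainder sees only the diagonal block of the
  Hessian, and convexity keeps the intermediate point in \<Omega>.\<close>

lemma block_descent:
  assumes f: "C2 f" and \<Omega>: "compact \<Omega>" "convex \<Omega>" and x: "x \<in> \<Omega>" "x + d \<in> \<Omega>" and d: "d \<in> block_space b i"
  shows "f (x + d) \<le> f x + gradient f x \<bullet> d + hess_bound b i f \<Omega> / 2 * (norm d)\<^sup>2"
proof -
  obtain t where t: "0 < t" "t < 1"
    "f (x + d) = f x + gradient f x \<bullet> d + (d \<bullet> (hessian f (x + t *\<^sub>R d) *v d)) / 2"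
    using C2_taylor[OF f] by blast
  have "x + t *\<^sub>R d = (1 - t) *\<^sub>R x + t *\<^sub>R (x + d)" by (simp add: algebra_simps)
  then have xt: "x + t *\<^sub>R d \<in> \<Omega>" using convexD[OF \<Omega>(2) x, of "1 - t" t] t by simp
  have "d \<bullet> (hessian f (x + t *\<^sub>R d) *v d) = d \<bullet> (block_mat b i (hessian f (x + t *\<^sub>R d)) *v d)"
    by (rule inner_block_mat[OF d, symmetric])
  also have "\<dots> \<le> onorm (\<lambda>v. block_mat b i (hessian f (x + t *\<^sub>R d)) *v v) * (norm d)\<^sup>2"
    using inner_matrix_le_onorm[of d "block_mat b i (hessian f (x + t *\<^sub>R d))"] by simp
  also have "\<dots> \<le> hess_bound b i f \<Omega> * (norm d)\<^sup>2"
    unfolding hess_bound_def by (intro mult_right_mono cSUP_upper xt onorm_hessian_bdd(2)[OF f \<Omega>(1)]) simp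
  finally show ?thesis using t(3) by simp
qed

text \<open>Chain rule and uniqueness of the derivative. It transfers estimates between a point and
  its zero-padded block, where the bounds on the separable terms are taken.\<close>

lemma gradient_through_block:
  assumes f: "C2 f" and inv: "\<And>z. f (block b i z) = f z"
  shows "gradient f x \<bullet> d = gradient f (block b i x) \<bullet> block b i d"
proof -
  have "((\<lambda>z. f (block b i z)) has_derivative (\<lambda>h. gradient f (block b i x) \<bullet> block b i h)) (at x)"
    by (rule has_derivative_compose[OF bounded_linear_imp_has_derivative[OF bounded_linear_block] C2D(1)[OF f]])
  then have "(f has_derivative (\<lambda>h. gradient f (block b i x) \<bullet> block b i h)) (at x)" by (simp add: inv)
  from has_derivative_unique[OF this C2D(1)[OF f]] show ?thesis by metis
qed

lemma C2_lipschitz_gradient: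
  assumes f: "C2 f" and Z: "compact Z" "convex Z"
  shows "\<exists>K\<ge>0. (\<forall>x\<in>Z. \<forall>y\<in>Z. norm (gradient f x - gradient f y) \<le> K * norm (x - y)) \<and>
    (\<forall>x\<in>Z. \<forall>y\<in>Z. f x + gradient f x \<bullet> (y - x) - K * (norm (y - x))\<^sup>2 \<le> f y)"
proof -
  obtain K0 where K0: "\<forall>x\<in>Z. onorm (\<lambda>v. hessian f x *v v) \<le> K0" using onorm_hessian_bdd(1)[OF f Z(1)] by blast
  \<comment> \<open>For empty \<open>Z\<close> the constant \<open>K0\<close> may be
    negative.\<close>
  define K where "K = max 0 K0"
  have K: "K \<ge> 0" "\<And>x. x \<in> Z \<Longrightarrow> onorm (\<lambda>v. hessian f x *v v) \<le> K" using K0 by (auto simp: K_def)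
  have "norm (gradient f x - gradient f y) \<le> K * norm (x - y)" if "x \<in> Z" "y \<in> Z" for x y
  proof (rule differentiable_bound[where f' = "\<lambda>x v. hessian f x *v v", OF Z(2)])
    show "(gradient f has_derivative (\<lambda>v. hessian f w *v v)) (at w within Z)" for w
      by (rule has_derivative_at_withinI[OF C2D(2)[OF f]])
  qed (use K that in auto)
  moreover have "f x + gradient f x \<bullet> (y - x) - K * (norm (y - x))\<^sup>2 \<le> f y" if "x \<in> Z" "y \<in> Z" for x y
  proof -
    obtain t where t: "0 < t" "t < 1"
      "f (x + (y - x)) = f x + gradient f x \<bullet> (y - x) + ((y - x) \<bullet> (hessian f (x + t *\<^sub>R (y - x)) *v (y - x))) / 2"
      using C2_taylor[OF f] by blast
    have "x + t *\<^sub>R (y - x) = (1 - t) *\<^sub>R x + t *\<^sub>R y" by (simp add: algebra_simps)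
    then have xt: "x + t *\<^sub>R (y - x) \<in> Z" using convexD[OF Z(2) that, of "1 - t" t] t by simp
    have "- ((y - x) \<bullet> (hessian f (x + t *\<^sub>R (y - x)) *v (y - x))) \<le> K * (norm (y - x))\<^sup>2"
      using inner_matrix_le_onorm[of "y - x" "hessian f (x + t *\<^sub>R (y - x))"]
        mult_right_mono[OF K(2)[OF xt], of "(norm (y - x))\<^sup>2"] by simp
    moreover have "0 \<le> K * (norm (y - x))\<^sup>2" using K by simp
    ultimately show ?thesis using t(3) by simp
  qed
  ultimately show ?thesis using K(1) by blast
qed

text \<open>Polarisation and the parallelogram law turn bounds on the quadratic form into one on the
  bilinear form. It bounds the term with \<open>B i l\<close> in the slope estimate using only the
  quadratic form on one block.\<close>

lemma psd_inner_le:
  fixes A :: "real^'n^'n"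
  assumes sym: "transpose A = A" and W: "subspace W"
    and A: "\<And>v. v \<in> W \<Longrightarrow> 0 \<le> v \<bullet> (A *v v)" "\<And>v. v \<in> W \<Longrightarrow> v \<bullet> (A *v v) \<le> c * (norm v)\<^sup>2"
    and x: "x \<in> W" "y \<in> W"
  shows "(A *v x) \<bullet> y \<le> c * norm x * norm y"
proof (cases "x = 0 \<or> y = 0")
  case True then show ?thesis by auto
next
  case False
  \<comment> \<open>Scaling by \<open>t\<close> and \<open>1 / t\<close> gives both vectors the same
    norm, with square \<open>norm x * norm y\<close>, and leaves the bilinear form
    unchanged.\<close>
  define t where "t = sqrt (norm y / norm x)"
  have t: "t > 0" "t\<^sup>2 = norm y / norm x" using False by (simp_all add: t_def)
  define u v where "u = t *\<^sub>R x" and "v = (1 / t) *\<^sub>R y"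
  have uv: "u \<in> W" "v \<in> W" using W x by (auto simp: u_def v_def subspace_scale)
  have s: "a \<bullet> (A *v b) = b \<bullet> (A *v a)" for a b
    by (metis dot_lmul_matrix inner_commute sym vector_transpose_matrix)
  have "0 \<le> (u - v) \<bullet> (A *v (u - v))" using A(1) uv W by (simp add: subspace_diff)
  moreover have "(u + v) \<bullet> (A *v (u + v)) \<le> c * (norm (u + v))\<^sup>2" using A(2) uv W by (simp add: subspace_add)
  moreover have "(u + v) \<bullet> (A *v (u + v)) - (u - v) \<bullet> (A *v (u - v)) = 4 * (v \<bullet> (A *v u))"
    using s[of u v] by (simp add: algebra_simps inner_add_left inner_add_right inner_diff_left inner_diff_right
        matrix_vector_right_distrib matrix_vector_mult_diff_distrib)
  moreover have c: "c * (norm (u + v))\<^sup>2 \<le> c * (2 * (norm u)\<^sup>2 + 2 * (norm v)\<^sup>2)"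
  proof (rule mult_left_mono)
    have "(norm (u + v))\<^sup>2 + (norm (u - v))\<^sup>2 = 2 * (norm u)\<^sup>2 + 2 * (norm v)\<^sup>2"
      by (simp add: power2_norm_eq_inner inner_add_left inner_add_right inner_diff_left inner_diff_right inner_commute)
    then show "(norm (u + v))\<^sup>2 \<le> 2 * (norm u)\<^sup>2 + 2 * (norm v)\<^sup>2"
      using zero_le_power2[of "norm (u - v)"] by linarith
    have "0 \<le> c * (norm x)\<^sup>2" using A(1,2)[OF x(1)] by linarith
    then show "0 \<le> c" using False by (simp add: zero_le_mult_iff)
  qed
  ultimately have "4 * (v \<bullet> (A *v u)) \<le> c * (2 * (norm u)\<^sup>2 + 2 * (norm v)\<^sup>2)" by linarith
  moreover have "v \<bullet> (A *v u) = (A *v x) \<bullet> y"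
    using t(1) by (simp add: u_def v_def matrix_vector_mult_scaleR inner_commute)
  moreover have "(norm u)\<^sup>2 = norm x * norm y" "(norm v)\<^sup>2 = norm x * norm y"
  proof -
    have "(norm u)\<^sup>2 = t\<^sup>2 * (norm x)\<^sup>2" "(norm v)\<^sup>2 = (norm y)\<^sup>2 / t\<^sup>2"
      using t(1) by (simp_all add: u_def v_def power_mult_distrib power_divide)
    then show "(norm u)\<^sup>2 = norm x * norm y" "(norm v)\<^sup>2 = norm x * norm y"
      using False unfolding t(2) by (simp_all add: power2_eq_square)
  qed
  ultimately show ?thesis by (simp add: algebra_simps)
qed

section \<open>The block-coordinate scheme\<close>

lemma sa_semialgebraic:
  assumes "semialgebraic S" shows "sa_pred (\<lambda>x. x \<in> S)"
proof -
  obtain \<C> where C: "finite \<C>" "\<forall>(P, R)\<in>\<C>. finite P \<and> finite R \<and> (\<forall>p\<in>P \<union> R. real_polynomial_function p)"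
    "S = (\<Union>(P, R)\<in>\<C>. {x. (\<forall>p\<in>P. p x = 0) \<and> (\<forall>q\<in>R. q x < 0)})"
    using assms unfolding semialgebraic_def by blast
  have "sa_pred (\<lambda>x. (\<forall>p\<in>fst c. p x = 0) \<and> (\<forall>q\<in>snd c. q x < 0))" if c: "c \<in> \<C>" for c
  proof -
    have *: "finite (fst c)" "finite (snd c)" "\<And>p. p \<in> fst c \<union> snd c \<Longrightarrow> real_polynomial_function p"
      using C(2) c by (auto simp: case_prod_unfold)
    have "sa_pred (\<lambda>x. q x < 0)" if "q \<in> snd c" for q
      using sa_poly_pos[OF real_polynomial_function_minus[OF *(3)[of q]]] that by simp
    then show ?thesis using * by (intro sa_conj sa_ball_finite sa_poly_zero) auto
  qed
  then have "sa_pred (\<lambda>x. \<exists>c\<in>\<C>. (\<forall>p\<in>fst c. p x = 0) \<and> (\<forall>q\<in>snd c. q x < 0))"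
    by (rule sa_bex_finite[OF C(1)])
  moreover have "x \<in> S \<longleftrightarrow> (\<exists>c\<in>\<C>. (\<forall>p\<in>fst c. p x = 0) \<and> (\<forall>q\<in>snd c. q x < 0))" for x
    unfolding C(3) by (auto simp: case_prod_unfold)
  ultimately show ?thesis by simp
qed

text \<open>Only the graph over \<open>D\<close> is known to be semi-algebraic; as \<open>g\<close>
  maps into \<open>D\<close>, the graph of the composite is a preimage of it.\<close>

lemma sa_fun_semialgebraic_on:
  assumes f: "semialgebraic_on D f" and g: "sa_fun g" "\<And>x. g x \<in> D"
  shows "sa_fun (\<lambda>x. f (g x))"
proof -
  have "sa_pred (\<lambda>p. p \<in> (\<lambda>x. (x, f x)) ` D)" using f sa_semialgebraic unfolding semialgebraic_on_def by blast
  then have "sa_pred (\<lambda>q. (g (fst q), snd q) \<in> (\<lambda>x. (x, f x)) ` D)"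
    by (rule sa_comp) (intro sa_fun_Pair sa_fun_comp[OF g(1)] sa_fun_fst sa_fun_snd sa_fun_id)
  moreover have "(g (fst q), snd q) \<in> (\<lambda>x. (x, f x)) ` D \<longleftrightarrow> snd q = f (g (fst q))" for q
    using g(2) by auto
  ultimately show ?thesis by (simp add: sa_fun_def)
qed

lemma sa_polytope:
  assumes "polytope S" shows "sa_pred (\<lambda>x. x \<in> S)"
proof -
  obtain F where F: "finite F" "S = \<Inter>F" "\<And>h. h \<in> F \<Longrightarrow> \<exists>a b. a \<noteq> 0 \<and> h = {x. a \<bullet> x \<le> b}"
    using polytope_imp_polyhedron[OF assms] unfolding polyhedron_def by blast
  have "sa_pred (\<lambda>x. x \<in> h)" if h: "h \<in> F" for h
  proof -
    obtain a b where "h = {x. a \<bullet> x \<le> b}" using F(3)[OF h] by blast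
    then show ?thesis by (simp only: mem_Collect_eq) (intro sa_le sa_fun_inner sa_fun_const sa_fun_id)
  qed
  from sa_ball_finite[OF F(1) this] show ?thesis unfolding F(2) by simp
qed

lemma subspace_block_space: "subspace (block_space b i)"
  by (simp add: subspace_def block_space_def)

lemma norm_sum_blocks:
  fixes b :: "'n::finite \<Rightarrow> nat"
  assumes "range b = {1..N}" shows "(\<Sum>i=1..N. (norm (block b i x))\<^sup>2) = (norm x)\<^sup>2"
proof -
  have "(norm (block b i x))\<^sup>2 = x \<bullet> block b i x" for i
    using inner_block[of x b i "block b i x"] block_eq_self[OF block_in_block_space, of b i x]
    by (simp add: power2_norm_eq_inner)
  then have "(\<Sum>i=1..N. (norm (block b i x))\<^sup>2) = x \<bullet> (\<Sum>i=1..N. block b i x)" by (simp add: inner_sum_right)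
  then show ?thesis unfolding sum_blocks[OF assms] by (simp only: power2_norm_eq_inner)
qed

text \<open>Moving from \<open>x\<close> a fraction \<open>t\<close> towards \<open>y\<close>
  changes the quadratic by \<open>t * A + t * t / 2 * q\<close>, which is negative for small
  \<open>t\<close> if \<open>A < 0\<close>.\<close>

lemma quadratic_minimizer_first_order:
  fixes M :: "real^'n^'n"
  assumes S: "convex S" and M: "transpose M = M" and x: "x \<in> S" and y: "y \<in> S"
    and min: "\<And>y. y \<in> S \<Longrightarrow> g \<bullet> (x - c) + 1/2 * ((x - c) \<bullet> (M *v (x - c))) \<le> g \<bullet> (y - c) + 1/2 * ((y - c) \<bullet> (M *v (y - c)))"
  shows "0 \<le> (g + M *v (x - c)) \<bullet> (y - x)"
proof (rule ccontr)
  define A q where "A = (g + M *v (x - c)) \<bullet> (y - x)" and "q = (y - x) \<bullet> (M *v (y - x))"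
  assume "\<not> ?thesis"
  then have A: "A < 0" by (simp add: A_def)
  have s: "a \<bullet> (M *v d) = d \<bullet> (M *v a)" for a d
    by (metis dot_lmul_matrix inner_commute M vector_transpose_matrix)
  have step: "0 \<le> A + t / 2 * q" if t: "0 < t" "t \<le> 1" for t
  proof -
    have "x + t *\<^sub>R (y - x) = (1 - t) *\<^sub>R x + t *\<^sub>R y" by (simp add: algebra_simps)
    then have "x + t *\<^sub>R (y - x) \<in> S" using convexD[OF S x y, of "1 - t" t] t by simp
    from min[OF this] have m: "g \<bullet> (x - c) + 1/2 * ((x - c) \<bullet> (M *v (x - c)))
        \<le> g \<bullet> ((x - c) + t *\<^sub>R (y - x)) + 1/2 * (((x - c) + t *\<^sub>R (y - x)) \<bullet> (M *v ((x - c) + t *\<^sub>R (y - x))))"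
      by (simp add: algebra_simps)
    have "((x - c) + t *\<^sub>R (y - x)) \<bullet> (M *v ((x - c) + t *\<^sub>R (y - x)))
        = (x - c) \<bullet> (M *v (x - c)) + 2 * t * ((M *v (x - c)) \<bullet> (y - x)) + t * t * q"
      using s[of "x - c" "y - x"]
      by (simp add: q_def matrix_vector_right_distrib matrix_vector_mult_scaleR inner_add_left inner_add_right inner_commute)
    with m have "0 \<le> t * A + t * t / 2 * q" by (simp add: A_def inner_add_left inner_add_right distrib_left)
    then have "0 \<le> t * (A + t / 2 * q)" by (simp add: algebra_simps)
    then show ?thesis using t(1) by (simp add: zero_le_mult_iff)
  qed
  \<comment> \<open>Small enough that \<open>t * q\<close> is at most \<open>- A\<close>, so half of
    \<open>A\<close> survives; at most 1 to stay on the segment.\<close>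
  define t where "t = min 1 (- A / (\<bar>q\<bar> + 1))"
  have "t \<le> - A / (\<bar>q\<bar> + 1)" by (simp add: t_def)
  then have "t * (\<bar>q\<bar> + 1) \<le> - A" by (subst (asm) pos_le_divide_eq) auto
  moreover have "0 < - A / (\<bar>q\<bar> + 1)" using A by (intro divide_pos_pos) auto
  then have "0 < t" "t \<le> 1" by (auto simp: t_def)
  ultimately have t: "0 < t" "t \<le> 1" "t * (\<bar>q\<bar> + 1) \<le> - A" by auto
  have "t * q \<le> t * (\<bar>q\<bar> + 1)" using t by (intro mult_left_mono) auto
  then have "A + t * q \<le> 0" using t(3) by linarith
  then have "A + t / 2 * q \<le> A / 2" by (simp add: field_simps)
  then show False using step[OF t(1,2)] A by simp
qed

section \<open>Intermediate points of a sweep and the block subproblems\<close>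

lemma sweep_point_first:
  assumes "range b = {1..N}" shows "sweep_point b 1 y x = x"
proof -
  have "\<not> b k < 1" for k using assms by (metis atLeastAtMost_iff not_less rangeI)
  then show ?thesis by (simp only: sweep_point_def if_False vec_eq_iff vec_lambda_beta) blast
qed

lemma sweep_point_last:
  assumes "range b = {1..N}" shows "sweep_point b (Suc N) y x = y"
proof -
  have "b k \<le> N" for k using assms by (metis atLeastAtMost_iff rangeI)
  then show ?thesis by (simp add: sweep_point_def vec_eq_iff less_Suc_eq_le)
qed

lemma sweep_point_Suc: "sweep_point b (Suc i) y x = sweep_point b i y x + block b i (y - x)"
  by (auto simp: sweep_point_def block_def vec_eq_iff)

lemma block_sweep_point: "block b j (sweep_point b i y x) = (if j < i then block b j y else block b j x)"
  by (auto simp: sweep_point_def block_def vec_eq_iff)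

lemma norm_sweep_point_diff: "norm (y - sweep_point b i y x) \<le> norm (y - x)"
  by (rule norm_le_componentwise_cart) (simp add: sweep_point_def)

lemma block_prod_properties:
  fixes b :: "'n::finite \<Rightarrow> nat"
  assumes b: "range b = {1..N}" and Zs: "\<And>i. i \<in> {1..N} \<Longrightarrow> polytope (Zs i)"
  shows "compact (block_prod b N Zs)" "convex (block_prod b N Zs)" "sa_pred (\<lambda>x. x \<in> block_prod b N Zs)"
proof -
  have eq: "block_prod b N Zs = (\<Inter>i\<in>{1..N}. block b i -` Zs i)" by (auto simp: block_prod_def)
  have "closed (block_prod b N Zs)" unfolding eq
    using linear_continuous_on[OF bounded_linear_block] polytope_imp_closed[OF Zs]
    by (intro closed_INT ballI closed_vimage) auto
  moreover have "bounded (block_prod b N Zs)"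
  proof -
    have "\<forall>i\<in>{1..N}. \<exists>K. \<forall>x\<in>Zs i. norm x \<le> K" using polytope_imp_bounded[OF Zs] bounded_iff by blast
    then obtain K where K: "\<And>i x. i \<in> {1..N} \<Longrightarrow> x \<in> Zs i \<Longrightarrow> norm x \<le> K i" by metis
    have "norm x \<le> (\<Sum>i=1..N. K i)" if "x \<in> block_prod b N Zs" for x
    proof -
      have "norm x \<le> (\<Sum>i=1..N. norm (block b i x))" using norm_sum[of "\<lambda>i. block b i x" "{1..N}"] unfolding sum_blocks[OF b] .
      also have "\<dots> \<le> (\<Sum>i=1..N. K i)" using K that by (intro sum_mono) (auto simp: block_prod_def)
      finally show ?thesis .
    qed
    then show ?thesis unfolding bounded_iff by blast
  qed
  ultimately show "compact (block_prod b N Zs)" by (simp add: compact_eq_bounded_closed)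
  show "convex (block_prod b N Zs)" unfolding eq
    by (intro convex_INT convex_linear_vimage linear_block polytope_imp_convex Zs)
  have "sa_pred (\<lambda>x. \<forall>i\<in>{1..N}. block b i x \<in> Zs i)"
    by (intro sa_ball_finite finite_atLeastAtMost sa_comp[OF sa_polytope[OF Zs]]
        sa_fun_linear[OF bounded_linear_block sa_fun_id])
  then show "sa_pred (\<lambda>x. x \<in> block_prod b N Zs)" by (simp add: block_prod_def)
qed

text \<open>Comparing the minimiser with the current block yields the decrease (second claim); its
  first-order condition yields the variational inequality (third claim). The projection of the
  gradient onto the block disappears because it is tested only against vectors of that
  block.\<close>

lemma bcd_sequenceD:
  assumes z: "bcd_sequence b N L Zs B \<alpha> z" and i: "i \<in> {1..N}"
    and Zs: "convex (Zs i)" "Zs i \<subseteq> block_space b i" and sym: "transpose (B i l) = B i l"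
  defines "d \<equiv> \<lambda>l. block b i (z (Suc l) - z l)" and "w \<equiv> \<lambda>l. sweep_point b i (z (Suc l)) (z l)"
  shows "block b i (z l) \<in> Zs i"
    "gradient L (w l) \<bullet> d l + 1/2 * (d l \<bullet> (B i l *v d l) + \<alpha> i l * (norm (d l))\<^sup>2) \<le> 0"
    "y \<in> Zs i \<Longrightarrow> 0 \<le> gradient L (w l) \<bullet> (y - block b i (z (Suc l)))
        + (B i l *v d l) \<bullet> (y - block b i (z (Suc l))) + \<alpha> i l * (d l \<bullet> (y - block b i (z (Suc l))))"
proof -
  define g where "g = block b i (gradient L (w l))"
  define M where "M = B i l + \<alpha> i l *\<^sub>R mat 1"
  have mem: "block b i (z l) \<in> Zs i" for l
    using z i by (cases l) (auto simp: bcd_sequence_def is_arg_min_def block_prod_def)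
  then show "block b i (z l) \<in> Zs i" .
  have min: "g \<bullet> (block b i (z (Suc l)) - block b i (z l)) + 1/2 * ((block b i (z (Suc l)) - block b i (z l)) \<bullet> (M *v (block b i (z (Suc l)) - block b i (z l))))
     \<le> g \<bullet> (x - block b i (z l)) + 1/2 * ((x - block b i (z l)) \<bullet> (M *v (x - block b i (z l))))" if "x \<in> Zs i" for x
    using z i that unfolding bcd_sequence_def is_arg_min_def g_def M_def w_def by (auto simp: not_less)
  have d: "block b i (z (Suc l)) - block b i (z l) = d l" by (simp add: d_def linear_diff[OF linear_block])
  have dB: "d l \<in> block_space b i" by (simp add: d_def block_in_block_space)
  have gd: "g \<bullet> v = gradient L (w l) \<bullet> v" if "v \<in> block_space b i" for v
    using inner_block[of "gradient L (w l)" b i v] block_eq_self[OF that] by (simp add: g_def)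
  have Md: "M *v v = B i l *v v + \<alpha> i l *\<^sub>R v" for v
    by (simp add: M_def matrix_vector_mult_add_rdistrib scaleR_matrix_vector_assoc[symmetric])
  show "gradient L (w l) \<bullet> d l + 1/2 * (d l \<bullet> (B i l *v d l) + \<alpha> i l * (norm (d l))\<^sup>2) \<le> 0"
    using min[OF mem[of l]] unfolding d by (simp add: gd[OF dB] Md inner_add_right power2_norm_eq_inner)
  assume y: "y \<in> Zs i"
  have "transpose M = M"
    using sym by (simp add: M_def transpose_def mat_def vec_eq_iff)
  from quadratic_minimizer_first_order[OF Zs(1) this mem[of "Suc l"] y min]
  have "0 \<le> (g + M *v d l) \<bullet> (y - block b i (z (Suc l)))" unfolding d by simp
  moreover have "y - block b i (z (Suc l)) \<in> block_space b i"
    using y Zs(2) mem[of "Suc l"] by (intro subspace_diff subspace_block_space) auto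
  ultimately show "0 \<le> gradient L (w l) \<bullet> (y - block b i (z (Suc l)))
        + (B i l *v d l) \<bullet> (y - block b i (z (Suc l))) + \<alpha> i l * (d l \<bullet> (y - block b i (z (Suc l))))"
    by (simp add: gd Md inner_add_left)
qed

lemma block_pos_def_bounds:
  assumes "block_pos_def b i (B - C *\<^sub>R mat 1)" "block_pos_def b i (D *\<^sub>R mat 1 - B)" "v \<in> block_space b i"
  shows "C * (norm v)\<^sup>2 \<le> v \<bullet> (B *v v)" "v \<bullet> (B *v v) \<le> D * (norm v)\<^sup>2"
  using assms unfolding block_pos_def_def
  by (cases "v = 0"; force simp: matrix_vector_mult_diff_rdistrib scaleR_matrix_vector_assoc[symmetric]
      inner_diff_right power2_norm_eq_inner)+

text \<open>The structure of \<open>L\<close> enters through \<open>descent\<close> alone. The lower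
  bound on \<open>B\<close> absorbs the curvature \<open>C i\<close>, so the proximal term remains
  as net decrease; the upper bound on \<open>B\<close> and on \<alpha> controls the slope at the new
  iterate.\<close>

lemma bcd_convergence:
  fixes b :: "'n::finite \<Rightarrow> nat" and L :: "real^'n \<Rightarrow> real" and N :: nat and Zs :: "nat \<Rightarrow> (real^'n) set"
  defines "Z \<equiv> block_prod b N Zs"
  assumes b: "range b = {1..N}"
    and L: "C2 L" "sa_fun L"
    and descent: "\<And>i x d. i \<in> {1..N} \<Longrightarrow> x \<in> Z \<Longrightarrow> x + d \<in> Z \<Longrightarrow> d \<in> block_space b i \<Longrightarrow>
          L (x + d) \<le> L x + gradient L x \<bullet> d + C i / 2 * (norm d)\<^sup>2"
    and Zs: "\<And>i. i \<in> {1..N} \<Longrightarrow> polytope (Zs i)" "\<And>i. i \<in> {1..N} \<Longrightarrow> Zs i \<subseteq> block_space b i"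
    and \<alpha>: "\<And>i. i \<in> {1..N} \<Longrightarrow> \<exists>lo hi. 0 < lo \<and> lo < hi \<and> (\<forall>l. \<alpha> i l \<in> {lo..hi})"
    and sym: "\<And>i l. i \<in> {1..N} \<Longrightarrow> transpose (B i l) = B i l"
    and pos: "\<And>i l. i \<in> {1..N} \<Longrightarrow> block_pos_def b i (B i l)"
    and lower: "\<And>i l. i \<in> {1..N} \<Longrightarrow> block_pos_def b i (B i l - C i *\<^sub>R mat 1)"
    and upper: "\<And>i l. i \<in> {1..N} \<Longrightarrow> block_pos_def b i ((2 * C i) *\<^sub>R mat 1 - B i l)"
    and z: "bcd_sequence b N L Zs B \<alpha> z"
  shows "\<exists>z'\<in>Z. z \<longlonglongrightarrow> z' \<and> (\<forall>y\<in>Z. 0 \<le> gradient L z' \<bullet> (y - z'))"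
proof -
  have Zp: "compact Z" "convex Z" "sa_pred (\<lambda>x. x \<in> Z)"
    unfolding Z_def by (rule block_prod_properties[OF b]; rule Zs(1); assumption)+
  have zZs: "block b i (z l) \<in> Zs i" if "i \<in> {1..N}" for i l
    using bcd_sequenceD(1)[OF z that polytope_imp_convex[OF Zs(1)[OF that]] Zs(2)[OF that] sym[OF that]] .
  have N: "{1..N} \<noteq> {}" using b by blast
  obtain lo hi where lh: "\<And>i. i \<in> {1..N} \<Longrightarrow> 0 < lo i \<and> lo i < hi i \<and> (\<forall>l. \<alpha> i l \<in> {lo i..hi i})"
    using \<alpha> by metis
  define w d where "w l i = sweep_point b i (z (Suc l)) (z l)" and "d l i = block b i (z (Suc l) - z l)" for l i
  have zZ: "z l \<in> Z" for l using zZs by (simp add: Z_def block_prod_def)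
  have wZ: "w l i \<in> Z" for l i using zZs by (simp add: Z_def block_prod_def w_def block_sweep_point)
  have w_Suc: "w l (Suc i) = w l i + d l i" for l i by (simp add: w_def d_def sweep_point_Suc)
  have dB: "d l i \<in> block_space b i" for l i by (simp add: d_def block_in_block_space)
  \<comment> \<open>Half of the least proximal weight, the part of the subproblem left after
    \<open>B\<close> has absorbed the curvature.\<close>
  define a where "a = Min (lo ` {1..N}) / 2"
  have a: "a > 0" using lh N by (simp add: a_def)
  have a_lo: "a \<le> \<alpha> i l / 2" if "i \<in> {1..N}" for i l
  proof -
    have "Min (lo ` {1..N}) \<le> lo i" using that by simp
    then show ?thesis using lh[OF that] by (simp add: a_def) (meson atLeastAtMost_iff order_trans)
  qed
  have block_step: "L (w l (Suc i)) \<le> L (w l i) - a * (norm (d l i))\<^sup>2" if i: "i \<in> {1..N}" for i l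
  proof -
    have "L (w l (Suc i)) \<le> L (w l i) + gradient L (w l i) \<bullet> d l i + C i / 2 * (norm (d l i))\<^sup>2"
      unfolding w_Suc using descent[OF i wZ _ dB] wZ[of l "Suc i"] by (simp add: w_Suc)
    moreover have "gradient L (w l i) \<bullet> d l i + 1/2 * (d l i \<bullet> (B i l *v d l i) + \<alpha> i l * (norm (d l i))\<^sup>2) \<le> 0"
      using bcd_sequenceD(2)[OF z i polytope_imp_convex[OF Zs(1)[OF i]] Zs(2)[OF i] sym[OF i]]
      unfolding w_def d_def .
    moreover have "C i * (norm (d l i))\<^sup>2 \<le> d l i \<bullet> (B i l *v d l i)"
      by (rule block_pos_def_bounds(1)[OF lower[OF i] upper[OF i] dB])
    moreover have "a * (norm (d l i))\<^sup>2 \<le> \<alpha> i l / 2 * (norm (d l i))\<^sup>2"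
      by (intro mult_right_mono a_lo i) simp
    ultimately show ?thesis by argo
  qed
  have sweep: "L (w l (Suc n)) \<le> L (w l 1) - a * (\<Sum>i=1..n. (norm (d l i))\<^sup>2)" if "n \<le> N" for l n
    using that
  proof (induction n)
    case (Suc n)
    then have "L (w l (Suc (Suc n))) \<le> L (w l (Suc n)) - a * (norm (d l (Suc n)))\<^sup>2" by (intro block_step) auto
    then show ?case using Suc by (simp add: distrib_left)
  qed simp
  have decrease: "a * (norm (z (Suc l) - z l))\<^sup>2 \<le> L (z l) - L (z (Suc l))" for l
    using sweep[of N l] sweep_point_first[OF b] sweep_point_last[OF b] norm_sum_blocks[OF b, of "z (Suc l) - z l"]
    by (simp add: w_def d_def)
  obtain K where K0: "K \<ge> 0 \<and>
      (\<forall>x\<in>Z. \<forall>y\<in>Z. norm (gradient L x - gradient L y) \<le> K * norm (x - y)) \<and>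
      (\<forall>x\<in>Z. \<forall>y\<in>Z. L x + gradient L x \<bullet> (y - x) - K * (norm (y - x))\<^sup>2 \<le> L y)"
    using C2_lipschitz_gradient[OF L(1) Zp(1,2)] by (elim exE)
  have K: "K \<ge> 0" by (rule K0[THEN conjunct1])
  note lipschitz = K0[THEN conjunct2, THEN conjunct1, rule_format]
  note lower_model = K0[THEN conjunct2, THEN conjunct2, rule_format]
  \<comment> \<open>Per block: \<open>K\<close> for the change of the gradient between the sweep
    point and the new iterate, \<open>2 * \<bar>C i\<bar>\<close> for \<open>B\<close>, and
    \<open>hi i\<close> for the proximal weight.\<close>
  define bb where "bb = (\<Sum>i=1..N. K + 2 * \<bar>C i\<bar> + hi i)"
  have bb: "bb \<ge> 0" unfolding bb_def using K lh by (intro sum_nonneg) force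
  \<comment> \<open>This serves twice: with the lower quadratic model it is the slope estimate, and
    since the steps tend to 0 its limit is stationarity.\<close>
  have variational: "- (bb * norm (z (Suc l) - z l) * norm (y - z (Suc l))) \<le> gradient L (z (Suc l)) \<bullet> (y - z (Suc l))"
    if y: "y \<in> Z" for y l
  proof -
    define u where "u i = block b i (y - z (Suc l))" for i
    define D U where "D = norm (z (Suc l) - z l)" and "U = norm (y - z (Suc l))"
    have each: "- ((K + 2 * \<bar>C i\<bar> + hi i) * D * U) \<le> gradient L (z (Suc l)) \<bullet> u i" if i: "i \<in> {1..N}" for i
    proof -
      have ui: "u i = block b i y - block b i (z (Suc l))" by (simp add: u_def linear_diff[OF linear_block])
      have uB: "u i \<in> block_space b i" by (simp add: u_def block_in_block_space)
      have nU: "norm (u i) \<le> U" and nD: "norm (d l i) \<le> D" by (simp_all add: u_def U_def d_def D_def norm_block_le)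
      have DU: "norm (d l i) * norm (u i) \<le> D * U" using nU nD by (intro mult_mono) (auto simp: D_def)
      have "block b i y \<in> Zs i" using y i by (simp add: Z_def block_prod_def)
      from bcd_sequenceD(3)[OF z i polytope_imp_convex[OF Zs(1)[OF i]] Zs(2)[OF i] sym[OF i] this, of l]
      have "0 \<le> gradient L (w l i) \<bullet> u i + (B i l *v d l i) \<bullet> u i + \<alpha> i l * (d l i \<bullet> u i)"
        by (simp add: w_def d_def ui)
      moreover have "(gradient L (w l i) - gradient L (z (Suc l))) \<bullet> u i \<le> K * (D * U)"
      proof -
        have "(gradient L (w l i) - gradient L (z (Suc l))) \<bullet> u i \<le> norm (gradient L (w l i) - gradient L (z (Suc l))) * norm (u i)"
          by (rule norm_cauchy_schwarz)
        also have "\<dots> \<le> (K * norm (z (Suc l) - w l i)) * U"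
          using lipschitz[OF zZ[of "Suc l"] wZ[of l i]] nU K by (intro mult_mono) (auto simp: norm_minus_commute)
        also have "\<dots> \<le> K * D * U"
          using norm_sweep_point_diff[of "z (Suc l)" b i "z l"] K
          by (intro mult_right_mono mult_left_mono) (auto simp: w_def D_def U_def)
        finally show ?thesis by simp
      qed
      moreover have "(B i l *v d l i) \<bullet> u i \<le> 2 * \<bar>C i\<bar> * (D * U)"
      proof -
        have "0 \<le> v \<bullet> (B i l *v v)" if "v \<in> block_space b i" for v
          using pos[OF i, of l] that unfolding block_pos_def_def by (cases "v = 0") force+
        then have "(B i l *v d l i) \<bullet> u i \<le> 2 * C i * norm (d l i) * norm (u i)"
          using block_pos_def_bounds(2)[OF lower[OF i] upper[OF i]]
          by (intro psd_inner_le[OF sym[OF i] subspace_block_space _ _ dB uB]) auto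
        also have "\<dots> \<le> 2 * \<bar>C i\<bar> * (norm (d l i) * norm (u i))"
          by (simp add: mult_right_mono mult.assoc)
        also have "\<dots> \<le> 2 * \<bar>C i\<bar> * (D * U)" by (intro mult_left_mono DU) simp
        finally show ?thesis .
      qed
      moreover have "\<alpha> i l * (d l i \<bullet> u i) \<le> hi i * (D * U)"
      proof -
        have al: "0 \<le> \<alpha> i l" "\<alpha> i l \<le> hi i" using lh[OF i] by (auto intro: order_trans[OF less_imp_le])
        have "\<alpha> i l * (d l i \<bullet> u i) \<le> \<alpha> i l * (D * U)"
          using norm_cauchy_schwarz[of "d l i" "u i"] DU al by (intro mult_left_mono) auto
        also have "\<dots> \<le> hi i * (D * U)" using al by (intro mult_right_mono) (auto simp: D_def U_def)
        finally show ?thesis .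
      qed
      ultimately have "0 \<le> gradient L (z (Suc l)) \<bullet> u i + (K * (D * U) + 2 * \<bar>C i\<bar> * (D * U) + hi i * (D * U))"
        by (simp add: inner_diff_left)
      then show ?thesis by (simp add: algebra_simps)
    qed
    have "- (bb * D * U) = (\<Sum>i=1..N. - ((K + 2 * \<bar>C i\<bar> + hi i) * D * U))"
      by (simp add: bb_def sum_negf sum_distrib_right)
    also have "\<dots> \<le> (\<Sum>i=1..N. gradient L (z (Suc l)) \<bullet> u i)" by (intro sum_mono each)
    also have "\<dots> = gradient L (z (Suc l)) \<bullet> (y - z (Suc l))"
      unfolding u_def inner_sum_right[symmetric] sum_blocks[OF b] ..
    finally show ?thesis by (simp add: D_def U_def)
  qed
  have "summable (\<lambda>l. norm (z (Suc l) - z l))"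
  proof (rule sa_descent_finite_length[where z = z, OF Zp(1,3) L(2) C2_continuous(1)[OF L(1)] zZ a bb K decrease])
    fix l y assume y: "y \<in> Z"
    show "L (z (Suc l)) - bb * norm (z (Suc l) - z l) * norm (y - z (Suc l)) - K * (norm (y - z (Suc l)))\<^sup>2 \<le> L y"
      using variational[OF y, of l] lower_model[OF zZ[of "Suc l"] y] by linarith
  qed
  note sm = this
  from summable_increments_convergent[OF sm] obtain z' where z': "z \<longlonglongrightarrow> z'" by (auto simp: convergent_def)
  have z'Z: "z' \<in> Z" using closed_sequentially[OF compact_imp_closed[OF Zp(1)]] zZ z' by blast
  have "0 \<le> gradient L z' \<bullet> (y - z')" if y: "y \<in> Z" for y
  proof (rule tendsto_le[OF sequentially_bot])
    have zS: "(\<lambda>l. z (Suc l)) \<longlonglongrightarrow> z'" using LIMSEQ_Suc[OF z'] .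
    have "(\<lambda>l. gradient L (z (Suc l))) \<longlonglongrightarrow> gradient L z'"
      using continuous_on_tendsto_compose[OF C2_continuous(2)[OF L(1)] zS] by simp
    then show "(\<lambda>l. gradient L (z (Suc l)) \<bullet> (y - z (Suc l))) \<longlonglongrightarrow> gradient L z' \<bullet> (y - z')"
      by (intro tendsto_intros zS)
    have "(\<lambda>l. - (bb * norm (z (Suc l) - z l) * norm (y - z (Suc l)))) \<longlonglongrightarrow> - (bb * 0 * norm (y - z'))"
      by (intro tendsto_intros zS summable_LIMSEQ_zero[OF sm])
    then show "(\<lambda>l. - (bb * norm (z (Suc l) - z l) * norm (y - z (Suc l)))) \<longlonglongrightarrow> 0" by simp
    show "\<forall>\<^sub>F l in sequentially. - (bb * norm (z (Suc l) - z l) * norm (y - z (Suc l))) \<le> gradient L (z (Suc l)) \<bullet> (y - z (Suc l))"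
      using variational[OF y] by simp
  qed
  then show ?thesis using z' z'Z by blast
qed

section \<open>Splitting the augmented Lagrangian into separable and coupled terms\<close>

lemma gradient_add:
  assumes "C2 f" "C2 g" shows "gradient (\<lambda>x. f x + g x) x = gradient f x + gradient g x"
  by (rule gradient_eq) (unfold inner_add_left, intro has_derivative_add C2D assms)

lemma gradient_sum:
  assumes "finite I" "\<And>i. i \<in> I \<Longrightarrow> C2 (f i)"
  shows "gradient (\<lambda>x. \<Sum>i\<in>I. f i x) x = (\<Sum>i\<in>I. gradient (f i) x)"
  by (rule gradient_eq) (unfold inner_sum_left, intro has_derivative_sum C2D assms)

lemma sa_fun_penalty:
  assumes "sa_fun (\<lambda>x. h (g x))" shows "sa_fun (\<lambda>x. penalty h \<rho> \<nu> (g x))"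
  unfolding penalty_def power2_eq_square
  by (intro sa_fun_add sa_fun_mult sa_fun_inner sa_fun_norm sa_fun_const assms)

text \<open>For each row at most one of the vectors \<open>F i\<close> and \<open>G\<close> is
  nonzero. A general \<phi> vanishing at 0 covers both the linear multiplier term and the
  square.\<close>

lemma constraint_map_split:
  fixes b :: "'n::finite \<Rightarrow> nat" and c :: "'r::finite \<Rightarrow> nat option"
  assumes rows: "range c \<subseteq> insert None (Some ` {1..N})"
    and F: "\<And>i x. i \<in> {1..N} \<Longrightarrow> x \<in> block_space b i \<Longrightarrow> F i x \<in> block_space c (Some i)"
    and G: "\<And>x. G x \<in> block_space c None" and \<phi>: "\<phi> 0 = (0::real)"
  shows "\<phi> (constraint_map b c F G z $ k) = (\<Sum>i=1..N. \<phi> (F i (block b i z) $ k)) + \<phi> (G z $ k)"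
proof -
  have F0: "F i (block b i z) $ k = 0" if "i \<in> {1..N}" "c k \<noteq> Some i" for i
    using F[OF that(1) block_in_block_space] that(2) by (auto simp: block_space_def)
  have G0: "G z $ k = 0" if "c k \<noteq> None" using G[of z] that by (auto simp: block_space_def)
  show ?thesis
  proof (cases "c k")
    case None
    then have "(\<Sum>i=1..N. \<phi> (F i (block b i z) $ k)) = 0" using F0 \<phi> by (intro sum.neutral) auto
    then show ?thesis using None by (simp add: constraint_map_def)
  next
    case (Some j)
    then have j: "j \<in> {1..N}" using rows by (metis image_iff insert_iff option.distinct(1) option.inject rangeI subsetD)
    have "(\<Sum>i=1..N. \<phi> (F i (block b i z) $ k)) = (\<Sum>i=1..N. if i = j then \<phi> (F j (block b j z) $ k) else 0)"
      using F0 Some \<phi> by (intro sum.cong) auto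
    also have "\<dots> = \<phi> (F j (block b j z) $ k)" using j by (subst sum.delta) auto
    finally show ?thesis using Some G0 \<phi> by (simp add: constraint_map_def)
  qed
qed

text \<open>The row supports are disjoint, so the multiplier term and the squared norm are both
  additive; restricting \<mu> to a block of rows does not change its inner product with a vector
  supported there.\<close>

lemma aug_lagrangian_split:
  fixes b :: "'n::finite \<Rightarrow> nat" and c :: "'r::finite \<Rightarrow> nat option"
  assumes rows: "range c \<subseteq> insert None (Some ` {1..N})"
    and F: "\<And>i x. i \<in> {1..N} \<Longrightarrow> x \<in> block_space b i \<Longrightarrow> F i x \<in> block_space c (Some i)"
    and G: "\<And>x. G x \<in> block_space c None"
  shows "aug_lagrangian (objective b N J Q) (constraint_map b c F G) \<rho> \<mu> z =
    (\<Sum>i=1..N. J i (block b i z)) + ((\<Sum>i=1..N. penalty (F i) \<rho> (block c (Some i) \<mu>) (block b i z))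
      + (penalty G \<rho> (block c None \<mu>) z + Q z))"
proof -
  let ?H = "constraint_map b c F G z"
  note split = constraint_map_split[OF rows F G]
  have blk: "block c k \<mu> \<bullet> x = \<mu> \<bullet> x" if "x \<in> block_space c k" for k x
    using inner_block[of \<mu> c k x] block_eq_self[OF that] by simp
  have lin: "\<mu> \<bullet> ?H = (\<Sum>i=1..N. block c (Some i) \<mu> \<bullet> F i (block b i z)) + block c None \<mu> \<bullet> G z"
  proof -
    have "\<mu> \<bullet> ?H = (\<Sum>k\<in>UNIV. (\<Sum>i=1..N. \<mu> $ k * F i (block b i z) $ k) + \<mu> $ k * G z $ k)"
      unfolding inner_vec_def inner_real_def
      by (intro sum.cong refl split[where \<phi> = "\<lambda>t. \<mu> $ k * t" for k]) auto
    also have "\<dots> = (\<Sum>i=1..N. \<mu> \<bullet> F i (block b i z)) + \<mu> \<bullet> G z"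
      unfolding sum.distrib inner_vec_def inner_real_def by (subst sum.swap) (rule refl)
    also have "(\<Sum>i=1..N. \<mu> \<bullet> F i (block b i z)) = (\<Sum>i=1..N. block c (Some i) \<mu> \<bullet> F i (block b i z))"
      by (intro sum.cong refl blk[symmetric] F block_in_block_space)
    finally show ?thesis using blk[OF G] by simp
  qed
  have sq: "(norm ?H)\<^sup>2 = (\<Sum>i=1..N. (norm (F i (block b i z)))\<^sup>2) + (norm (G z))\<^sup>2"
  proof -
    have "(norm ?H)\<^sup>2 = (\<Sum>k\<in>UNIV. (\<Sum>i=1..N. F i (block b i z) $ k * F i (block b i z) $ k) + G z $ k * G z $ k)"
      unfolding power2_norm_eq_inner inner_vec_def inner_real_def
      by (intro sum.cong refl split[where \<phi> = "\<lambda>t. t * t"]) auto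
    also have "\<dots> = (\<Sum>i=1..N. (norm (F i (block b i z)))\<^sup>2) + (norm (G z))\<^sup>2"
      unfolding sum.distrib power2_norm_eq_inner inner_vec_def inner_real_def by (subst sum.swap) (rule refl)
    finally show ?thesis .
  qed
  show ?thesis
    unfolding aug_lagrangian_def objective_def penalty_def lin sq
    by (simp add: sum.distrib sum_distrib_left distrib_left)
qed

lemma block_plus_block_space:
  assumes "d \<in> block_space b i" shows "block b j (x + d) = (if j = i then block b i x + d else block b j x)"
  using assms by (auto simp: block_def block_space_def vec_eq_iff)

text \<open>Only the \<open>i\<close>-th summand changes along \<open>d\<close>. Its Hessian is
  bounded on \<open>Zs i\<close>, hence at padded block points, so the estimate is made at
  \<open>block b i x\<close> and carried back to \<open>x\<close> by invariance.\<close>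

lemma block_function_descent:
  fixes b :: "'n::finite \<Rightarrow> nat" and A :: "nat \<Rightarrow> real^'n \<Rightarrow> real"
  assumes A: "\<And>j. j \<in> {1..N} \<Longrightarrow> C2 (\<lambda>x. A j (block b j x))"
    and Zs: "compact (Zs i)" "convex (Zs i)" and i: "i \<in> {1..N}"
    and x: "block b i x \<in> Zs i" "block b i (x + d) \<in> Zs i" and d: "d \<in> block_space b i"
  shows "(\<Sum>j=1..N. A j (block b j (x + d))) \<le> (\<Sum>j=1..N. A j (block b j x))
    + gradient (\<lambda>x. \<Sum>j=1..N. A j (block b j x)) x \<bullet> d
    + hess_bound b i (\<lambda>x. A i (block b i x)) (Zs i) / 2 * (norm d)\<^sup>2"
proof -
  define h where "h j x = A j (block b j x)" for j x
  have h: "C2 (h j)" if "j \<in> {1..N}" for j using A[OF that] by (simp add: h_def[abs_def])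
  have bb: "block b j (block b j x) = block b j x" for j x by (rule block_eq_self[OF block_in_block_space])
  have inv: "h j (block b j x) = h j x" for j x by (simp add: h_def bb)
  have bd: "block b j d = (if j = i then d else 0)" for j
    using block_plus_block_space[OF d, of j 0] linear_0[OF linear_block[of b j]] linear_0[OF linear_block[of b i]] by simp
  have "h i (block b i x + d) \<le> h i (block b i x) + gradient (h i) (block b i x) \<bullet> d + hess_bound b i (h i) (Zs i) / 2 * (norm d)\<^sup>2"
    using block_descent[OF h[OF i] Zs x(1) _ d] x(2) by (simp add: block_plus_block_space[OF d])
  moreover have "gradient (h i) (block b i x) \<bullet> d = gradient (h i) x \<bullet> d"
    using gradient_through_block[of "h i" b i x d, OF h[OF i] inv] by (simp add: bd)
  moreover have "h i (block b i x + d) = h i (x + d)" by (simp add: h_def block_plus_block_space[OF d] linear_add[OF linear_block] bb bd)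
  ultimately have hi: "h i (x + d) \<le> h i x + gradient (h i) x \<bullet> d + hess_bound b i (h i) (Zs i) / 2 * (norm d)\<^sup>2"
    by (simp add: inv)
  \<comment> \<open>The other summands keep their values, and their gradients are orthogonal to
    \<open>d\<close>.\<close>
  have "h j (x + d) - h j x - gradient (h j) x \<bullet> d = 0" if "j \<in> {1..N} - {i}" for j
    using gradient_through_block[of "h j" b j x d, OF h inv] that by (simp add: bd h_def block_plus_block_space[OF d])
  then have "(\<Sum>j=1..N. h j (x + d) - h j x - gradient (h j) x \<bullet> d) = h i (x + d) - h i x - gradient (h i) x \<bullet> d"
    unfolding sum.remove[OF finite_atLeastAtMost i] by (simp add: sum.neutral)
  then have "(\<Sum>j=1..N. h j (x + d)) - (\<Sum>j=1..N. h j x) - gradient (\<lambda>x. \<Sum>j=1..N. h j x) x \<bullet> d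
      = h i (x + d) - h i x - gradient (h i) x \<bullet> d"
    using gradient_sum[of "{1..N}" h x] h by (simp add: sum_subtractf inner_sum_left)
  then show ?thesis using hi unfolding h_def by simp
qed

theorem theorem3:
  fixes N :: nat
    and b :: "'n::finite \<Rightarrow> nat"
    and c :: "'r::finite \<Rightarrow> nat option"
    and J :: "nat \<Rightarrow> real^'n \<Rightarrow> real"
    and Q :: "real^'n \<Rightarrow> real"
    and F :: "nat \<Rightarrow> real^'n \<Rightarrow> real^'r"
    and G :: "real^'n \<Rightarrow> real^'r"
    and Zs :: "nat \<Rightarrow> (real^'n) set"
    and \<rho> :: real
    and \<mu> :: "real^'r"
    and B :: "nat \<Rightarrow> nat \<Rightarrow> real^'n^'n"
    and \<alpha> :: "nat \<Rightarrow> nat \<Rightarrow> real"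
    and z :: "nat \<Rightarrow> real^'n"
  defines "Z \<equiv> block_prod b N Zs"
    and "L \<equiv> aug_lagrangian (objective b N J Q) (constraint_map b c F G) \<rho> \<mu>"
    and "C \<equiv> curvature_const b c N J Q F G Zs \<rho> \<mu>"
  assumes N: "1 \<le> N"
    and blocks: "range b = {1..N}"
    and rows: "range c \<subseteq> insert None (Some ` {1..N})"
    and F_range: "\<And>i x. i \<in> {1..N} \<Longrightarrow> x \<in> block_space b i \<Longrightarrow> F i x \<in> block_space c (Some i)"
    and G_range: "\<And>x. G x \<in> block_space c None"
    and J_C2: "\<And>i. i \<in> {1..N} \<Longrightarrow> C2 (\<lambda>x. J i (block b i x))"
    and Q_C2: "C2 Q"
    and F_C2: "\<And>i k. i \<in> {1..N} \<Longrightarrow> C2 (\<lambda>x. F i (block b i x) $ k)"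
    and G_C2: "\<And>k. C2 (\<lambda>x. G x $ k)"
    and J_semialg: "\<And>i. i \<in> {1..N} \<Longrightarrow> semialgebraic_on (block_space b i) (J i)"
    and Q_semialg: "semialgebraic_on UNIV Q"
    and F_semialg: "\<And>i. i \<in> {1..N} \<Longrightarrow> semialgebraic_on (block_space b i) (F i)"
    and G_semialg: "semialgebraic_on UNIV G"
    and Zs_polytope: "\<And>i. i \<in> {1..N} \<Longrightarrow> polytope (Zs i)"
    and Zs_block: "\<And>i. i \<in> {1..N} \<Longrightarrow> Zs i \<subseteq> block_space b i"
    and \<rho>_pos: "\<rho> > 0"
    and \<alpha>_bounds: "\<And>i. i \<in> {1..N} \<Longrightarrow>
          \<exists>\<alpha>lo \<alpha>hi. 0 < \<alpha>lo \<and> \<alpha>lo < \<alpha>hi \<and> (\<forall>l. \<alpha> i l \<in> {\<alpha>lo..\<alpha>hi})"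
    and B_block: "\<And>i l. i \<in> {1..N} \<Longrightarrow> block_mat b i (B i l) = B i l"
    and B_sym: "\<And>i l. i \<in> {1..N} \<Longrightarrow> transpose (B i l) = B i l"
    and B_pos: "\<And>i l. i \<in> {1..N} \<Longrightarrow> block_pos_def b i (B i l)"
    and B_lower: "\<And>i l. i \<in> {1..N} \<Longrightarrow> block_pos_def b i (B i l - C i *\<^sub>R mat 1)"
    and B_upper: "\<And>i l. i \<in> {1..N} \<Longrightarrow> block_pos_def b i ((2 * C i) *\<^sub>R mat 1 - B i l)"
    and z: "bcd_sequence b N L Zs B \<alpha> z"
  shows "\<exists>z'\<in>Z. z \<longlonglongrightarrow> z' \<and>
           0 \<in> (\<lambda>v. gradient L z' + v) ` normal_cone Z z' \<and>
           infdist 0 ((\<lambda>v. gradient L z' + v) ` normal_cone Z z') = 0"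
proof -
  define P where "P i = penalty (F i) \<rho> (block c (Some i) \<mu>)" for i
  define R where "R z = penalty G \<rho> (block c None \<mu>) z + Q z" for z
  have L: "L = (\<lambda>z. (\<Sum>i=1..N. J i (block b i z)) + ((\<Sum>i=1..N. P i (block b i z)) + R z))"
    unfolding L_def P_def R_def by (rule ext) (rule aug_lagrangian_split[OF rows F_range G_range])
  have P_C2: "C2 (\<lambda>x. P i (block b i x))" if "i \<in> {1..N}" for i
  proof -
    have "C2 (\<lambda>x. penalty (\<lambda>x. F i (block b i x)) \<rho> (block c (Some i) \<mu>) x)"
      by (rule C2_penalty) (rule F_C2[OF that])
    then show ?thesis by (simp add: P_def penalty_def)
  qed
  have R_C2: "C2 R" unfolding R_def by (intro C2_add C2_penalty G_C2 Q_C2)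
  have J_sum: "C2 (\<lambda>z. \<Sum>i=1..N. J i (block b i z))" by (intro C2_sum finite_atLeastAtMost J_C2)
  have P_sum: "C2 (\<lambda>z. \<Sum>i=1..N. P i (block b i z))" by (intro C2_sum finite_atLeastAtMost P_C2)
  have L_C2: "C2 L" unfolding L by (intro C2_add J_sum P_sum R_C2)
  have blk: "sa_fun (block b i)" for i by (rule sa_fun_linear[OF bounded_linear_block sa_fun_id])
  have L_sa: "sa_fun L" unfolding L P_def R_def
    by (intro sa_fun_add sa_fun_sum finite_atLeastAtMost sa_fun_penalty
        sa_fun_semialgebraic_on[OF J_semialg blk] sa_fun_semialgebraic_on[OF F_semialg blk]
        sa_fun_semialgebraic_on[OF G_semialg sa_fun_id] sa_fun_semialgebraic_on[OF Q_semialg sa_fun_id]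
        block_in_block_space UNIV_I)
  have Zc: "compact Z" "convex Z"
    unfolding Z_def by (rule block_prod_properties[OF blocks]; rule Zs_polytope; assumption)+
  \<comment> \<open>The two separable sums and the coupled part \<open>R\<close> are estimated
    separately; their three Hessian bounds add up to \<open>C i\<close>, the coupled one being
    enlarged to the maximum over all blocks.\<close>
  have descent: "L (x + d) \<le> L x + gradient L x \<bullet> d + C i / 2 * (norm d)\<^sup>2"
    if i: "i \<in> {1..N}" and x: "x \<in> Z" "x + d \<in> Z" and d: "d \<in> block_space b i" for i x d
  proof -
    have Zi: "compact (Zs i)" "convex (Zs i)"
      using Zs_polytope[OF i] polytope_imp_compact polytope_imp_convex by auto
    have xi: "block b i x \<in> Zs i" "block b i (x + d) \<in> Zs i" using x i by (auto simp: Z_def block_prod_def)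
    define mx where "mx = (MAX j\<in>{1..N}. hess_bound b j R Z)"
    have "hess_bound b i R Z \<le> mx" unfolding mx_def using i by (intro Max_ge) auto
    then have m: "hess_bound b i R Z / 2 * (norm d)\<^sup>2 \<le> mx / 2 * (norm d)\<^sup>2" by (intro mult_right_mono) auto
    have "C i = hess_bound b i (\<lambda>x. J i (block b i x)) (Zs i) + hess_bound b i (\<lambda>x. P i (block b i x)) (Zs i) + mx"
      by (simp add: C_def curvature_const_def P_def R_def[abs_def] mx_def Z_def)
    moreover have "gradient L x = gradient (\<lambda>z. \<Sum>i=1..N. J i (block b i z)) x
        + (gradient (\<lambda>z. \<Sum>i=1..N. P i (block b i z)) x + gradient R x)"
      unfolding L by (subst gradient_add[OF J_sum C2_add[OF P_sum R_C2]]) (subst gradient_add[OF P_sum R_C2], rule refl)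
    moreover have "(\<Sum>j=1..N. J j (block b j (x + d))) \<le> (\<Sum>j=1..N. J j (block b j x))
        + gradient (\<lambda>x. \<Sum>j=1..N. J j (block b j x)) x \<bullet> d
        + hess_bound b i (\<lambda>x. J i (block b i x)) (Zs i) / 2 * (norm d)\<^sup>2"
      using block_function_descent[of N J b Zs i x d] J_C2 Zi i xi d by blast
    moreover have "(\<Sum>j=1..N. P j (block b j (x + d))) \<le> (\<Sum>j=1..N. P j (block b j x))
        + gradient (\<lambda>x. \<Sum>j=1..N. P j (block b j x)) x \<bullet> d
        + hess_bound b i (\<lambda>x. P i (block b i x)) (Zs i) / 2 * (norm d)\<^sup>2"
      using block_function_descent[of N P b Zs i x d] P_C2 Zi i xi d by blast
    moreover have "R (x + d) \<le> R x + gradient R x \<bullet> d + mx / 2 * (norm d)\<^sup>2"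
      using block_descent[OF R_C2 Zc x d] m by linarith
    ultimately show ?thesis unfolding L by (simp add: inner_add_left add_divide_distrib distrib_right)
  qed
  obtain z' where z': "z' \<in> Z" "z \<longlonglongrightarrow> z'" "\<And>y. y \<in> Z \<Longrightarrow> 0 \<le> gradient L z' \<bullet> (y - z')"
  proof -
    have "\<exists>z'\<in>Z. z \<longlonglongrightarrow> z' \<and> (\<forall>y\<in>Z. 0 \<le> gradient L z' \<bullet> (y - z'))"
      unfolding Z_def
    proof (rule bcd_convergence[where C = C, OF blocks L_C2 L_sa])
      show "bcd_sequence b N L Zs B \<alpha> z" by (rule z)
    qed (rule descent[unfolded Z_def] Zs_polytope Zs_block \<alpha>_bounds B_sym B_pos B_lower B_upper; assumption)+
    then show ?thesis using that by blast
  qed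
  have "- gradient L z' \<in> normal_cone Z z'" using z'(3) by (simp add: normal_cone_def)
  then have zero: "0 \<in> (\<lambda>v. gradient L z' + v) ` normal_cone Z z'" by (rule rev_image_eqI) simp
  then show ?thesis using z'(1,2) infdist_zero by blast
qed

end
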